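(* Let $X=\Omega_p$ be the additive group of the field of $p$-adic numbers ($p$ prime). Let $\delta_1,\delta_2,\varepsilon_1,\varepsilon_2\in\Omega_p\setminus\{0\}$ (acting as topological automorphisms of $X$ by multiplication) with $\delta_j=p^{k_j}c_j$, $\varepsilon_j=p^{l_j}d_j$, where $c_j,d_j\in\Delta_p^0$, $k_j\ge 0$, $l_j\ge 0$, $j=1,2$. Put $k=\min\{k_1,k_2,l_1,l_2\}$. Let $\Lambda$ be one of the matrices $$\Lambda_1=\begin{pmatrix}1&1&1\\1&\delta_1&\delta_2\\1&\varepsilon_1&\varepsilon_2\end{pmatrix},\qquad \Lambda_2=\begin{pmatrix}1&1&1\\\delta_1&1&\delta_2\\1&\varepsilon_1&\varepsilon_2\end{pmatrix},$$ and assume $\det\Lambda=p^q\lambda$ with $q\ge 0$ an integer and $\lambda\in\Delta_p^0$. Consider independent random variables $\xi_1,\xi_2,\xi_3$ with values in $X$ and distributions $\mu_1,\mu_2,\mu_3$, and the random vector $(L_1,L_2,L_3)=\Lambda(\xi_1,\xi_2,\xi_3)^T$, and suppose that $L_1,L_2,L_3$ are independent. Then: A. Assume $q=0$. Then the following are equivalent: (i) for every such triple $\xi_1,\xi_2,\xi_3$ of independent random variables for which $L_1,L_2,L_3$ are independent, all $\mu_j\in I(X)$; (ii) each row and each column of $\Lambda$ contains at least two elements of $\Delta_p^0$. B. Assume $q>0$. B.1. If at least one of $\delta_1,\delta_2,\varepsilon_1,\varepsilon_2$ belongs to $\Delta_p^0$, then all $\mu_j\in D(X)$. B.2. Assume none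 of $\delta_1,\delta_2,\varepsilon_1,\varepsilon_2$ belongs to $\Delta_p^0$. Then the following are equivalent: (i) for every such triple of independent random variables for which $L_1,L_2,L_3$ are independent, all $\mu_j\in I(X)$; (ii) either $q>k$ (and in this case all $\mu_j\in D(X)$), or $q=k$ and either $k_1=l_2=k$ or $k_2=l_1=k$.
   Context: $\Omega_p$ is the field of $p$-adic numbers, considered as a locally compact Abelian group under addition; $\Delta_p$ is the subgroup (ring) of $p$-adic integers, and $\Delta_p^0$ is the set of invertible elements of $\Delta_p$. Every nonzero element of $\Omega_p$ is uniquely $p^mc$ with $m\in\mathbb Z$, $c\in\Delta_p^0$, and every topological automorphism of $\Omega_p$ is multiplication by a nonzero element. $I(X)$ denotes the set of idempotent distributions on $X$, i.e. shifts of Haar distributions $m_K$ of compact subgroups $K$ of $X$; $D(X)$ denotes the set of degenerate (point-mass) distributions on $X$. *)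

theory Defs
  imports "HOL-Probability.Probability"
begin

subsection \<open>The \<open>p\<close>-adic absolute value on the rationals\<close>

text \<open>The prime \<open>p\<close> is carried by a type: \<open>p = CARD('p)\<close>. Every prime is the cardinality
  of some finite type, so a statement about all types of class \<open>prime_card\<close> is a statement
  about all primes.\<close>

class prime_card =
  assumes prime_card: "prime CARD('a)"

definition rat_padic_abs :: "nat \<Rightarrow> rat \<Rightarrow> real" where
  "rat_padic_abs p x =
     (if x = 0 then 0
      else real p powi (int (multiplicity (int p) (snd (quotient_of x)))
                      - int (multiplicity (int p) (fst (quotient_of x)))))"

lemma rat_padic_abs_0 [simp]: "rat_padic_abs p 0 = 0"
  by (simp add: rat_padic_abs_def)

lemma rat_padic_abs_divide:
  assumes "prime p" "a \<noteq> 0" "b \<noteq> 0"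
  shows "rat_padic_abs p (of_int a / of_int b) =
    real p powi (int (multiplicity (int p) b) - int (multiplicity (int p) a))"
proof -
  obtain n d where nd: "quotient_of (of_int a / of_int b) = (n, d)" by fastforce
  have d: "d > 0" using quotient_of_denom_pos[OF nd] .
  have eq: "(of_int a / of_int b :: rat) = of_int n / of_int d"
    using quotient_of_div[OF nd] .
  hence "(of_int (a * d) :: rat) = of_int (n * b)"
    using assms d by (simp add: field_simps)
  hence ad: "a * d = n * b" by (simp only: of_int_eq_iff)
  have n: "n \<noteq> 0" using ad assms d by auto
  have pp: "prime_elem (int p)" using assms by simp
  have "multiplicity (int p) a + multiplicity (int p) d
      = multiplicity (int p) n + multiplicity (int p) b"
    using arg_cong[OF ad, of "multiplicity (int p)"] pp n d assms
    by (simp add: prime_elem_multiplicity_mult_distrib)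
  hence "int (multiplicity (int p) d) - int (multiplicity (int p) n)
      = int (multiplicity (int p) b) - int (multiplicity (int p) a)" by linarith
  thus ?thesis using assms nd by (simp add: rat_padic_abs_def)
qed

lemma rat_as_quotient: obtains a b :: int where "(x::rat) = of_int a / of_int b" "b \<noteq> 0"
proof -
  obtain n d where nd: "quotient_of x = (n, d)" by fastforce
  show thesis
    using that[of n d] quotient_of_denom_pos[OF nd] quotient_of_div[OF nd] by simp
qed

lemma rat_padic_abs_pos: "prime p \<Longrightarrow> x \<noteq> 0 \<Longrightarrow> rat_padic_abs p x > 0"
  by (auto simp: rat_padic_abs_def prime_gt_0_nat intro!: zero_less_power_int)

lemma rat_padic_abs_nonneg: "prime p \<Longrightarrow> rat_padic_abs p x \<ge> 0"
  by (cases "x = 0") (auto dest: rat_padic_abs_pos[of p x])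

lemma rat_padic_abs_eq_0_iff: "prime p \<Longrightarrow> rat_padic_abs p x = 0 \<longleftrightarrow> x = 0"
  using rat_padic_abs_pos[of p x] by (cases "x = 0") auto

lemma rat_padic_abs_1 [simp]: "rat_padic_abs p 1 = 1"
  by (simp add: rat_padic_abs_def)

lemma rat_padic_abs_minus: "prime p \<Longrightarrow> rat_padic_abs p (- x) = rat_padic_abs p x"
proof (cases "x = 0")
  case False
  assume p: "prime p"
  obtain a b :: int where x: "x = of_int a / of_int b" "b \<noteq> 0" by (rule rat_as_quotient)
  have a: "a \<noteq> 0" using x False by auto
  have "- x = of_int (- a) / of_int b" using x by simp
  moreover have "multiplicity (int p) (- a) = multiplicity (int p) a"
    using multiplicity_normalize_right[of "int p" "- a"]
      multiplicity_normalize_right[of "int p" a] by simp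
  ultimately show ?thesis
    using rat_padic_abs_divide[OF p, of "- a" b] rat_padic_abs_divide[OF p, of a b] a x
    by simp
qed simp

lemma rat_padic_abs_mult:
  assumes p: "prime p"
  shows "rat_padic_abs p (x * y) = rat_padic_abs p x * rat_padic_abs p y"
proof (cases "x = 0 \<or> y = 0")
  case False
  obtain a b :: int where x: "x = of_int a / of_int b" "b \<noteq> 0" by (rule rat_as_quotient)
  obtain c d :: int where y: "y = of_int c / of_int d" "d \<noteq> 0" by (rule rat_as_quotient)
  have ac: "a \<noteq> 0" "c \<noteq> 0" using x y False by auto
  have xy: "x * y = of_int (a * c) / of_int (b * d)" using x y by simp
  have pp: "prime_elem (int p)" and p0: "real p \<noteq> 0" using p by (auto simp: prime_gt_0_nat)
  show ?thesis
    unfolding xy unfolding x y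
    using ac x y pp p0 p
    by (subst (1 2 3) rat_padic_abs_divide)
       (auto simp: prime_elem_multiplicity_mult_distrib power_int_add [symmetric] algebra_simps)
qed auto

lemma rat_padic_abs_inverse:
  assumes p: "prime p"
  shows "rat_padic_abs p (inverse x) = inverse (rat_padic_abs p x)"
proof (cases "x = 0")
  case False
  have "rat_padic_abs p (inverse x) * rat_padic_abs p x = 1"
    using False by (simp flip: rat_padic_abs_mult[OF p])
  thus ?thesis by (metis inverse_unique mult.commute)
qed simp

lemma rat_padic_abs_ultrametric:
  assumes p: "prime p"
  shows "rat_padic_abs p (x + y) \<le> max (rat_padic_abs p x) (rat_padic_abs p y)"
proof (cases "x = 0 \<or> y = 0 \<or> x + y = 0")
  case True
  thus ?thesis
    using rat_padic_abs_nonneg[OF p, of x] rat_padic_abs_nonneg[OF p, of y] by auto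
next
  case False
  obtain a b :: int where x: "x = of_int a / of_int b" "b \<noteq> 0" by (rule rat_as_quotient)
  obtain c d :: int where y: "y = of_int c / of_int d" "d \<noteq> 0" by (rule rat_as_quotient)
  define m n e where "m = a * d" and "n = c * b" and "e = b * d"
  have e: "e \<noteq> 0" using x y by (simp add: e_def)
  have x': "x = of_int m / of_int e" and y': "y = of_int n / of_int e"
    using x y by (auto simp: m_def n_def e_def)
  have s: "x + y = of_int (m + n) / of_int e" by (simp add: x' y' add_divide_distrib)
  have nz: "m \<noteq> 0" "n \<noteq> 0" "m + n \<noteq> 0"
    using False e unfolding s unfolding x' y' by auto
  let ?v = "multiplicity (int p)"
  have "int p ^ min (?v m) (?v n) dvd m + n"
    by (intro dvd_add multiplicity_dvd') auto
  hence le: "min (?v m) (?v n) \<le> ?v (m + n)"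
    using nz p by (intro multiplicity_geI) auto
  have p1: "real p \<ge> 1" using prime_ge_1_nat[OF p] by simp
  have "rat_padic_abs p (x + y) = real p powi (int (?v e) - int (?v (m + n)))"
    unfolding s using p nz e by (intro rat_padic_abs_divide)
  also have "\<dots> \<le> real p powi (int (?v e) - int (min (?v m) (?v n)))"
    using le p1 by (intro power_int_increasing) auto
  also have "\<dots> \<le> max (real p powi (int (?v e) - int (?v m)))
                          (real p powi (int (?v e) - int (?v n)))"
    by (auto simp: min_def)
  also have "\<dots> = max (rat_padic_abs p x) (rat_padic_abs p y)"
    unfolding x' y' using p nz e by (simp add: rat_padic_abs_divide)
  finally show ?thesis .
qed

lemma rat_padic_abs_triangle:
  "prime p \<Longrightarrow> rat_padic_abs p (x + y) \<le> rat_padic_abs p x + rat_padic_abs p y"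
  using rat_padic_abs_ultrametric[of p x y] rat_padic_abs_nonneg[of p x]
    rat_padic_abs_nonneg[of p y] by linarith

lemma rat_padic_abs_minus_commute:
  "prime p \<Longrightarrow> rat_padic_abs p (x - y) = rat_padic_abs p (y - x)"
  using rat_padic_abs_minus[of p "x - y"] by simp

lemma rat_padic_abs_diff_le:
  assumes p: "prime p"
  shows "\<bar>rat_padic_abs p x - rat_padic_abs p y\<bar> \<le> rat_padic_abs p (x - y)"
  using rat_padic_abs_triangle[OF p, of "x - y" y] rat_padic_abs_triangle[OF p, of "y - x" x]
    rat_padic_abs_minus_commute[OF p, of x y] by simp


subsection \<open>Rational null sequences and Cauchy sequences for the \<open>p\<close>-adic absolute value\<close>

definition padic_null :: "nat \<Rightarrow> (nat \<Rightarrow> rat) \<Rightarrow> bool" where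
  "padic_null p X \<longleftrightarrow> (\<lambda>n. rat_padic_abs p (X n)) \<longlonglongrightarrow> 0"

definition padic_cauchy :: "nat \<Rightarrow> (nat \<Rightarrow> rat) \<Rightarrow> bool" where
  "padic_cauchy p X \<longleftrightarrow>
     (\<forall>r>0. \<exists>N. \<forall>m\<ge>N. \<forall>n\<ge>N. rat_padic_abs p (X m - X n) < r)"

lemma padic_null_le:
  assumes "prime p" "\<And>n. rat_padic_abs p (X n) \<le> f n" "f \<longlonglongrightarrow> 0"
  shows "padic_null p X"
  unfolding padic_null_def using assms
  by (intro tendsto_sandwich[OF _ _ tendsto_const assms(3)])
     (auto intro!: always_eventually rat_padic_abs_nonneg)

lemma padic_null_const [simp]: "prime p \<Longrightarrow> padic_null p (\<lambda>_. c) \<longleftrightarrow> c = 0"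
  by (simp add: padic_null_def LIMSEQ_const_iff rat_padic_abs_eq_0_iff)

lemma padic_null_minus: "prime p \<Longrightarrow> padic_null p (\<lambda>n. - X n) \<longleftrightarrow> padic_null p X"
  by (simp add: padic_null_def rat_padic_abs_minus)

lemma padic_null_add:
  assumes p: "prime p" and "padic_null p X" "padic_null p Y"
  shows "padic_null p (\<lambda>n. X n + Y n)"
  using assms(2,3) tendsto_add[of "\<lambda>n. rat_padic_abs p (X n)" 0 _ "\<lambda>n. rat_padic_abs p (Y n)" 0]
  by (intro padic_null_le[OF p rat_padic_abs_triangle[OF p]]) (simp add: padic_null_def)

lemma padic_null_diff:
  assumes p: "prime p" and "padic_null p X" "padic_null p Y"
  shows "padic_null p (\<lambda>n. X n - Y n)"
  using padic_null_add[OF p assms(2), of "\<lambda>n. - Y n"] assms by (simp add: padic_null_minus)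

lemma padic_null_diff_commute:
  "prime p \<Longrightarrow> padic_null p (\<lambda>n. X n - Y n) \<longleftrightarrow> padic_null p (\<lambda>n. Y n - X n)"
  using padic_null_minus[of p "\<lambda>n. X n - Y n"] by simp

lemma padic_cauchy_const [simp]: "padic_cauchy p (\<lambda>_. c)"
  by (simp add: padic_cauchy_def)

lemma padic_cauchy_abs:
  assumes p: "prime p" and X: "padic_cauchy p X"
  shows "convergent (\<lambda>n. rat_padic_abs p (X n))"
proof -
  have "Cauchy (\<lambda>n. rat_padic_abs p (X n))"
  proof (rule metric_CauchyI)
    fix e :: real assume "e > 0"
    then obtain N where "\<forall>m\<ge>N. \<forall>n\<ge>N. rat_padic_abs p (X m - X n) < e"
      using X unfolding padic_cauchy_def by blast
    thus "\<exists>M. \<forall>m\<ge>M. \<forall>n\<ge>M. dist (rat_padic_abs p (X m)) (rat_padic_abs p (X n)) < e"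
      using rat_padic_abs_diff_le[OF p] unfolding dist_real_def by (meson le_less_trans)
  qed
  thus ?thesis by (rule real_Cauchy_convergent)
qed

lemma padic_cauchy_bounded:
  assumes p: "prime p" and X: "padic_cauchy p X"
  obtains B where "B > 0" "\<And>n. rat_padic_abs p (X n) \<le> B"
proof -
  have "Bseq (\<lambda>n. rat_padic_abs p (X n))"
    using padic_cauchy_abs[OF assms] convergent_imp_Bseq by blast
  then obtain B where "B > 0" "\<forall>n. norm (rat_padic_abs p (X n)) \<le> B"
    unfolding Bseq_def by blast
  thus thesis using that[of B] by (metis abs_le_D1 real_norm_def)
qed

lemma padic_cauchy_not_null:
  assumes p: "prime p" and X: "padic_cauchy p X" and nz: "\<not> padic_null p X"
  obtains b N where "b > 0" "\<And>n. n \<ge> N \<Longrightarrow> rat_padic_abs p (X n) > b"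
proof -
  obtain L where L: "(\<lambda>n. rat_padic_abs p (X n)) \<longlonglongrightarrow> L"
    using padic_cauchy_abs[OF p X] unfolding convergent_def by blast
  have "L \<ge> 0" using LIMSEQ_le_const[OF L] rat_padic_abs_nonneg[OF p] by blast
  moreover have "L \<noteq> 0" using nz L by (auto simp: padic_null_def)
  ultimately have "L / 2 > 0" "L / 2 < L" by auto
  moreover from order_tendstoD(1)[OF L this(2)]
  obtain N where "\<And>n. n \<ge> N \<Longrightarrow> rat_padic_abs p (X n) > L / 2"
    unfolding eventually_sequentially by blast
  ultimately show thesis using that by blast
qed

lemma padic_cauchy_minus: "prime p \<Longrightarrow> padic_cauchy p X \<Longrightarrow> padic_cauchy p (\<lambda>n. - X n)"
  unfolding padic_cauchy_def
  by (metis minus_diff_minus rat_padic_abs_minus)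

lemma padic_cauchy_add:
  assumes p: "prime p" and X: "padic_cauchy p X" and Y: "padic_cauchy p Y"
  shows "padic_cauchy p (\<lambda>n. X n + Y n)"
  unfolding padic_cauchy_def
proof (intro allI impI)
  fix r :: real assume r: "r > 0"
  obtain M where M: "\<forall>m\<ge>M. \<forall>n\<ge>M. rat_padic_abs p (X m - X n) < r"
    using X r unfolding padic_cauchy_def by blast
  obtain N where N: "\<forall>m\<ge>N. \<forall>n\<ge>N. rat_padic_abs p (Y m - Y n) < r"
    using Y r unfolding padic_cauchy_def by blast
  have "rat_padic_abs p ((X m + Y m) - (X n + Y n)) < r"
    if "m \<ge> max M N" "n \<ge> max M N" for m n
    using rat_padic_abs_ultrametric[OF p, of "X m - X n" "Y m - Y n"] M N that
    by (force simp: add_diff_add)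
  thus "\<exists>N. \<forall>m\<ge>N. \<forall>n\<ge>N. rat_padic_abs p ((X m + Y m) - (X n + Y n)) < r" by blast
qed

lemma padic_cauchy_mult:
  assumes p: "prime p" and X: "padic_cauchy p X" and Y: "padic_cauchy p Y"
  shows "padic_cauchy p (\<lambda>n. X n * Y n)"
  unfolding padic_cauchy_def
proof (intro allI impI)
  fix r :: real assume r: "r > 0"
  obtain A where A: "A > 0" "\<And>n. rat_padic_abs p (X n) \<le> A"
    using padic_cauchy_bounded[OF p X] by blast
  obtain B where B: "B > 0" "\<And>n. rat_padic_abs p (Y n) \<le> B"
    using padic_cauchy_bounded[OF p Y] by blast
  have rB: "r / B > 0" "r / A > 0" using r A B by auto
  obtain M where M: "\<forall>m\<ge>M. \<forall>n\<ge>M. rat_padic_abs p (X m - X n) < r / B"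
    using X rB unfolding padic_cauchy_def by blast
  obtain N where N: "\<forall>m\<ge>N. \<forall>n\<ge>N. rat_padic_abs p (Y m - Y n) < r / A"
    using Y rB unfolding padic_cauchy_def by blast
  have "rat_padic_abs p (X m * Y m - X n * Y n) < r"
    if mn: "m \<ge> max M N" "n \<ge> max M N" for m n
  proof -
    have "rat_padic_abs p (X m * (Y m - Y n)) \<le> A * rat_padic_abs p (Y m - Y n)"
      unfolding rat_padic_abs_mult[OF p] using A rat_padic_abs_nonneg[OF p]
      by (intro mult_right_mono) auto
    also have "\<dots> < A * (r / A)" using N mn A by (intro mult_strict_left_mono) auto
    finally have 1: "rat_padic_abs p (X m * (Y m - Y n)) < r" using A by simp
    have "rat_padic_abs p ((X m - X n) * Y n) \<le> rat_padic_abs p (X m - X n) * B"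
      unfolding rat_padic_abs_mult[OF p] using B rat_padic_abs_nonneg[OF p]
      by (intro mult_left_mono) auto
    also have "\<dots> < (r / B) * B" using M mn B by (intro mult_strict_right_mono) auto
    finally have 2: "rat_padic_abs p ((X m - X n) * Y n) < r" using B by simp
    show ?thesis
      using rat_padic_abs_ultrametric[OF p, of "X m * (Y m - Y n)" "(X m - X n) * Y n"] 1 2
      by (simp add: mult_diff_mult)
  qed
  thus "\<exists>N. \<forall>m\<ge>N. \<forall>n\<ge>N. rat_padic_abs p (X m * Y m - X n * Y n) < r" by blast
qed

lemma padic_null_mult_cauchy:
  assumes p: "prime p" and X: "padic_cauchy p X" and Y: "padic_null p Y"
  shows "padic_null p (\<lambda>n. X n * Y n)"
proof -
  obtain A where A: "A > 0" "\<And>n. rat_padic_abs p (X n) \<le> A"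
    using padic_cauchy_bounded[OF p X] by blast
  show ?thesis
  proof (rule padic_null_le[OF p])
    show "rat_padic_abs p (X n * Y n) \<le> A * rat_padic_abs p (Y n)" for n
      unfolding rat_padic_abs_mult[OF p] using A rat_padic_abs_nonneg[OF p]
      by (intro mult_right_mono) auto
    show "(\<lambda>n. A * rat_padic_abs p (Y n)) \<longlonglongrightarrow> 0"
      using Y tendsto_mult_right_zero unfolding padic_null_def by blast
  qed
qed

lemma rat_padic_abs_inverse_diff:
  assumes p: "prime p" and "rat_padic_abs p x > a" "rat_padic_abs p y > b" "a > 0" "b > 0"
  shows "rat_padic_abs p (inverse x - inverse y) \<le> rat_padic_abs p (x - y) / (a * b)"
proof -
  have xy: "x \<noteq> 0" "y \<noteq> 0" using assms by auto
  have "rat_padic_abs p (inverse x - inverse y)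
      = rat_padic_abs p (x - y) / (rat_padic_abs p x * rat_padic_abs p y)"
    using xy by (simp add: inverse_diff_inverse rat_padic_abs_minus[OF p]
      rat_padic_abs_mult[OF p] rat_padic_abs_inverse[OF p] divide_inverse mult_ac
      del: minus_diff_eq)
  also have "\<dots> \<le> rat_padic_abs p (x - y) / (a * b)"
    using assms rat_padic_abs_nonneg[OF p]
    by (intro divide_left_mono mult_mono mult_pos_pos) auto
  finally show ?thesis .
qed

lemma padic_cauchy_inverse:
  assumes p: "prime p" and X: "padic_cauchy p X" and nz: "\<not> padic_null p X"
  shows "padic_cauchy p (\<lambda>n. inverse (X n))"
  unfolding padic_cauchy_def
proof (intro allI impI)
  fix r :: real assume r: "r > 0"
  obtain b M where b: "b > 0" and M: "\<And>n. n \<ge> M \<Longrightarrow> rat_padic_abs p (X n) > b"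
    using padic_cauchy_not_null[OF assms] by blast
  have rb: "r * (b * b) > 0" using r b by simp
  obtain N where N: "\<forall>m\<ge>N. \<forall>n\<ge>N. rat_padic_abs p (X m - X n) < r * (b * b)"
    using X rb unfolding padic_cauchy_def by blast
  have "rat_padic_abs p (inverse (X m) - inverse (X n)) < r"
    if mn: "m \<ge> max M N" "n \<ge> max M N" for m n
  proof -
    have "rat_padic_abs p (inverse (X m) - inverse (X n)) \<le> rat_padic_abs p (X m - X n) / (b * b)"
      using mn M b by (intro rat_padic_abs_inverse_diff[OF p]) auto
    also have "\<dots> < r * (b * b) / (b * b)"
      using N mn b by (intro divide_strict_right_mono) auto
    finally show ?thesis using b by simp
  qed
  thus "\<exists>N. \<forall>m\<ge>N. \<forall>n\<ge>N. rat_padic_abs p (inverse (X m) - inverse (X n)) < r" by blast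
qed

lemma padic_null_inverse_diff:
  assumes p: "prime p" and X: "padic_cauchy p X" "\<not> padic_null p X"
    and Y: "padic_cauchy p Y" "\<not> padic_null p Y"
    and XY: "padic_null p (\<lambda>n. X n - Y n)"
  shows "padic_null p (\<lambda>n. inverse (X n) - inverse (Y n))"
proof -
  obtain a M where a: "a > 0" and M: "\<And>n. n \<ge> M \<Longrightarrow> rat_padic_abs p (X n) > a"
    using padic_cauchy_not_null[OF p X] by blast
  obtain b N where b: "b > 0" and N: "\<And>n. n \<ge> N \<Longrightarrow> rat_padic_abs p (Y n) > b"
    using padic_cauchy_not_null[OF p Y] by blast
  have ev: "eventually (\<lambda>n. rat_padic_abs p (inverse (X n) - inverse (Y n))
      \<le> rat_padic_abs p (X n - Y n) / (a * b)) sequentially"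
    unfolding eventually_sequentially
    by (intro exI[of _ "max M N"] allI impI rat_padic_abs_inverse_diff[OF p])
       (use a b M N in auto)
  have "(\<lambda>n. rat_padic_abs p (X n - Y n) / (a * b)) \<longlonglongrightarrow> 0"
    using tendsto_divide_zero XY unfolding padic_null_def by blast
  thus ?thesis
    unfolding padic_null_def
    by (intro tendsto_sandwich[OF _ ev tendsto_const])
       (auto intro!: always_eventually rat_padic_abs_nonneg[OF p])
qed


subsection \<open>The field of \<open>p\<close>-adic numbers\<close>

definition padic_rel :: "'p::prime_card itself \<Rightarrow> (nat \<Rightarrow> rat) \<Rightarrow> (nat \<Rightarrow> rat) \<Rightarrow> bool" where
  "padic_rel _ X Y \<longleftrightarrow> padic_cauchy CARD('p) X \<and> padic_cauchy CARD('p) Y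
     \<and> padic_null CARD('p) (\<lambda>n. X n - Y n)"

lemma part_equivp_padic_rel: "part_equivp (padic_rel TYPE('p::prime_card))"
proof (rule part_equivpI)
  show "\<exists>X. padic_rel TYPE('p) X X"
    by (rule exI[of _ "\<lambda>_. 0"]) (simp add: padic_rel_def prime_card)
  show "symp (padic_rel TYPE('p))"
    unfolding symp_def padic_rel_def
    using padic_null_diff_commute[OF prime_card[where 'a='p]] by blast
  show "transp (padic_rel TYPE('p))"
    using padic_null_add[OF prime_card[where 'a='p]]
    by (force intro!: transpI simp: padic_rel_def)
qed

text \<open>\<open>quotient_type\<close> does not accept a relation with a phantom type parameter, so the
  type of equivalence classes is set up for lifting by hand.\<close>

typedef (overloaded) 'p padic =
    "{S. \<exists>X. padic_rel TYPE('p::prime_card) X X \<and> S = Collect (padic_rel TYPE('p) X)}"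
  using part_equivp_padic_rel[where 'p='p] unfolding part_equivp_def by blast

definition abs_padic :: "(nat \<Rightarrow> rat) \<Rightarrow> 'p::prime_card padic" where
  "abs_padic X = Abs_padic (Collect (padic_rel TYPE('p) X))"

definition rep_padic :: "'p::prime_card padic \<Rightarrow> nat \<Rightarrow> rat" where
  "rep_padic x = (SOME X. X \<in> Rep_padic x)"

definition cr_padic :: "(nat \<Rightarrow> rat) \<Rightarrow> 'p::prime_card padic \<Rightarrow> bool" where
  "cr_padic X x \<longleftrightarrow> padic_rel TYPE('p) X X \<and> abs_padic X = x"

lemma Quotient_padic:
  "Quotient (padic_rel TYPE('p::prime_card)) abs_padic rep_padic
     (cr_padic :: _ \<Rightarrow> 'p padic \<Rightarrow> bool)"
proof -
  interpret quot_type "padic_rel TYPE('p)" "Abs_padic :: _ \<Rightarrow> 'p padic" Rep_padic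
    using part_equivp_padic_rel[where 'p='p] Rep_padic[where 'p='p]
      Rep_padic_inverse[where 'p='p] Abs_padic_inverse[where 'p='p]
      Rep_padic_inject[where 'p='p]
    by unfold_locales auto
  have "Quotient3 (padic_rel TYPE('p)) abs rep"
    by (rule Quotient)
  moreover have "abs = abs_padic"
    by (rule ext) (simp add: abs_def abs_padic_def)
  moreover have "rep = rep_padic"
    by (rule ext) (simp add: rep_def rep_padic_def)
  ultimately show ?thesis
    by (intro Quotient3_to_Quotient eq_reflection ext) (auto simp: cr_padic_def)
qed

setup_lifting Quotient_padic

instantiation padic :: (prime_card) field
begin

lift_definition zero_padic :: "'a padic" is "\<lambda>_. 0"
  by (simp add: padic_rel_def prime_card)

lift_definition one_padic :: "'a padic" is "\<lambda>_. 1"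
  by (simp add: padic_rel_def prime_card)

lift_definition plus_padic :: "'a padic \<Rightarrow> 'a padic \<Rightarrow> 'a padic" is "\<lambda>X Y n. X n + Y n"
  unfolding padic_rel_def add_diff_add
  by (simp add: padic_cauchy_add padic_null_add prime_card)

lift_definition uminus_padic :: "'a padic \<Rightarrow> 'a padic" is "\<lambda>X n. - X n"
  unfolding padic_rel_def minus_diff_minus
  by (simp add: padic_cauchy_minus padic_null_minus[OF prime_card] prime_card
    del: minus_diff_eq)

lift_definition times_padic :: "'a padic \<Rightarrow> 'a padic \<Rightarrow> 'a padic" is "\<lambda>X Y n. X n * Y n"
proof -
  fix X X' Y Y'
  assume "padic_rel TYPE('a) X X'" "padic_rel TYPE('a) Y Y'"
  hence *: "padic_cauchy CARD('a) X" "padic_cauchy CARD('a) X'" "padic_cauchy CARD('a) Y"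
    "padic_cauchy CARD('a) Y'" "padic_null CARD('a) (\<lambda>n. X n - X' n)"
    "padic_null CARD('a) (\<lambda>n. Y n - Y' n)"
    by (auto simp: padic_rel_def)
  have "padic_null CARD('a) (\<lambda>n. X n * (Y n - Y' n) + Y' n * (X n - X' n))"
    using * by (intro padic_null_add padic_null_mult_cauchy prime_card)
  hence "padic_null CARD('a) (\<lambda>n. X n * Y n - X' n * Y' n)"
    by (simp add: algebra_simps)
  thus "padic_rel TYPE('a) (\<lambda>n. X n * Y n) (\<lambda>n. X' n * Y' n)"
    using * by (simp add: padic_rel_def padic_cauchy_mult prime_card)
qed

lift_definition inverse_padic :: "'a padic \<Rightarrow> 'a padic"
  is "\<lambda>X. if padic_null CARD('a) X then (\<lambda>_. 0) else (\<lambda>n. inverse (X n))"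
proof -
  fix X Y
  assume *: "padic_rel TYPE('a) X Y"
  hence XY: "padic_null CARD('a) (\<lambda>n. X n - Y n)" by (simp add: padic_rel_def)
  have "padic_null CARD('a) X \<longleftrightarrow> padic_null CARD('a) Y"
    using padic_null_diff[OF prime_card _ XY, of X] padic_null_add[OF prime_card XY, of Y]
    by auto
  with * show "padic_rel TYPE('a)
      (if padic_null CARD('a) X then (\<lambda>_. 0) else (\<lambda>n. inverse (X n)))
      (if padic_null CARD('a) Y then (\<lambda>_. 0) else (\<lambda>n. inverse (Y n)))"
    by (auto simp: padic_rel_def prime_card intro!: padic_cauchy_inverse padic_null_inverse_diff)
qed

definition "x - y = x + - y" for x y :: "'a padic"

definition "x div y = x * inverse y" for x y :: "'a padic"

instance
proof
  fix a b c :: "'a padic"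
  note [simp] = padic_rel_def prime_card padic_cauchy_add padic_cauchy_mult padic_cauchy_minus
  show "a + b = b + a" by transfer (simp add: ac_simps)
  show "(a + b) + c = a + (b + c)" by transfer (simp add: ac_simps)
  show "0 + a = a" by transfer simp
  show "- a + a = 0" by transfer simp
  show "a - b = a + - b" by (rule minus_padic_def)
  show "(a * b) * c = a * (b * c)" by transfer (simp add: ac_simps)
  show "a * b = b * a" by transfer (simp add: ac_simps)
  show "1 * a = a" by transfer simp
  show "(a + b) * c = a * c + b * c" by transfer (simp add: distrib_right)
  show "(0 :: 'a padic) \<noteq> 1" by transfer simp
  have null: "padic_null CARD('a) (\<lambda>n. inverse (X n) * X n - 1)"
    if X: "padic_cauchy CARD('a) X" "\<not> padic_null CARD('a) X" for X
  proof -
    obtain b N where b: "b > 0" and N: "\<And>n. n \<ge> N \<Longrightarrow> rat_padic_abs CARD('a) (X n) > b"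
      using padic_cauchy_not_null[OF prime_card X] by blast
    have "eventually (\<lambda>n. rat_padic_abs CARD('a) (inverse (X n) * X n - 1) = 0) sequentially"
      using eventually_ge_at_top[of N]
    proof eventually_elim
      case (elim n)
      hence "X n \<noteq> 0" using N[of n] b by auto
      thus ?case by simp
    qed
    thus ?thesis unfolding padic_null_def by (rule tendsto_eventually)
  qed
  show "a \<noteq> 0 \<Longrightarrow> inverse a * a = 1"
    by transfer (auto simp: null padic_cauchy_inverse)
  show "a div b = a * inverse b" by (rule divide_padic_def)
  show "inverse (0 :: 'a padic) = 0" by transfer simp
qed

end

text \<open>The absolute value is normalised by \<open>padic_abs p = 1 / p\<close>, and the topology of the field
  is the one of the metric \<open>padic_abs (x - y)\<close>.\<close>

lift_definition padic_abs :: "'a::prime_card padic \<Rightarrow> real" is "\<lambda>X. lim (\<lambda>n. rat_padic_abs CARD('a) (X n))"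
proof -
  fix X Y
  assume *: "padic_rel TYPE('a) X Y"
  obtain L where L: "(\<lambda>n. rat_padic_abs CARD('a) (X n)) \<longlonglongrightarrow> L"
    using * padic_cauchy_abs[OF prime_card] unfolding padic_rel_def convergent_def by blast
  have "(\<lambda>n. rat_padic_abs CARD('a) (X n - Y n)) \<longlonglongrightarrow> 0"
    using * by (simp add: padic_rel_def padic_null_def)
  hence "(\<lambda>n. rat_padic_abs CARD('a) (X n) - rat_padic_abs CARD('a) (Y n)) \<longlonglongrightarrow> 0"
    by (rule Lim_null_comparison[rotated])
       (simp add: rat_padic_abs_diff_le prime_card)
  from tendsto_diff[OF L this] have "(\<lambda>n. rat_padic_abs CARD('a) (Y n)) \<longlonglongrightarrow> L" by simp
  with L show "lim (\<lambda>n. rat_padic_abs CARD('a) (X n)) = lim (\<lambda>n. rat_padic_abs CARD('a) (Y n))"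
    by (simp add: limI)
qed

lemma padic_abs_tendsto:
  fixes X :: "nat \<Rightarrow> rat"
  assumes "padic_rel TYPE('a::prime_card) X X"
  shows "(\<lambda>n. rat_padic_abs CARD('a) (X n)) \<longlonglongrightarrow> lim (\<lambda>n. rat_padic_abs CARD('a) (X n))"
  using assms padic_cauchy_abs[OF prime_card] unfolding padic_rel_def convergent_LIMSEQ_iff by blast

lemma padic_abs_eq_0_iff: "padic_abs x = 0 \<longleftrightarrow> x = 0" for x :: "'a::prime_card padic"
proof transfer
  fix X :: "nat \<Rightarrow> rat"
  assume X: "padic_rel TYPE('a) X X"
  show "lim (\<lambda>n. rat_padic_abs CARD('a) (X n)) = 0 \<longleftrightarrow> padic_rel TYPE('a) X (\<lambda>_. 0)"
    using X padic_abs_tendsto[OF X] limI[of "\<lambda>n. rat_padic_abs CARD('a) (X n)" 0]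
    by (auto simp: padic_rel_def padic_null_def)
qed

lemma padic_abs_mult: "padic_abs (x * y) = padic_abs x * padic_abs y" for x y :: "'a::prime_card padic"
proof transfer
  fix X Y :: "nat \<Rightarrow> rat"
  assume "padic_rel TYPE('a) X X" "padic_rel TYPE('a) Y Y"
  from tendsto_mult[OF this[THEN padic_abs_tendsto]]
  show "lim (\<lambda>n. rat_padic_abs CARD('a) (X n * Y n))
    = lim (\<lambda>n. rat_padic_abs CARD('a) (X n)) * lim (\<lambda>n. rat_padic_abs CARD('a) (Y n))"
    by (simp add: rat_padic_abs_mult prime_card limI)
qed

lemma padic_abs_minus: "padic_abs (- x) = padic_abs x" for x :: "'a::prime_card padic"
  by transfer (simp add: rat_padic_abs_minus prime_card)

lemma padic_abs_ultrametric: "padic_abs (x + y) \<le> max (padic_abs x) (padic_abs y)"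
  for x y :: "'a::prime_card padic"
proof transfer
  fix X Y :: "nat \<Rightarrow> rat"
  assume *: "padic_rel TYPE('a) X X" "padic_rel TYPE('a) Y Y"
  hence "padic_rel TYPE('a) (\<lambda>n. X n + Y n) (\<lambda>n. X n + Y n)"
    by (simp add: padic_rel_def padic_cauchy_add prime_card)
  from padic_abs_tendsto[OF this] tendsto_max[OF *[THEN padic_abs_tendsto]]
  show "lim (\<lambda>n. rat_padic_abs CARD('a) (X n + Y n))
    \<le> max (lim (\<lambda>n. rat_padic_abs CARD('a) (X n))) (lim (\<lambda>n. rat_padic_abs CARD('a) (Y n)))"
    by (rule LIMSEQ_le) (auto intro: rat_padic_abs_ultrametric prime_card)
qed

lemma padic_abs_nonneg: "padic_abs x \<ge> 0" for x :: "'a::prime_card padic"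
  using padic_abs_ultrametric[of x "- x"] padic_abs_minus[of x] padic_abs_eq_0_iff[of "0 :: 'a padic"]
  by simp

lemma padic_abs_triangle: "padic_abs (x + y) \<le> padic_abs x + padic_abs y" for x y :: "'a::prime_card padic"
  using padic_abs_ultrametric[of x y] padic_abs_nonneg[of x] padic_abs_nonneg[of y] by linarith

instantiation padic :: (prime_card) metric_space
begin

definition dist_padic :: "'a padic \<Rightarrow> 'a padic \<Rightarrow> real" where
  "dist_padic x y = padic_abs (x - y)"

definition uniformity_padic :: "('a padic \<times> 'a padic) filter" where
  "uniformity_padic = (INF e\<in>{0<..}. principal {(x, y). dist x y < e})"

definition open_padic :: "'a padic set \<Rightarrow> bool" where
  "open_padic U \<longleftrightarrow> (\<forall>x\<in>U. \<forall>\<^sub>F (x', y) in uniformity. x' = x \<longrightarrow> y \<in> U)"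

instance
proof
  fix x y z :: "'a padic" and U :: "'a padic set"
  show "uniformity = (INF e\<in>{0<..}. principal {(x, y :: 'a padic). dist x y < e})"
    by (rule uniformity_padic_def)
  show "open U \<longleftrightarrow> (\<forall>x\<in>U. \<forall>\<^sub>F (x', y) in uniformity. x' = x \<longrightarrow> y \<in> U)"
    by (rule open_padic_def)
  show "dist x y = 0 \<longleftrightarrow> x = y"
    by (simp add: dist_padic_def padic_abs_eq_0_iff)
  show "dist x y \<le> dist x z + dist y z"
    using padic_abs_triangle[of "x - z" "z - y"] padic_abs_minus[of "y - z"]
    by (simp add: dist_padic_def)
qed

end

definition padic_integers :: "'p::prime_card padic set" where
  "padic_integers = {x. padic_abs x \<le> 1}"

definition padic_units :: "'p::prime_card padic set" where
  "padic_units = {x \<in> padic_integers. \<exists>y\<in>padic_integers. x * y = 1}"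


subsection \<open>Idempotent and degenerate distributions\<close>

definition compact_subgroup :: "'a::{ab_group_add, topological_space} set \<Rightarrow> bool" where
  "compact_subgroup K \<longleftrightarrow> compact K \<and> 0 \<in> K \<and> (\<forall>x\<in>K. \<forall>y\<in>K. x - y \<in> K)"

text \<open>\<open>haar_distribution K m\<close>: \<open>m\<close> is the normalised Haar measure of \<open>K\<close>, regarded as a
  distribution on the whole group.\<close>

definition haar_distribution ::
    "'a::{ab_group_add, topological_space} set \<Rightarrow> 'a measure \<Rightarrow> bool" where
  "haar_distribution K m \<longleftrightarrow> prob_space m \<and> sets m = sets borel \<and> emeasure m K = 1
     \<and> (\<forall>x\<in>K. distr m borel (\<lambda>y. x + y) = m)"

definition idempotent_distributions :: "'a::{ab_group_add, topological_space} measure set" where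
  "idempotent_distributions =
     {distr m borel (\<lambda>y. x + y) | x m. \<exists>K. compact_subgroup K \<and> haar_distribution K m}"

definition degenerate_distributions :: "'a::topological_space measure set" where
  "degenerate_distributions = range (return borel)"


subsection \<open>Linear forms of independent random variables\<close>

definition Lambda1 :: "'a::comm_ring_1 \<Rightarrow> 'a \<Rightarrow> 'a \<Rightarrow> 'a \<Rightarrow> 'a^3^3" where
  "Lambda1 \<delta>1 \<delta>2 \<epsilon>1 \<epsilon>2 =
     vector [vector [1, 1, 1], vector [1, \<delta>1, \<delta>2], vector [1, \<epsilon>1, \<epsilon>2]]"

definition Lambda2 :: "'a::comm_ring_1 \<Rightarrow> 'a \<Rightarrow> 'a \<Rightarrow> 'a \<Rightarrow> 'a^3^3" where
  "Lambda2 \<delta>1 \<delta>2 \<epsilon>1 \<epsilon>2 =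
     vector [vector [1, 1, 1], vector [\<delta>1, 1, \<delta>2], vector [1, \<epsilon>1, \<epsilon>2]]"

definition independent_with_forms ::
    "'p::prime_card padic^3^3 \<Rightarrow> 'w measure \<Rightarrow> (3 \<Rightarrow> 'w \<Rightarrow> 'p padic) \<Rightarrow> bool" where
  "independent_with_forms \<Lambda> M \<xi> \<longleftrightarrow> prob_space M
     \<and> prob_space.indep_vars M (\<lambda>_. borel) \<xi> UNIV
     \<and> prob_space.indep_vars M (\<lambda>_. borel) (\<lambda>i \<omega>. (\<Lambda> *v (\<chi> j. \<xi> j \<omega>)) $ i) UNIV"

text \<open>Formulas cannot quantify over types, so the type \<open>'w\<close> of the points of the sample spaces
  is a parameter. All joint distributions of triples already occur for \<open>'w = 'p padic^3\<close>.\<close>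

definition forces_distributions ::
    "'w itself \<Rightarrow> 'p::prime_card padic^3^3 \<Rightarrow> 'p padic measure set \<Rightarrow> bool" where
  "forces_distributions _ \<Lambda> D \<longleftrightarrow>
     (\<forall>(M :: 'w measure) \<xi>. independent_with_forms \<Lambda> M \<xi> \<longrightarrow> (\<forall>j. distr M borel (\<xi> j) \<in> D))"

end

theory Submission
  imports Defs
begin

text \<open>
  Let \<open>f\<^sub>j\<close> be the characteristic function of \<open>\<xi>\<^sub>j\<close> and \<open>g\<^sub>j = \<bar>f\<^sub>j\<bar>\<close>. Independence of the forms means
  \<open>\<Prod>\<^sub>j f\<^sub>j(\<Sum>\<^sub>i \<lambda>\<^sub>i\<^sub>j u\<^sub>i) = \<Prod>\<^sub>i \<Prod>\<^sub>j f\<^sub>j(\<lambda>\<^sub>i\<^sub>j u\<^sub>i)\<close>. Taking logarithms near 0 and finite differences shows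
  \<open>g\<^sub>j = 1\<close> near 0, so each \<open>E\<^sub>j = {g\<^sub>j = 1}\<close> is the whole field or a ball of some radius \<open>\<rho>\<^sub>j\<close>, and by the
  equation \<open>\<Sum>\<^sub>i \<lambda>\<^sub>i\<^sub>j u\<^sub>i \<in> E\<^sub>j\<close> for all \<open>j\<close> forces \<open>\<lambda>\<^sub>i\<^sub>j u\<^sub>i \<in> E\<^sub>j\<close> for all \<open>i, j\<close>. Either all \<open>E\<^sub>j\<close> are
  the whole field, or comparing the volumes of the two lattices gives
  \<open>\<Prod>\<^sub>i \<bar>\<lambda>\<^sub>i\<^sub>\<tau>\<^sub>i\<bar> \<le> \<bar>det \<Lambda>\<bar>\<close> for every permutation \<open>\<tau>\<close>. If equality holds for two permutations without a
  common value, then the maximum \<open>S < 1\<close> of the \<open>g\<^sub>j\<close> over spheres of radii proportional to the \<open>\<rho>\<^sub>j\<close>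
  satisfies \<open>S \<le> S\<^sup>2\<close>; so \<open>g\<^sub>j\<close> vanishes off \<open>E\<^sub>j\<close> and all distributions are idempotent. In the remaining
  cases a diagonal scaling turns \<open>\<Lambda>\<close> into an element of \<open>GL\<^sub>3(\<Delta>\<^sub>p)\<close> with a row or a column containing a
  single unit; there one summand may have a biased lowest \<open>p\<close>-adic digit while all other digits are uniform.
\<close>


subsection \<open>The \<open>p\<close>-adic absolute value\<close>

text \<open>Moduli forget shifts and admit real logarithms, but they may vanish away from 0, so
  logarithms reach only a ball. There integers help: |n| \<le> 1, so all multiples n c of a small c
  stay in the ball, and the quadratic polynomial in n is bounded. Volumes: the vectors u whose sums
  all lie in the \<open>E\<^sub>j\<close> form a lattice of volume \<Prod>\<rho>_j / |det
  \<Lambda>|. It lies in the box of radii R_i = min_j \<rho>_j / |\<lambda>_ij|, and R_i \<le>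
  \<rho>_(\<tau> i) / |\<lambda>_(i, \<tau> i)|. The comparison is carried out on the Leibniz
  expansion of the determinant of the inverse matrix. If equality holds for \<tau>, these bounds on
  R_i are sharp, and a vector u that is extremal in row i puts its argument at column \<tau> i
  exactly on a sphere. Two permutations that differ in every row yield two such columns whatever the
  row i is; this is where S squared comes from. Distinct permutations of three letters differ
  everywhere exactly if they have the same parity, which is why for q = k the conditions couple
  \<open>k1\<close> with \<open>l2\<close> and \<open>k2\<close> with \<open>l1\<close>.\<close>

abbreviation (input) uniformizer :: "'p::prime_card padic" where
  "uniformizer \<equiv> of_nat CARD('p)"

lemma prime_card_gt_1: "1 < real CARD('p::prime_card)"
  using prime_gt_1_nat[OF prime_card[where 'a='p]] by simp

lemma padic_abs_0 [simp]: "padic_abs (0 :: 'p::prime_card padic) = 0"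
  by (simp add: padic_abs_eq_0_iff)

lemma padic_abs_pos: "x \<noteq> 0 \<Longrightarrow> 0 < padic_abs (x :: 'p::prime_card padic)"
  using padic_abs_nonneg[of x] padic_abs_eq_0_iff[of x] by linarith

lemma padic_abs_1 [simp]: "padic_abs (1 :: 'p::prime_card padic) = 1"
  using padic_abs_mult[of "1 :: 'p padic" 1] padic_abs_eq_0_iff[of "1 :: 'p padic"] by simp

lemma padic_abs_power: "padic_abs (x ^ n) = padic_abs (x :: 'p::prime_card padic) ^ n"
  by (induction n) (auto simp: padic_abs_mult)

lemma padic_abs_inverse: "padic_abs (inverse x) = inverse (padic_abs (x :: 'p::prime_card padic))"
proof (cases "x = 0")
  case False
  hence "padic_abs (inverse x) * padic_abs x = 1" by (simp flip: padic_abs_mult)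
  thus ?thesis by (metis inverse_unique mult.commute)
qed simp

lemma padic_abs_divide: "padic_abs (x / y) = padic_abs x / padic_abs (y :: 'p::prime_card padic)"
  by (simp add: divide_inverse padic_abs_mult padic_abs_inverse)

lemma padic_abs_prod: "padic_abs (prod f A) = (\<Prod>i\<in>A. padic_abs (f i :: 'p::prime_card padic))"
  by (induction A rule: infinite_finite_induct) (auto simp: padic_abs_mult)

lemma padic_abs_add_le:
  "padic_abs x \<le> r \<Longrightarrow> padic_abs y \<le> r \<Longrightarrow> padic_abs (x + y :: 'p::prime_card padic) \<le> r"
  using padic_abs_ultrametric[of x y] by simp

lemma padic_abs_diff_le:
  "padic_abs x \<le> r \<Longrightarrow> padic_abs y \<le> r \<Longrightarrow> padic_abs (x - y :: 'p::prime_card padic) \<le> r"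
  using padic_abs_add_le[of x r "- y"] by (simp add: padic_abs_minus)

lemma padic_abs_minus_commute: "padic_abs (x - y) = padic_abs (y - x :: 'p::prime_card padic)"
  using padic_abs_minus[of "x - y"] by simp

lemma padic_abs_add_less:
  "padic_abs x < r \<Longrightarrow> padic_abs y < r \<Longrightarrow> padic_abs (x + y :: 'p::prime_card padic) < r"
  using padic_abs_ultrametric[of x y] by simp

lemma padic_abs_sum_le:
  assumes "\<And>i. i \<in> A \<Longrightarrow> padic_abs (f i :: 'p::prime_card padic) \<le> r" "0 \<le> r"
  shows "padic_abs (sum f A) \<le> r"
  using assms by (induction A rule: infinite_finite_induct) (auto intro: padic_abs_add_le)

lemma padic_abs_sum_less:
  assumes "\<And>i. i \<in> A \<Longrightarrow> padic_abs (f i :: 'p::prime_card padic) < r" "0 < r"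
  shows "padic_abs (sum f A) < r"
  using assms by (induction A rule: infinite_finite_induct) (auto intro: padic_abs_add_less)

text \<open>Isosceles principle: \<open>x\<close> is recovered as (x + y) - y, and \<open>y\<close>
  is too small to account for its absolute value.\<close>

lemma padic_abs_add_eq:
  assumes "padic_abs y < padic_abs (x :: 'p::prime_card padic)"
  shows "padic_abs (x + y) = padic_abs x"
proof (rule antisym)
  show "padic_abs (x + y) \<le> padic_abs x" using assms by (intro padic_abs_add_le) auto
  have "padic_abs x \<le> max (padic_abs (x + y)) (padic_abs y)"
    using padic_abs_ultrametric[of "x + y" "- y"] by (simp add: padic_abs_minus)
  thus "padic_abs x \<le> padic_abs (x + y)" using assms by simp
qed

section \<open>The rationals inside the field\<close>

lift_definition padic_of_rat :: "rat \<Rightarrow> 'p::prime_card padic" is "\<lambda>r _. r"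
  by (simp add: padic_rel_def prime_card)

lemma padic_of_rat_0 [simp]: "padic_of_rat 0 = 0"
  by transfer (simp add: padic_rel_def prime_card)

lemma padic_of_rat_1 [simp]: "padic_of_rat 1 = 1"
  by transfer (simp add: padic_rel_def prime_card)

lemma padic_of_rat_add: "padic_of_rat (r + s) = padic_of_rat r + padic_of_rat s"
  by transfer (simp add: padic_rel_def prime_card)

lemma padic_of_rat_minus: "padic_of_rat (- r) = - padic_of_rat r"
  by transfer (simp add: padic_rel_def prime_card)

lemma padic_of_rat_diff: "padic_of_rat (r - s) = padic_of_rat r - padic_of_rat s"
  using padic_of_rat_add[of r "- s"] by (simp add: padic_of_rat_minus)

lemma padic_of_rat_of_nat: "padic_of_rat (of_nat n) = of_nat n"
  by (induction n) (auto simp: padic_of_rat_add)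

lemma padic_of_rat_of_int: "padic_of_rat (of_int z) = of_int z"
  by (cases z) (auto simp: padic_of_rat_minus padic_of_rat_of_nat padic_of_rat_diff)

lemma padic_abs_of_rat: "padic_abs (padic_of_rat r :: 'p::prime_card padic) = rat_padic_abs CARD('p) r"
  by transfer simp

lemma padic_abs_of_int:
  "padic_abs (of_int z :: 'p::prime_card padic) = rat_padic_abs CARD('p) (of_int z)"
  by (simp flip: padic_of_rat_of_int add: padic_abs_of_rat)

text \<open>Link from analysis to arithmetic: balls around 0 cut out congruence classes of integers.
  The well-definedness of the character and its kernel both rest on it.\<close>

lemma padic_abs_of_int_le_iff:
  "padic_abs (of_int z :: 'p::prime_card padic) \<le> (1 / real CARD('p)) ^ n \<longleftrightarrow> int CARD('p) ^ n dvd z"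
proof (cases "z = 0")
  case False
  let ?v = "multiplicity (int CARD('p)) z"
  have p: "prime CARD('p)" by (rule prime_card)
  have "rat_padic_abs CARD('p) (of_int z) = real CARD('p) powi (- int ?v)"
    using rat_padic_abs_divide[OF p False, of 1] by simp
  also have "\<dots> = (1 / real CARD('p)) ^ ?v"
    by (simp add: power_int_minus power_divide field_simps)
  finally have "padic_abs (of_int z :: 'p padic) = (1 / real CARD('p)) ^ ?v"
    by (simp add: padic_abs_of_int)
  hence "padic_abs (of_int z :: 'p padic) \<le> (1 / real CARD('p)) ^ n \<longleftrightarrow> n \<le> ?v"
    using prime_card_gt_1[where 'p='p] by (simp add: power_decreasing_iff)
  also have "\<dots> \<longleftrightarrow> int CARD('p) ^ n dvd z"
    using False p by (intro power_dvd_iff_le_multiplicity[symmetric]) auto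
  finally show ?thesis .
qed (use prime_card_gt_1[where 'p='p] in auto)

lemma padic_abs_of_int_le_1: "padic_abs (of_int z :: 'p::prime_card padic) \<le> 1"
  using padic_abs_of_int_le_iff[of z 0, where 'p='p] by simp

lemma padic_abs_of_nat_le_1: "padic_abs (of_nat n :: 'p::prime_card padic) \<le> 1"
  using padic_abs_of_int_le_1[of "int n", where 'p='p] by simp

lemma padic_abs_uniformizer: "padic_abs (uniformizer :: 'p::prime_card padic) = 1 / real CARD('p)"
proof -
  have p: "prime CARD('p)" by (rule prime_card)
  have "multiplicity (int CARD('p)) (int CARD('p)) = 1"
    using p by (intro multiplicity_self) auto
  thus ?thesis
    using rat_padic_abs_divide[OF p, of "int CARD('p)" 1] padic_abs_of_int[of "int CARD('p)", where 'p='p] p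
    by (auto simp: power_int_minus field_simps)
qed

lemma uniformizer_nonzero [simp]: "(uniformizer :: 'p::prime_card padic) \<noteq> 0"
  using padic_abs_uniformizer[where 'p='p] prime_card_gt_1[where 'p='p] by (auto simp flip: padic_abs_eq_0_iff)

text \<open>Subtracting the constant \<open>r\<close> termwise represents the difference, so
  distances to rationals can be read off along a representing sequence; density and completeness
  both use this.\<close>

lemma padic_abs_abs_padic_diff:
  assumes "padic_cauchy CARD('p) R"
  shows "(\<lambda>m. rat_padic_abs CARD('p) (R m - r))
    \<longlonglongrightarrow> padic_abs (abs_padic R - padic_of_rat r :: 'p::prime_card padic)"
proof -
  have *: "padic_rel TYPE('p) (\<lambda>m. R m - r) (\<lambda>m. R m - r)"
    using assms padic_cauchy_add[OF prime_card[where 'a='p], of R "\<lambda>_. - r"]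
    by (simp add: padic_rel_def prime_card)
  have "padic_rel TYPE('p) R R" "padic_rel TYPE('p) (\<lambda>_. - r) (\<lambda>_. - r)"
    using assms by (auto simp: padic_rel_def prime_card)
  from plus_padic.abs_eq[OF this]
  have "abs_padic R + padic_of_rat (- r) = (abs_padic (\<lambda>m. R m - r) :: 'p padic)"
    unfolding padic_of_rat.abs_eq by simp
  hence "abs_padic R - padic_of_rat r = (abs_padic (\<lambda>m. R m - r) :: 'p padic)"
    by (simp add: padic_of_rat_minus)
  thus ?thesis
    using padic_abs.abs_eq[OF *] padic_abs_tendsto[OF *] by simp
qed

lemma padic_dense_rat:
  assumes "0 < e"
  obtains r where "padic_abs (x - padic_of_rat r :: 'p::prime_card padic) < e"
proof -
  define X where "X = rep_padic x"
  have x: "x = abs_padic X"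
    unfolding X_def using Quotient_abs_rep[OF Quotient_padic] by metis
  have X: "padic_cauchy CARD('p) X"
    using Quotient_rep_reflp[OF Quotient_padic, of x] by (simp add: X_def padic_rel_def)
  have "0 < e / 2" using assms by simp
  then obtain N where N: "\<forall>m\<ge>N. \<forall>n\<ge>N. rat_padic_abs CARD('p) (X m - X n) < e / 2"
    using X unfolding padic_cauchy_def by blast
  have "padic_abs (x - padic_of_rat (X N)) \<le> e / 2"
    unfolding x using padic_abs_abs_padic_diff[OF X, of "X N"]
    by (rule LIMSEQ_le_const2) (use N in \<open>auto intro!: exI[of _ N] less_imp_le\<close>)
  hence "padic_abs (x - padic_of_rat (X N)) < e" using assms by linarith
  thus thesis by (rule that)
qed

lemma padic_complete_rat:
  assumes "padic_cauchy CARD('p) R"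
  obtains x :: "'p::prime_card padic" where "(\<lambda>n. padic_abs (x - padic_of_rat (R n))) \<longlonglongrightarrow> 0"
proof -
  define x :: "'p padic" where "x = abs_padic R"
  have x: "\<exists>N. \<forall>n\<ge>N. padic_abs (x - padic_of_rat (R n)) \<le> e" if e: "e > 0" for e
  proof -
    obtain N where N: "\<forall>m\<ge>N. \<forall>n\<ge>N. rat_padic_abs CARD('p) (R m - R n) < e"
      using assms e unfolding padic_cauchy_def by blast
    have "padic_abs (x - padic_of_rat (R n)) \<le> e" if "n \<ge> N" for n
      unfolding x_def using padic_abs_abs_padic_diff[OF assms, of "R n"]
      by (rule LIMSEQ_le_const2) (use N that in \<open>auto intro!: exI[of _ N] less_imp_le\<close>)
    thus ?thesis by blast
  qed
  have "(\<lambda>n. padic_abs (x - padic_of_rat (R n))) \<longlonglongrightarrow> 0"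
  proof (rule LIMSEQ_I)
    fix e :: real assume "e > 0"
    then obtain N where "\<forall>n\<ge>N. padic_abs (x - padic_of_rat (R n)) \<le> e / 2" using x[of "e / 2"] by auto
    hence "\<forall>n\<ge>N. norm (padic_abs (x - padic_of_rat (R n)) - 0) < e"
      using \<open>e > 0\<close> padic_abs_nonneg[of "x - padic_of_rat (R _)"] by fastforce
    thus "\<exists>N. \<forall>n\<ge>N. norm (padic_abs (x - padic_of_rat (R n)) - 0) < e" ..
  qed
  thus thesis by (rule that)
qed


subsection \<open>Density, completeness and compactness\<close>

lemma padic_units_iff: "x \<in> padic_units \<longleftrightarrow> padic_abs (x :: 'p::prime_card padic) = 1"
proof
  assume "x \<in> padic_units"
  then obtain y where xy: "padic_abs x \<le> 1" "padic_abs y \<le> 1" "x * y = 1"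
    by (auto simp: padic_units_def padic_integers_def)
  from xy(3) have "padic_abs x * padic_abs y = 1" by (simp flip: padic_abs_mult)
  moreover have "padic_abs x * padic_abs y \<le> padic_abs x"
    using xy padic_abs_nonneg[of x] by (simp add: mult_left_le)
  ultimately show "padic_abs x = 1" using xy by simp
next
  assume "padic_abs x = 1"
  moreover from this have "x \<noteq> 0" by auto
  ultimately show "x \<in> padic_units"
    by (auto simp: padic_units_def padic_integers_def padic_abs_inverse intro!: exI[of _ "inverse x"])
qed

text \<open>A rational closer to \<open>x\<close> than 0 is has the same absolute value, by the
  isosceles principle, so the field has the same value group as the rationals.\<close>

lemma padic_abs_value:
  assumes "x \<noteq> 0"
  obtains n :: int where "padic_abs (x :: 'p::prime_card padic) = real CARD('p) powi n"
proof -
  obtain r where r: "padic_abs (x - padic_of_rat r) < padic_abs x"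
    using padic_dense_rat[OF padic_abs_pos[OF assms]] .
  have "padic_abs (padic_of_rat r :: 'p padic) = padic_abs x"
    using padic_abs_add_eq[of "padic_of_rat r - x" x] r by (simp add: padic_abs_minus_commute)
  hence "rat_padic_abs CARD('p) r = padic_abs x" by (simp add: padic_abs_of_rat)
  moreover from this have "r \<noteq> 0" using padic_abs_pos[OF assms] by auto
  ultimately have "padic_abs x = real CARD('p) powi
      (int (multiplicity (int CARD('p)) (snd (quotient_of r)))
       - int (multiplicity (int CARD('p)) (fst (quotient_of r))))"
    by (simp add: rat_padic_abs_def)
  thus thesis by (rule that)
qed

text \<open>The value group is discrete: no power of p lies strictly between 1 / p and 1.\<close>

lemma padic_abs_less_1D:
  assumes "padic_abs (x :: 'p::prime_card padic) < 1"
  shows "padic_abs x \<le> 1 / real CARD('p)"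
proof (cases "x = 0")
  case False
  then obtain n where n: "padic_abs x = real CARD('p) powi n" by (rule padic_abs_value)
  have p: "1 < real CARD('p)" by (rule prime_card_gt_1)
  have "n < 0"
  proof (rule ccontr)
    assume "\<not> n < 0"
    hence "1 \<le> real CARD('p) powi n" using p by (intro one_le_power_int) auto
    thus False using n assms by simp
  qed
  hence "real CARD('p) powi n \<le> real CARD('p) powi (-1)"
    using p by (intro power_int_increasing) auto
  thus ?thesis using n by (simp add: power_int_minus divide_inverse)
qed auto

lemma padic_abs_gt_1D:
  assumes "1 < padic_abs (x :: 'p::prime_card padic)"
  shows "real CARD('p) \<le> padic_abs x"
proof -
  have "padic_abs (inverse x) \<le> 1 / real CARD('p)"
    using assms by (intro padic_abs_less_1D) (simp add: padic_abs_inverse inverse_less_1_iff)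
  moreover have "x \<noteq> 0" using assms by auto
  ultimately show ?thesis
    using prime_card_gt_1[where 'p='p] padic_abs_pos[of x]
    unfolding padic_abs_inverse by (simp add: field_simps)
qed

lemma padic_abs_of_int_eq_1:
  assumes "\<not> int CARD('p) dvd z"
  shows "padic_abs (of_int z :: 'p::prime_card padic) = 1"
proof -
  have "multiplicity (int CARD('p)) z = 0" "z \<noteq> 0"
    using assms by (auto simp: not_dvd_imp_multiplicity_0)
  thus ?thesis
    using rat_padic_abs_divide[OF prime_card, of z 1, where 'a1='p] by (simp add: padic_abs_of_int)
qed

lemma padic_of_rat_mult: "padic_of_rat (r * s) = padic_of_rat r * padic_of_rat s"
  by transfer (simp add: padic_rel_def prime_card)

text \<open>A nearby rational c / d in lowest terms has p not dividing d, as otherwise |c| = 1 and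
  |c / d| > 1. So d is invertible modulo p^n by Bezout, and c times that inverse, reduced modulo
  p^n, is the integer sought.\<close>

lemma padic_dense_int:
  fixes x :: "'p::prime_card padic"
  assumes "padic_abs x \<le> 1"
  obtains a :: nat where "a < CARD('p) ^ n" "padic_abs (x - of_nat a) \<le> (1 / real CARD('p)) ^ n"
proof -
  let ?p = "CARD('p)"
  have p: "prime ?p" by (rule prime_card)
  have p1: "1 < real ?p" by (rule prime_card_gt_1)
  obtain r where r: "padic_abs (x - padic_of_rat r) < (1 / real ?p) ^ n"
    using padic_dense_rat[of "(1 / real ?p) ^ n" x] p1 by auto
  also have "\<dots> \<le> 1" using p1 by (intro power_le_one) auto
  finally have r1: "padic_abs (padic_of_rat r :: 'p padic) \<le> 1"
    using padic_abs_diff_le[of x 1 "x - padic_of_rat r"] assms by simp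
  obtain c d where cd: "quotient_of r = (c, d)" by fastforce
  have d0: "d > 0" using quotient_of_denom_pos[OF cd] .
  have rd: "r = of_int c / of_int d" using quotient_of_div[OF cd] .
  have copr: "coprime c d" using quotient_of_coprime[OF cd] .
  have rd': "padic_of_rat r * of_int d = (of_int c :: 'p padic)"
    using d0 by (simp flip: padic_of_rat_of_int padic_of_rat_mult add: rd)
  have nd: "\<not> int ?p dvd d"
  proof
    assume pd: "int ?p dvd d"
    hence "\<not> int ?p dvd c"
      using copr p by (meson coprime_common_divisor not_prime_unit prime_nat_int_transfer)
    hence "padic_abs (of_int c :: 'p padic) = 1" by (rule padic_abs_of_int_eq_1)
    moreover have "padic_abs (of_int d :: 'p padic) < 1"
    proof -
      have "padic_abs (of_int d :: 'p padic) \<le> 1 / real ?p"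
        using padic_abs_of_int_le_iff[of d 1, where 'p='p] pd by simp
      also have "\<dots> < 1" using p1 by simp
      finally show ?thesis .
    qed
    ultimately have "padic_abs (padic_of_rat r * of_int d :: 'p padic) < 1"
      using r1 padic_abs_nonneg[of "padic_of_rat r :: 'p padic"] padic_abs_nonneg[of "of_int d :: 'p padic"]
      by (simp add: padic_abs_mult mult_le_one mult_le_cancel_right1 order.strict_trans1[OF mult_left_le_one_le])
    thus False using \<open>padic_abs (of_int c :: 'p padic) = 1\<close> rd' by simp
  qed
  hence "coprime d (int ?p ^ n)"
    using p by (metis coprime_commute coprime_power_left_iff prime_imp_coprime prime_nat_int_transfer)
  then obtain s t where st: "s * d + t * int ?p ^ n = 1"
    using bezout_int[of d "int ?p ^ n"] by (auto simp: coprime_iff_gcd_eq_1)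
  define a where "a = nat ((c * s) mod int ?p ^ n)"
  have pn: "int ?p ^ n > 0" using p1 by simp
  have "int a = (c * s) mod int ?p ^ n" using pn by (simp add: a_def)
  then obtain w where w: "int a = c * s + w * int ?p ^ n"
    by (metis mod_eqE mod_mod_trivial mult.commute)
  have "c - int a * d = c * (s * d + t * int ?p ^ n) - int a * d" by (simp add: st)
  also have "\<dots> = int ?p ^ n * (c * t - w * d)" by (simp add: w algebra_simps)
  finally have dv: "int ?p ^ n dvd c - int a * d" by simp
  have "(padic_of_rat r - of_nat a) * of_int d = (of_int (c - int a * d) :: 'p padic)"
    by (simp add: left_diff_distrib rd')
  hence "padic_abs ((padic_of_rat r - of_nat a) * of_int d :: 'p padic) \<le> (1 / real ?p) ^ n"
    using dv padic_abs_of_int_le_iff by metis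
  hence "padic_abs (padic_of_rat r - of_nat a :: 'p padic) \<le> (1 / real ?p) ^ n"
    by (simp add: padic_abs_mult padic_abs_of_int_eq_1[OF nd])
  hence "padic_abs (x - of_nat a) \<le> (1 / real ?p) ^ n"
    using padic_abs_add_le[of "x - padic_of_rat r" _ "padic_of_rat r - of_nat a"] r by simp
  moreover have "int a < int ?p ^ n" using pn by (simp add: a_def)
  hence "a < ?p ^ n" by (metis of_nat_less_iff of_nat_power)
  ultimately show thesis using that by blast
qed

lemma inverse_prime_power_less:
  assumes "0 < e"
  obtains n where "(1 / real CARD('p::prime_card)) ^ n < e"
  using real_arch_pow_inv[OF assms, of "1 / real CARD('p)"] prime_card_gt_1[where 'p='p] by auto

lemma prime_power_ge: obtains n where "r \<le> real CARD('p::prime_card) ^ n"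
  using real_arch_pow[OF prime_card_gt_1[where 'p='p], of r] less_imp_le by blast

lemma padic_abs_uniformizer_power:
  "padic_abs (uniformizer ^ n :: 'p::prime_card padic) = (1 / real CARD('p)) ^ n"
  by (simp add: padic_abs_power padic_abs_uniformizer)

text \<open>Multiplication by p^N carries the ball into the integers of the field. Only finitely
  many \<open>a\<close> occur, which gives total boundedness; the centres over all \<open>N\<close>
  and \<open>a\<close> are countable, which gives a countable base.\<close>

lemma padic_finite_net:
  fixes x :: "'p::prime_card padic"
  assumes "padic_abs x \<le> real CARD('p) ^ N"
  obtains a :: nat where "a < CARD('p) ^ (N + n)"
    "padic_abs (x - of_nat a / uniformizer ^ N) \<le> (1 / real CARD('p)) ^ n"
proof -
  have p1: "1 < real CARD('p)" by (rule prime_card_gt_1)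
  have "padic_abs (x * uniformizer ^ N) \<le> real CARD('p) ^ N * (1 / real CARD('p)) ^ N"
    unfolding padic_abs_mult padic_abs_uniformizer_power using assms p1
    by (intro mult_right_mono) auto
  also have "\<dots> = 1" using p1 by (simp add: power_divide)
  finally obtain a where a: "a < CARD('p) ^ (N + n)"
      "padic_abs (x * uniformizer ^ N - of_nat a) \<le> (1 / real CARD('p)) ^ (N + n)"
    using padic_dense_int by blast
  have "x - of_nat a / uniformizer ^ N = (x * uniformizer ^ N - of_nat a) / uniformizer ^ N"
    by (simp add: field_simps)
  hence "padic_abs (x - of_nat a / uniformizer ^ N)
      = padic_abs (x * uniformizer ^ N - of_nat a) / (1 / real CARD('p)) ^ N"
    by (simp only: padic_abs_divide padic_abs_uniformizer_power)
  also have "\<dots> \<le> (1 / real CARD('p)) ^ (N + n) / (1 / real CARD('p)) ^ N"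
    using a p1 by (intro divide_right_mono) auto
  also have "\<dots> = (1 / real CARD('p)) ^ n" using p1 by (simp add: power_add)
  finally show thesis using that a by blast
qed

text \<open>Each \<open>X n\<close> is replaced by a rational at distance below 1 / (n + 1). The
  rational sequence is again Cauchy, and its own class is the limit.\<close>

instance padic :: (prime_card) complete_space
proof
  fix X :: "nat \<Rightarrow> 'a padic"
  assume X: "Cauchy X"
  have "\<exists>r. \<forall>n. padic_abs (X n - padic_of_rat (r n)) < 1 / real (Suc n)"
  proof (rule choice, rule allI)
    fix n
    show "\<exists>r. padic_abs (X n - padic_of_rat r) < 1 / real (Suc n)"
      using padic_dense_rat[of "1 / real (Suc n)" "X n"] by auto
  qed
  then obtain r where r: "\<And>n. padic_abs (X n - padic_of_rat (r n)) < 1 / real (Suc n)" by blast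
  have close: "\<exists>N. \<forall>n\<ge>N. padic_abs (X n - padic_of_rat (r n)) < e" if e: "e > 0" for e
  proof -
    obtain N where N: "1 / real (Suc N) < e" using nat_approx_posE[OF e] by blast
    have "padic_abs (X n - padic_of_rat (r n)) < e" if "n \<ge> N" for n
    proof -
      have "1 / real (Suc n) \<le> 1 / real (Suc N)" using that by (intro divide_left_mono) auto
      thus ?thesis using r[of n] N by linarith
    qed
    thus ?thesis by blast
  qed
  have "padic_cauchy CARD('a) r"
    unfolding padic_cauchy_def
  proof (intro allI impI)
    fix e :: real assume e: "e > 0"
    obtain M where M: "\<forall>m\<ge>M. \<forall>n\<ge>M. dist (X m) (X n) < e"
      using X e unfolding Cauchy_def by blast
    obtain N where N: "\<forall>n\<ge>N. padic_abs (X n - padic_of_rat (r n)) < e"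
      using close[OF e] by blast
    have "rat_padic_abs CARD('a) (r m - r n) < e" if mn: "m \<ge> max M N" "n \<ge> max M N" for m n
    proof -
      have "padic_abs (padic_of_rat (r m) - X m) < e"
        using N mn by (simp add: padic_abs_minus_commute)
      moreover have "padic_abs (X m - X n) < e" using M mn by (simp add: dist_padic_def)
      moreover have "padic_abs (X n - padic_of_rat (r n)) < e" using N mn by simp
      ultimately have "padic_abs ((padic_of_rat (r m) - X m) + ((X m - X n) + (X n - padic_of_rat (r n)))) < e"
        by (intro padic_abs_add_less)
      thus ?thesis by (simp flip: padic_abs_of_rat[where 'p='a] add: padic_of_rat_diff)
    qed
    thus "\<exists>N. \<forall>m\<ge>N. \<forall>n\<ge>N. rat_padic_abs CARD('a) (r m - r n) < e" by blast
  qed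
  then obtain x :: "'a padic" where x: "(\<lambda>n. padic_abs (x - padic_of_rat (r n))) \<longlonglongrightarrow> 0"
    by (rule padic_complete_rat)
  have "X \<longlonglongrightarrow> x"
  proof (rule metric_LIMSEQ_I)
    fix e :: real assume e: "e > 0"
    obtain N where N: "\<forall>n\<ge>N. padic_abs (X n - padic_of_rat (r n)) < e"
      using close[OF e] by blast
    obtain M where M: "\<forall>n\<ge>M. padic_abs (x - padic_of_rat (r n)) < e"
      using LIMSEQ_D[OF x e] by (auto simp: abs_of_nonneg padic_abs_nonneg)
    have "dist (X n) x < e" if "n \<ge> max M N" for n
    proof -
      have "padic_abs ((X n - padic_of_rat (r n)) + (padic_of_rat (r n) - x)) < e"
        using N M that by (intro padic_abs_add_less) (auto simp: padic_abs_minus_commute)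
      thus ?thesis by (simp add: dist_padic_def)
    qed
    thus "\<exists>no. \<forall>n\<ge>no. dist (X n) x < e" by blast
  qed
  thus "convergent X" by (auto simp: convergent_def)
qed

section \<open>Group topology, countable base and compact balls\<close>

lemma padic_tendsto_iff:
  "(f \<longlongrightarrow> (l :: 'p::prime_card padic)) F \<longleftrightarrow> ((\<lambda>x. padic_abs (f x - l)) \<longlongrightarrow> 0) F"
  by (subst tendsto_dist_iff) (simp add: dist_padic_def)

instance padic :: (prime_card) topological_ab_group_add
proof
  fix a b :: "'a padic"
  have "((\<lambda>x. padic_abs (fst x - a) + padic_abs (snd x - b)) \<longlongrightarrow> 0 + 0) (nhds a \<times>\<^sub>F nhds b)"
    by (intro tendsto_add; subst padic_tendsto_iff[symmetric])
      (auto intro: filterlim_fst filterlim_snd)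
  hence "((\<lambda>x. padic_abs (fst x - a) + padic_abs (snd x - b)) \<longlongrightarrow> 0) (nhds a \<times>\<^sub>F nhds b)"
    by simp
  thus "LIM x (nhds a \<times>\<^sub>F nhds b). fst x + snd x :> nhds (a + b)"
    unfolding padic_tendsto_iff
    by (rule tendsto_sandwich[OF _ _ tendsto_const, rotated 2])
      (auto simp: padic_abs_nonneg add_diff_add intro!: always_eventually padic_abs_triangle)
  have "((\<lambda>x. padic_abs (x - a)) \<longlongrightarrow> 0) (nhds a)"
    by (subst padic_tendsto_iff[symmetric]) (rule filterlim_ident)
  thus "(uminus \<longlongrightarrow> - a) (nhds a)"
    unfolding padic_tendsto_iff by (simp add: padic_abs_minus_commute)
qed

lemma continuous_on_padic_mult [continuous_intros]:
  fixes f :: "_ \<Rightarrow> 'p::prime_card padic"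
  assumes "continuous_on A f"
  shows "continuous_on A (\<lambda>x. c * f x)"
proof -
  have "((\<lambda>y. c * f y) \<longlongrightarrow> c * f x) (at x within A)" if "x \<in> A" for x
  proof -
    have "((\<lambda>y. padic_abs (f y - f x)) \<longlongrightarrow> 0) (at x within A)"
      using assms that by (simp add: continuous_on_def flip: padic_tendsto_iff)
    hence "((\<lambda>y. padic_abs c * padic_abs (f y - f x)) \<longlongrightarrow> padic_abs c * 0) (at x within A)"
      by (intro tendsto_intros)
    thus ?thesis by (simp add: padic_tendsto_iff flip: padic_abs_mult right_diff_distrib)
  qed
  thus ?thesis by (simp add: continuous_on_def)
qed

text \<open>By the ultrametric inequality every point of the ball is a centre of it.\<close>

lemma open_padic_ball: "open {x :: 'p::prime_card padic. padic_abs (x - c) \<le> (1 / real CARD('p)) ^ m}"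
  unfolding open_contains_ball
proof (intro ballI exI conjI subsetI)
  show "0 < (1 / real CARD('p)) ^ m" using prime_card_gt_1[where 'p='p] by simp
  fix x y :: "'p padic"
  assume "x \<in> {x. padic_abs (x - c) \<le> (1 / real CARD('p)) ^ m}" "y \<in> ball x ((1 / real CARD('p)) ^ m)"
  thus "y \<in> {x. padic_abs (x - c) \<le> (1 / real CARD('p)) ^ m}"
    using padic_abs_add_le[of "y - x" "(1 / real CARD('p)) ^ m" "x - c"]
    by (simp add: dist_padic_def padic_abs_minus_commute)
qed

lemma topological_basis_padic:
  "topological_basis (range (\<lambda>(a, N, m).
     {x :: 'p::prime_card padic. padic_abs (x - of_nat a / uniformizer ^ N) \<le> (1 / real CARD('p)) ^ m}))"
    (is "topological_basis ?B")
proof (rule topological_basisI)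
  show "open S" if "S \<in> ?B" for S using that by (auto simp: open_padic_ball)
  fix S and x :: "'p padic" assume "open S" "x \<in> S"
  then obtain e where e: "e > 0" "ball x e \<subseteq> S" by (meson open_contains_ball)
  obtain m where m: "(1 / real CARD('p)) ^ m < e"
    using inverse_prime_power_less[OF e(1)] .
  obtain N where "padic_abs x \<le> real CARD('p) ^ N" using prime_power_ge[where 'p='p] by blast
  then obtain a where a: "padic_abs (x - of_nat a / uniformizer ^ N) \<le> (1 / real CARD('p)) ^ m"
    using padic_finite_net by blast
  let ?c = "of_nat a / uniformizer ^ N :: 'p padic"
  let ?S = "{x. padic_abs (x - ?c) \<le> (1 / real CARD('p)) ^ m}"
  have "?S \<subseteq> ball x e"
  proof
    fix y assume "y \<in> ?S"
    hence "padic_abs ((x - ?c) - (y - ?c)) \<le> (1 / real CARD('p)) ^ m"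
      using padic_abs_diff_le[OF a, of "y - ?c"] by simp
    thus "y \<in> ball x e" using m by (simp add: dist_padic_def)
  qed
  moreover have "?S \<in> ?B" by (rule range_eqI[of _ _ "(a, N, m)"]) simp
  ultimately show "\<exists>B'\<in>?B. x \<in> B' \<and> B' \<subseteq> S"
    using e(2) a by (intro bexI[of _ ?S]) auto
qed

instance padic :: (prime_card) second_countable_topology
proof
  let ?B = "range (\<lambda>(a, N, m).
     {x :: 'a padic. padic_abs (x - of_nat a / uniformizer ^ N) \<le> (1 / real CARD('a)) ^ m})"
  have "countable ?B" by (rule countable_image) simp
  thus "\<exists>B :: 'a padic set set. countable B \<and> open = generate_topology B"
    using topological_basis_imp_subbasis[OF topological_basis_padic[where 'p='a]] by blast
qed

lemma continuous_on_padic_abs: "continuous_on A (padic_abs :: 'p::prime_card padic \<Rightarrow> real)"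
proof -
  have "continuous_on A (\<lambda>x :: 'p padic. dist x 0)" by (intro continuous_intros)
  thus ?thesis by (simp add: dist_padic_def)
qed

lemma compact_padic_ball: "compact {x :: 'p::prime_card padic. padic_abs x \<le> r}"
  unfolding compact_eq_totally_bounded
proof (intro conjI allI impI)
  have "closed {x :: 'p padic. padic_abs x \<le> r}"
    by (intro closed_Collect_le continuous_on_padic_abs continuous_intros)
  thus "Topological_Spaces.complete {x :: 'p padic. padic_abs x \<le> r}" by (simp add: complete_eq_closed)
  fix e :: real assume e: "e > 0"
  obtain N where N: "r \<le> real CARD('p) ^ N" by (rule prime_power_ge)
  obtain n where n: "(1 / real CARD('p)) ^ n < e" using inverse_prime_power_less[OF e] .
  let ?k = "(\<lambda>a. of_nat a / uniformizer ^ N :: 'p padic) ` {..<CARD('p) ^ (N + n)}"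
  have "\<exists>c\<in>?k. x \<in> ball c e" if "padic_abs x \<le> r" for x
  proof -
    from that N have "padic_abs x \<le> real CARD('p) ^ N" by simp
    from padic_finite_net[OF this, of n] obtain a where
      "a < CARD('p) ^ (N + n)" "padic_abs (x - of_nat a / uniformizer ^ N) \<le> (1 / real CARD('p)) ^ n" .
    thus ?thesis
      using n by (intro bexI[of _ "of_nat a / uniformizer ^ N"])
        (auto simp: dist_padic_def padic_abs_minus_commute)
  qed
  hence "{x. padic_abs x \<le> r} \<subseteq> (\<Union>c\<in>?k. ball c e)" by (intro subsetI UN_iff[THEN iffD2]) simp
  moreover have "finite ?k" by simp
  ultimately show "\<exists>k. finite k \<and> {x :: 'p padic. padic_abs x \<le> r} \<subseteq> (\<Union>c\<in>k. ball c e)" by blast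
qed


subsection \<open>An additive character and characteristic functions\<close>

text \<open>\<open>padic_char x = exp(2 \<pi> i {x})\<close>, where the fractional part \<open>{x}\<close> is represented by any
  \<open>a / p\<^sup>n\<close> with \<open>x - a / p\<^sup>n\<close> integral.\<close>

definition padic_char :: "'p::prime_card padic \<Rightarrow> complex" where
  "padic_char x = (SOME z. \<exists>(a::int) n. z = cis (2 * pi * (of_int a / real CARD('p) ^ n))
     \<and> padic_abs (x * uniformizer ^ n - of_int a) \<le> (1 / real CARD('p)) ^ n)"

text \<open>Two fractions a / p^n and b / p^m that both approximate \<open>x\<close> up to an
  integral element satisfy a p^m = b p^n modulo p^(n + m), so they differ by an integer and give the
  same point of the circle.\<close>

lemma padic_char_eq:
  fixes x :: "'p::prime_card padic"
  assumes "padic_abs (x * uniformizer ^ n - of_int a) \<le> (1 / real CARD('p)) ^ n"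
  shows "padic_char x = cis (2 * pi * (of_int a / real CARD('p) ^ n))"
proof -
  let ?p = "real CARD('p)"
  have p1: "1 < ?p" by (rule prime_card_gt_1)
  have *: "cis (2 * pi * (of_int b / ?p ^ m)) = cis (2 * pi * (of_int a / ?p ^ n))"
    if b: "padic_abs (x * uniformizer ^ m - of_int b) \<le> (1 / ?p) ^ m" for b :: int and m
  proof -
    have "padic_abs ((x * uniformizer ^ m - of_int b) * uniformizer ^ n) \<le> (1 / ?p) ^ (n + m)"
      using mult_right_mono[OF b, of "(1 / ?p) ^ n"] p1
      by (simp add: padic_abs_mult padic_abs_uniformizer_power power_add mult_ac)
    moreover have "padic_abs ((x * uniformizer ^ n - of_int a) * uniformizer ^ m) \<le> (1 / ?p) ^ (n + m)"
      using mult_right_mono[OF assms, of "(1 / ?p) ^ m"] p1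
      by (simp add: padic_abs_mult padic_abs_uniformizer_power power_add mult_ac)
    ultimately have "padic_abs ((x * uniformizer ^ m - of_int b) * uniformizer ^ n
        - (x * uniformizer ^ n - of_int a) * uniformizer ^ m) \<le> (1 / ?p) ^ (n + m)"
      by (rule padic_abs_diff_le)
    also have "(x * uniformizer ^ m - of_int b) * uniformizer ^ n
        - (x * uniformizer ^ n - of_int a) * uniformizer ^ m
        = of_int (a * int CARD('p) ^ m - b * int CARD('p) ^ n)"
      by (simp add: algebra_simps)
    finally have "int CARD('p) ^ (n + m) dvd a * int CARD('p) ^ m - b * int CARD('p) ^ n"
      by (simp only: padic_abs_of_int_le_iff)
    then obtain k where "a * int CARD('p) ^ m - b * int CARD('p) ^ n = int CARD('p) ^ (n + m) * k"
      by (auto simp: dvd_def)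
    hence "of_int a * ?p ^ m - of_int b * ?p ^ n = ?p ^ (n + m) * of_int k"
      by (simp only: of_int_eq_iff[where 'a=real, symmetric] of_int_diff of_int_mult of_int_power of_int_of_nat_eq)
    hence "of_int a / ?p ^ n = of_int b / ?p ^ m + of_int k"
      using p1 by (simp add: field_simps power_add)
    hence "2 * pi * (of_int a / ?p ^ n) = 2 * pi * (of_int b / ?p ^ m) + 2 * pi * of_int k"
      by (simp only: distrib_left)
    moreover have "cis (2 * pi * of_int k) = 1" by simp
    ultimately show ?thesis by (simp only: mult_1_right flip: cis_mult)
  qed
  show ?thesis
    unfolding padic_char_def
  proof (rule someI2)
    show "\<exists>a' m. cis (2 * pi * (of_int a / ?p ^ n)) = cis (2 * pi * (of_int a' / ?p ^ m))
        \<and> padic_abs (x * uniformizer ^ m - of_int a') \<le> (1 / ?p) ^ m"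
      using assms by blast
  qed (use * in blast)
qed

lemma padic_char_repr:
  fixes x :: "'p::prime_card padic"
  obtains a :: int and n where "padic_abs (x * uniformizer ^ n - of_int a) \<le> (1 / real CARD('p)) ^ n"
    "padic_char x = cis (2 * pi * (of_int a / real CARD('p) ^ n))"
proof -
  obtain N where N: "padic_abs x \<le> real CARD('p) ^ N" by (rule prime_power_ge)
  obtain a :: nat where "padic_abs (x - of_nat a / uniformizer ^ N) \<le> (1 / real CARD('p)) ^ 0"
    using padic_finite_net[OF N] by metis
  hence "padic_abs ((x - of_nat a / uniformizer ^ N) * uniformizer ^ N) \<le> (1 / real CARD('p)) ^ N"
    using prime_card_gt_1[where 'p='p]
    by (simp add: padic_abs_mult padic_abs_uniformizer_power mult_left_le_one_le padic_abs_nonneg)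
  hence "padic_abs (x * uniformizer ^ N - of_int (int a)) \<le> (1 / real CARD('p)) ^ N"
    by (simp add: left_diff_distrib)
  thus thesis using that padic_char_eq by blast
qed

lemma padic_char_add: "padic_char (x + y) = padic_char x * padic_char (y :: 'p::prime_card padic)"
proof -
  let ?p = "real CARD('p)"
  have p1: "1 < ?p" by (rule prime_card_gt_1)
  obtain a n where a: "padic_abs (x * uniformizer ^ n - of_int a) \<le> (1 / ?p) ^ n"
      "padic_char x = cis (2 * pi * (of_int a / ?p ^ n))" by (rule padic_char_repr)
  obtain b m where b: "padic_abs (y * uniformizer ^ m - of_int b) \<le> (1 / ?p) ^ m"
      "padic_char y = cis (2 * pi * (of_int b / ?p ^ m))" by (rule padic_char_repr)
  have "padic_abs ((y * uniformizer ^ m - of_int b) * uniformizer ^ n) \<le> (1 / ?p) ^ (n + m)"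
    using mult_right_mono[OF b(1), of "(1 / ?p) ^ n"] p1
    by (simp add: padic_abs_mult padic_abs_uniformizer_power power_add mult_ac)
  moreover have "padic_abs ((x * uniformizer ^ n - of_int a) * uniformizer ^ m) \<le> (1 / ?p) ^ (n + m)"
    using mult_right_mono[OF a(1), of "(1 / ?p) ^ m"] p1
    by (simp add: padic_abs_mult padic_abs_uniformizer_power power_add mult_ac)
  ultimately have "padic_abs ((y * uniformizer ^ m - of_int b) * uniformizer ^ n
      + (x * uniformizer ^ n - of_int a) * uniformizer ^ m) \<le> (1 / ?p) ^ (n + m)"
    by (rule padic_abs_add_le)
  also have "(y * uniformizer ^ m - of_int b) * uniformizer ^ n
      + (x * uniformizer ^ n - of_int a) * uniformizer ^ m
      = (x + y) * uniformizer ^ (n + m) - of_int (a * int CARD('p) ^ m + b * int CARD('p) ^ n)"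
    by (simp add: algebra_simps power_add)
  finally have "padic_char (x + y)
      = cis (2 * pi * (of_int (a * int CARD('p) ^ m + b * int CARD('p) ^ n) / ?p ^ (n + m)))"
    by (rule padic_char_eq)
  also have "of_int (a * int CARD('p) ^ m + b * int CARD('p) ^ n) / ?p ^ (n + m)
      = of_int a / ?p ^ n + of_int b / ?p ^ m"
    using p1 by (simp add: field_simps power_add)
  finally show ?thesis using a b by (simp add: cis_mult distrib_left)
qed

lemma norm_padic_char [simp]: "norm (padic_char x) = 1"
  by (rule padic_char_repr[of x]) simp

text \<open>If the fraction a / p^n is an integer, \<open>x\<close> itself is integral. A kernel
  that is exactly \<open>padic_integers\<close> lets the characters x \<mapsto> padic_char (y * x)
  test membership in any ball.\<close>

lemma padic_char_eq_1_iff: "padic_char x = 1 \<longleftrightarrow> padic_abs (x :: 'p::prime_card padic) \<le> 1"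
proof
  assume "padic_abs x \<le> 1"
  thus "padic_char x = 1" using padic_char_eq[of x 0 0] by simp
next
  let ?p = "real CARD('p)"
  have p1: "1 < ?p" by (rule prime_card_gt_1)
  assume 1: "padic_char x = 1"
  obtain a n where a: "padic_abs (x * uniformizer ^ n - of_int a) \<le> (1 / ?p) ^ n"
      "padic_char x = cis (2 * pi * (of_int a / ?p ^ n))" by (rule padic_char_repr)
  from 1 a have "cos (2 * pi * (of_int a / ?p ^ n)) = 1"
    by (metis cis.sel(1) one_complex.sel(1))
  then obtain k :: int where "2 * pi * (of_int a / ?p ^ n) = of_int k * 2 * pi"
    by (auto simp: cos_one_2pi_int)
  hence "of_int a = of_int k * ?p ^ n" using p1 by (simp add: field_simps)
  hence "real_of_int a = real_of_int (k * int CARD('p) ^ n)" by simp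
  hence "a = k * int CARD('p) ^ n" by (simp only: of_int_eq_iff)
  hence "padic_abs (of_int a :: 'p padic) \<le> (1 / ?p) ^ n" by (simp only: padic_abs_of_int_le_iff dvd_triv_right)
  hence "padic_abs (x * uniformizer ^ n) \<le> (1 / ?p) ^ n"
    using padic_abs_add_le[OF a(1), of "of_int a"] by simp
  thus "padic_abs x \<le> 1"
    using p1 by (simp add: padic_abs_mult padic_abs_uniformizer_power)
qed

lemma padic_char_0 [simp]: "padic_char 0 = 1"
  by (simp add: padic_char_eq_1_iff)

lemma padic_char_nonzero [simp]: "padic_char x \<noteq> 0"
  using norm_padic_char[of x] by fastforce

lemma padic_char_diff: "padic_char (x - y) = padic_char x / padic_char y"
  using padic_char_add[of "x - y" y] by simp

lemma padic_char_sum: "padic_char (sum f A) = (\<Prod>i\<in>A. padic_char (f i))"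
  by (induction A rule: infinite_finite_induct) (auto simp: padic_char_add)

lemma padic_char_of_nat_mult: "padic_char (of_nat n * x) = padic_char x ^ n"
  by (induction n) (auto simp: padic_char_add distrib_right)

lemma padic_char_cong:
  "padic_abs (x - y) \<le> 1 \<Longrightarrow> padic_char x = padic_char (y :: 'p::prime_card padic)"
  using padic_char_add[of "x - y" y] by (simp add: padic_char_eq_1_iff[THEN iffD2])

lemma continuous_on_padic_char: "continuous_on A (padic_char :: 'p::prime_card padic \<Rightarrow> complex)"
proof (rule continuous_on_subset[of UNIV])
  show "continuous_on UNIV (padic_char :: 'p padic \<Rightarrow> complex)"
    unfolding continuous_on_iff
  proof (intro ballI allI impI)
    fix x :: "'p padic" and e :: real assume "e > 0"
    thus "\<exists>d>0. \<forall>x'\<in>UNIV. dist x' x < d \<longrightarrow> dist (padic_char x') (padic_char x) < e"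
    proof (intro exI[of _ 1] conjI ballI impI)
      fix y :: "'p padic" assume "dist y x < 1"
      hence "padic_char y = padic_char x" by (intro padic_char_cong) (simp add: dist_padic_def)
      thus "dist (padic_char y) (padic_char x) < e" using \<open>e > 0\<close> by simp
    qed simp
  qed
qed simp

section \<open>Measurability and a generator of the Borel sets\<close>

lemma borel_measurable_padic_char [measurable]:
  "padic_char \<in> borel_measurable (borel :: 'p::prime_card padic measure)"
  by (rule borel_measurable_continuous_onI) (rule continuous_on_padic_char)

lemma borel_measurable_padic_mult [measurable]:
  fixes f :: "_ \<Rightarrow> 'p::prime_card padic"
  assumes "f \<in> borel_measurable M"
  shows "(\<lambda>x. c * f x) \<in> borel_measurable M"
proof -
  have "(\<lambda>x. c * x) \<in> borel_measurable (borel :: 'p padic measure)"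
    by (intro borel_measurable_continuous_onI continuous_intros)
  thus ?thesis using assms by measurable
qed

lemma borel_measurable_padic_abs [measurable]:
  "padic_abs \<in> borel_measurable (borel :: 'p::prime_card padic measure)"
  by (rule borel_measurable_continuous_onI) (rule continuous_on_padic_abs)

lemma borel_measurable_padic_diff [measurable]:
  fixes f :: "_ \<Rightarrow> 'p::prime_card padic"
  assumes "f \<in> borel_measurable M" "g \<in> borel_measurable M"
  shows "(\<lambda>x. f x - g x) \<in> borel_measurable M"
  using assms by (rule borel_measurable_continuous_Pair) (intro continuous_intros)

text \<open>The case \<open>y = 0\<close> gives the whole space, which the generator in \<open>indep_vars_finite\<close> must contain.\<close>

definition padic_cosets :: "'p::prime_card padic set set" where
  "padic_cosets = insert {} (range (\<lambda>(y, c). {x. y * (x - c) \<in> padic_integers}))"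

lemma padic_cosetsI: "{x. y * (x - c) \<in> padic_integers} \<in> padic_cosets"
  unfolding padic_cosets_def by (rule insertI2, rule range_eqI[of _ _ "(y, c)"]) simp

lemma sets_borel_padic_cosets:
  "sets (borel :: 'p::prime_card padic measure) = sigma_sets UNIV padic_cosets"
proof
  let ?B = "range (\<lambda>(a, N, m).
     {x :: 'p padic. padic_abs (x - of_nat a / uniformizer ^ N) \<le> (1 / real CARD('p)) ^ m})"
  have p1: "1 < real CARD('p)" by (rule prime_card_gt_1)
  have "countable ?B" by (rule countable_image) simp
  hence "borel = sigma UNIV ?B"
    by (rule borel_eq_countable_basis[OF _ topological_basis_padic])
  hence "sets borel = sets (sigma UNIV ?B)" by (rule arg_cong)
  also have "\<dots> = sigma_sets UNIV ?B" by (rule sets_measure_of) simp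
  finally have borel: "sets borel = sigma_sets UNIV ?B" .
  have "?B \<subseteq> padic_cosets"
  proof
    fix S assume "S \<in> ?B"
    then obtain a N m where S:
      "S = {x :: 'p padic. padic_abs (x - of_nat a / uniformizer ^ N) \<le> (1 / real CARD('p)) ^ m}" by auto
    have "S = {x. 1 / uniformizer ^ m * (x - of_nat a / uniformizer ^ N) \<in> padic_integers}"
      unfolding S using p1
      by (simp add: padic_integers_def padic_abs_mult padic_abs_divide padic_abs_uniformizer_power field_simps)
    thus "S \<in> padic_cosets" using padic_cosetsI by metis
  qed
  hence "sigma_sets UNIV ?B \<subseteq> sigma_sets UNIV padic_cosets" by (rule sigma_sets_mono')
  thus "sets borel \<subseteq> sigma_sets UNIV (padic_cosets :: 'p padic set set)"
    by (simp only: borel)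
  have "{x :: 'p padic. y * (x - c) \<in> padic_integers} \<in> sets borel" for y c
    unfolding padic_integers_def by measurable
  hence "(padic_cosets :: 'p padic set set) \<subseteq> sets borel" unfolding padic_cosets_def by auto
  thus "sigma_sets UNIV (padic_cosets :: 'p padic set set) \<subseteq> sets borel"
    using sets.sigma_sets_subset[of padic_cosets "borel :: 'p padic measure"] by simp
qed

text \<open>Two balls that meet are nested, and the one with the larger factor \<open>y\<close> is
  the smaller. Disjoint balls account for the empty set in \<open>padic_cosets\<close>.\<close>

lemma Int_stable_padic_cosets: "Int_stable (padic_cosets :: 'p::prime_card padic set set)"
proof (rule Int_stableI)
  fix A B :: "'p padic set" assume A: "A \<in> padic_cosets" and B: "B \<in> padic_cosets"
  have *: "{x. y * (x - c) \<in> padic_integers} \<inter> {x. z * (x - d) \<in> padic_integers} \<in> padic_cosets"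
    if zy: "padic_abs z \<le> padic_abs y" for y c z d :: "'p padic"
  proof (cases "{x. y * (x - c) \<in> padic_integers} \<inter> {x. z * (x - d) \<in> padic_integers} = {}")
    case False
    then obtain x0 where x0: "padic_abs (y * (x0 - c)) \<le> 1" "padic_abs (z * (x0 - d)) \<le> 1"
      by (auto simp: padic_integers_def)
    have "padic_abs (z * (x - d)) \<le> 1" if x: "padic_abs (y * (x - c)) \<le> 1" for x
    proof -
      have "padic_abs (y * (x - c) - y * (x0 - c)) \<le> 1" using x x0 by (intro padic_abs_diff_le)
      hence "padic_abs y * padic_abs (x - x0) \<le> 1" by (simp flip: padic_abs_mult right_diff_distrib)
      moreover have "padic_abs z * padic_abs (x - x0) \<le> padic_abs y * padic_abs (x - x0)"
        using zy padic_abs_nonneg by (intro mult_right_mono)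
      ultimately have "padic_abs (z * (x - x0)) \<le> 1" by (simp add: padic_abs_mult)
      hence "padic_abs (z * (x - x0) + z * (x0 - d)) \<le> 1" using x0 by (intro padic_abs_add_le)
      thus ?thesis by (simp flip: distrib_left)
    qed
    hence "{x. y * (x - c) \<in> padic_integers} \<inter> {x. z * (x - d) \<in> padic_integers}
      = {x. y * (x - c) \<in> padic_integers}" by (auto simp: padic_integers_def)
    thus ?thesis by (auto simp: padic_cosets_def)
  qed (simp add: padic_cosets_def)
  show "A \<inter> B \<in> padic_cosets"
  proof (cases "A = {} \<or> B = {}")
    case False
    then obtain y c z d where "A = {x. y * (x - c) \<in> padic_integers}" "B = {x. z * (x - d) \<in> padic_integers}"
      using A B by (auto simp: padic_cosets_def)
    thus ?thesis
      using *[of y z d c] *[of z y c d] by (cases "padic_abs y \<le> padic_abs z") (auto simp: Int_commute)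
  qed (auto simp: padic_cosets_def)
qed

lemma UNIV_in_padic_cosets: "UNIV \<in> (padic_cosets :: 'p::prime_card padic set set)"
proof -
  have "UNIV \<in> range (\<lambda>(y, c). {x :: 'p padic. y * (x - c) \<in> padic_integers})"
    by (rule range_eqI[of _ _ "(0, 0)"]) (simp add: padic_integers_def)
  thus ?thesis unfolding padic_cosets_def by (rule insertI2)
qed

text \<open>For w \<noteq> 1 the geometric sums stay bounded, so division by N kills them.\<close>

lemma cesaro_mean_power:
  fixes w :: complex
  assumes "norm w = 1"
  shows "(\<lambda>N. (\<Sum>a<N. w ^ a) / of_nat N) \<longlonglongrightarrow> (if w = 1 then 1 else 0)"
proof (cases "w = 1")
  case True
  have "eventually (\<lambda>N. (\<Sum>a<N. w ^ a) / of_nat N = 1) sequentially"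
    using eventually_gt_at_top[of 0] by eventually_elim (simp add: True)
  thus ?thesis using True by (simp add: tendsto_eventually)
next
  case False
  have "norm ((\<Sum>a<N. w ^ a) / of_nat N) \<le> 2 / norm (w - 1) / real N" for N
  proof -
    have "norm (w ^ N - 1) \<le> norm (w ^ N) + norm (1 :: complex)" by (rule norm_triangle_ineq4)
    hence "norm (w ^ N - 1) \<le> 2" using assms by (simp add: norm_power)
    thus ?thesis
      using False by (simp add: geometric_sum norm_divide norm_mult divide_right_mono)
  qed
  moreover have "(\<lambda>N. 2 / norm (w - 1) / real N) \<longlonglongrightarrow> 0"
    by (rule lim_const_over_n)
  ultimately have "(\<lambda>N. (\<Sum>a<N. w ^ a) / of_nat N) \<longlonglongrightarrow> 0"
    by (rule Lim_null_comparison[OF always_eventually[OF allI]])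
  thus ?thesis using False by simp
qed

lemma norm_cesaro_mean_le:
  fixes w :: complex
  assumes "norm w = 1"
  shows "norm ((\<Sum>a<N. w ^ a) / of_nat N) \<le> 1"
proof -
  have "norm (\<Sum>a<N. w ^ a) \<le> (\<Sum>a<N. norm (w ^ a))" by (rule norm_sum)
  also have "\<dots> = real N" using assms by (simp add: norm_power)
  finally have "norm (\<Sum>a<N. w ^ a) / real N \<le> 1" by (cases "N = 0") (auto simp: divide_le_eq)
  thus ?thesis by (simp add: norm_divide)
qed

text \<open>The means are bounded by 1 and converge pointwise to the indicator of the event, so
  dominated convergence applies. The product over \<open>I\<close> covers joint events and, for a
  singleton \<open>I\<close>, marginal ones.\<close>

lemma (in prob_space) prob_padic_integers_tendsto:
  fixes Y :: "'i \<Rightarrow> 'a \<Rightarrow> 'p::prime_card padic"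
  assumes I: "finite I" and Y: "\<And>i. i \<in> I \<Longrightarrow> random_variable borel (Y i)"
  shows "(\<lambda>N. LINT \<omega>|M. (\<Prod>i\<in>I. (\<Sum>a<N. padic_char (Y i \<omega>) ^ a) / of_nat N))
    \<longlonglongrightarrow> of_real (prob {\<omega> \<in> space M. \<forall>i\<in>I. Y i \<omega> \<in> padic_integers})"
proof -
  let ?A = "{\<omega> \<in> space M. \<forall>i\<in>I. Y i \<omega> \<in> padic_integers}"
  have A: "?A \<in> events"
  proof -
    have "?A = {\<omega> \<in> space M. \<forall>i\<in>I. padic_abs (Y i \<omega>) \<le> 1}" by (simp add: padic_integers_def)
    also have "\<dots> \<in> events"
      using I Y by (intro sets.sets_Collect_finite_All borel_measurable_le) auto
    finally show ?thesis .
  qed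
  have "(\<lambda>N. LINT \<omega>|M. (\<Prod>i\<in>I. (\<Sum>a<N. padic_char (Y i \<omega>) ^ a) / of_nat N))
      \<longlonglongrightarrow> (LINT \<omega>|M. of_real (indicator ?A \<omega>))"
  proof (rule integral_dominated_convergence[where w = "\<lambda>_. 1"])
    show "(\<lambda>\<omega>. complex_of_real (indicator ?A \<omega>)) \<in> borel_measurable M" using A by measurable
    show "(\<lambda>\<omega>. \<Prod>i\<in>I. (\<Sum>a<N. padic_char (Y i \<omega>) ^ a) / of_nat N) \<in> borel_measurable M" for N
      using Y by measurable
    show "AE \<omega> in M. (\<lambda>N. \<Prod>i\<in>I. (\<Sum>a<N. padic_char (Y i \<omega>) ^ a) / of_nat N)
        \<longlonglongrightarrow> complex_of_real (indicator ?A \<omega>)"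
    proof (rule AE_I2)
      fix \<omega> assume \<omega>: "\<omega> \<in> space M"
      have "(\<lambda>N. \<Prod>i\<in>I. (\<Sum>a<N. padic_char (Y i \<omega>) ^ a) / of_nat N)
          \<longlonglongrightarrow> (\<Prod>i\<in>I. if padic_char (Y i \<omega>) = 1 then 1 else 0)"
        by (intro tendsto_prod cesaro_mean_power) simp
      also have "(\<Prod>i\<in>I. if padic_char (Y i \<omega>) = 1 then 1 else 0) = complex_of_real (indicator ?A \<omega>)"
        using \<omega> I by (auto simp: padic_char_eq_1_iff padic_integers_def indicator_def)
      finally show "(\<lambda>N. \<Prod>i\<in>I. (\<Sum>a<N. padic_char (Y i \<omega>) ^ a) / of_nat N)
          \<longlonglongrightarrow> complex_of_real (indicator ?A \<omega>)" .
    qed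
    show "AE \<omega> in M. norm (\<Prod>i\<in>I. (\<Sum>a<N. padic_char (Y i \<omega>) ^ a) / of_nat N) \<le> 1" for N
      by (intro AE_I2 order.trans[OF norm_prod_le] prod_le_1 conjI norm_cesaro_mean_le) auto
  qed simp
  also have "(LINT \<omega>|M. complex_of_real (indicator ?A \<omega>)) = of_real (prob ?A)"
    using A by (simp add: integral_complex_of_real)
  finally show ?thesis .
qed

definition padic_charf :: "'w measure \<Rightarrow> ('w \<Rightarrow> 'p::prime_card padic) \<Rightarrow> 'p padic \<Rightarrow> complex" where
  "padic_charf M X y = (LINT \<omega>|M. padic_char (y * X \<omega>))"

lemma (in prob_space) integrable_padic_char:
  assumes [measurable]: "random_variable borel (X :: 'a \<Rightarrow> 'p::prime_card padic)"
  shows "integrable M (\<lambda>\<omega>. padic_char (X \<omega>))"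
  by (rule integrable_const_bound[where B = 1]) auto

text \<open>The Cesaro means of the powers of \<open>padic_char (y * (x - c))\<close> approximate the indicator of
  a coset, so the characteristic functions determine the probabilities of all cosets.\<close>

lemma (in prob_space) indep_vars_padicI:
  fixes X :: "'i \<Rightarrow> 'a \<Rightarrow> 'p::prime_card padic"
  assumes I: "finite I" "I \<noteq> {}" and X [measurable]: "\<And>i. i \<in> I \<Longrightarrow> random_variable borel (X i)"
    and fact: "\<And>u. (LINT \<omega>|M. (\<Prod>i\<in>I. padic_char (u i * X i \<omega>))) = (\<Prod>i\<in>I. padic_charf M (X i) (u i))"
  shows "indep_vars (\<lambda>_. borel) X I"
proof (subst indep_vars_finite[where E = "\<lambda>_. padic_cosets"])
  show "\<forall>A\<in>I \<rightarrow> padic_cosets. prob (\<Inter>j\<in>I. X j -` A j \<inter> space M) = (\<Prod>j\<in>I. prob (X j -` A j \<inter> space M))"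
  proof
    fix A assume A: "A \<in> I \<rightarrow> (padic_cosets :: 'p padic set set)"
    show "prob (\<Inter>j\<in>I. X j -` A j \<inter> space M) = (\<Prod>j\<in>I. prob (X j -` A j \<inter> space M))"
    proof (cases "\<exists>j\<in>I. A j = {}")
      case True
      then obtain j where j: "j \<in> I" "A j = {}" by blast
      hence "(\<Inter>j\<in>I. X j -` A j \<inter> space M) = {}" by blast
      moreover have "prob (X j -` A j \<inter> space M) = 0" using j by simp
      hence "(\<Prod>j\<in>I. prob (X j -` A j \<inter> space M)) = 0" using j I by (metis prod_zero)
      ultimately show ?thesis by simp
    next
      case False
      hence "\<forall>j\<in>I. \<exists>y c. A j = {x. y * (x - c) \<in> padic_integers}"
        using A by (fastforce simp: padic_cosets_def Pi_def)
      then obtain y c where yc: "\<And>j. j \<in> I \<Longrightarrow> A j = {x. y j * (x - c j) \<in> padic_integers}"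
        by metis
      define Y where "Y j \<omega> = y j * (X j \<omega> - c j)" for j \<omega>
      have Y [measurable]: "random_variable borel (Y j)" if "j \<in> I" for j
        unfolding Y_def using X[OF that] by measurable
      have char_Y: "padic_char (Y j \<omega>) ^ a = padic_char (of_nat a * y j * X j \<omega>) / padic_char (of_nat a * y j * c j)"
        for j a \<omega>
        by (simp add: Y_def mult.assoc right_diff_distrib padic_char_diff
          power_divide flip: padic_char_of_nat_mult)
      \<comment> \<open>Expanding the product of sums gives one term for each choice f of exponents.
        Up to a constant it is a product of characters with frequencies f i * y i, to which
        \<open>fact\<close> applies.\<close>
      have prodE: "(LINT \<omega>|M. (\<Prod>i\<in>I. (\<Sum>a<N. padic_char (Y i \<omega>) ^ a) / of_nat N))
        = (\<Prod>i\<in>I. LINT \<omega>|M. (\<Sum>a<N. padic_char (Y i \<omega>) ^ a) / of_nat N)" for N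
      proof -
        have int: "integrable M (\<lambda>\<omega>. padic_char (Y i \<omega>) ^ a)" if "i \<in> I" for i a
          using that by (intro integrable_const_bound[where B = 1]) (auto simp: norm_power)
        have intP: "integrable M (\<lambda>\<omega>. \<Prod>i\<in>I. padic_char (Y i \<omega>) ^ f i)" for f
          by (intro integrable_const_bound[where B = 1])
            (auto simp: norm_power simp flip: prod_norm)
        have "(LINT \<omega>|M. (\<Prod>i\<in>I. (\<Sum>a<N. padic_char (Y i \<omega>) ^ a) / of_nat N))
          = (LINT \<omega>|M. (\<Sum>f\<in>I \<rightarrow>\<^sub>E {..<N}. \<Prod>i\<in>I. padic_char (Y i \<omega>) ^ f i) / of_nat N ^ card I)"
          using I by (simp add: prod_dividef prod_sum_PiE)
        also have "\<dots> = (\<Sum>f\<in>I \<rightarrow>\<^sub>E {..<N}. (LINT \<omega>|M. (\<Prod>i\<in>I. padic_char (Y i \<omega>) ^ f i))) / of_nat N ^ card I"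
          using intP by simp
        also have "\<dots> = (\<Sum>f\<in>I \<rightarrow>\<^sub>E {..<N}. \<Prod>i\<in>I. LINT \<omega>|M. padic_char (Y i \<omega>) ^ f i) / of_nat N ^ card I"
          unfolding char_Y prod_dividef
          using fact[of "\<lambda>i. of_nat (f i) * y i" for f]
          by (simp add: prod_dividef padic_charf_def)
        also have "\<dots> = (\<Prod>i\<in>I. LINT \<omega>|M. (\<Sum>a<N. padic_char (Y i \<omega>) ^ a) / of_nat N)"
          using I int by (simp add: prod_dividef prod_sum_PiE)
        finally show ?thesis .
      qed
      have "(\<lambda>N. LINT \<omega>|M. (\<Prod>i\<in>I. (\<Sum>a<N. padic_char (Y i \<omega>) ^ a) / of_nat N))
          \<longlonglongrightarrow> of_real (prob {\<omega> \<in> space M. \<forall>i\<in>I. Y i \<omega> \<in> padic_integers})"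
        using I Y by (intro prob_padic_integers_tendsto)
      moreover have "(\<lambda>N. \<Prod>i\<in>I. LINT \<omega>|M. (\<Sum>a<N. padic_char (Y i \<omega>) ^ a) / of_nat N)
          \<longlonglongrightarrow> (\<Prod>i\<in>I. of_real (prob {\<omega> \<in> space M. Y i \<omega> \<in> padic_integers}))"
      proof (rule tendsto_prod)
        fix i assume "i \<in> I"
        thus "(\<lambda>N. LINT \<omega>|M. (\<Sum>a<N. padic_char (Y i \<omega>) ^ a) / of_nat N)
          \<longlonglongrightarrow> of_real (prob {\<omega> \<in> space M. Y i \<omega> \<in> padic_integers})"
          using prob_padic_integers_tendsto[of "{i}" Y] Y by simp
      qed
      ultimately have "complex_of_real (prob {\<omega> \<in> space M. \<forall>i\<in>I. Y i \<omega> \<in> padic_integers})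
          = (\<Prod>i\<in>I. of_real (prob {\<omega> \<in> space M. Y i \<omega> \<in> padic_integers}))"
        unfolding prodE by (rule LIMSEQ_unique)
      hence "prob {\<omega> \<in> space M. \<forall>i\<in>I. Y i \<omega> \<in> padic_integers}
          = (\<Prod>i\<in>I. prob {\<omega> \<in> space M. Y i \<omega> \<in> padic_integers})"
        by (simp only: of_real_eq_iff flip: of_real_prod)
      moreover have "(\<Inter>j\<in>I. X j -` A j \<inter> space M) = {\<omega> \<in> space M. \<forall>i\<in>I. Y i \<omega> \<in> padic_integers}"
        using I yc by (auto simp: Y_def)
      moreover have "X j -` A j \<inter> space M = {\<omega> \<in> space M. Y j \<omega> \<in> padic_integers}" if "j \<in> I" for j
        using yc[OF that] by (auto simp: Y_def)
      ultimately show ?thesis by simp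
    qed
  qed
qed (use I X sets_borel_padic_cosets Int_stable_padic_cosets UNIV_in_padic_cosets in auto)

text \<open>Equal characteristic functions give equal Cesaro means, hence equal probabilities of all
  cosets; these form an intersection-stable generator.\<close>

lemma padic_charf_unique:
  fixes M N :: "'p::prime_card padic measure"
  assumes "prob_space M" "prob_space N" "sets M = sets borel" "sets N = sets borel"
    and eq: "\<And>y. padic_charf M (\<lambda>x. x) y = padic_charf N (\<lambda>x. x) y"
  shows "M = N"
proof (rule measure_eqI_generator_eq[where A = "\<lambda>_. UNIV" and E = padic_cosets and \<Omega> = UNIV])
  interpret M: prob_space M by fact
  interpret N: prob_space N by fact
  have [measurable_cong]: "sets M = sets borel" "sets N = sets borel" by fact+
  have sp: "space M = UNIV" "space N = UNIV"
    using sets_eq_imp_space_eq[OF assms(3)] sets_eq_imp_space_eq[OF assms(4)] by auto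
  fix A :: "'p padic set" assume "A \<in> padic_cosets"
  show "emeasure M A = emeasure N A"
  proof (cases "A = {}")
    case False
    then obtain y c where A: "A = {x. y * (x - c) \<in> padic_integers}"
      using \<open>A \<in> padic_cosets\<close> by (auto simp: padic_cosets_def)
    define Y where "Y x = y * (x - c)" for x
    have char_Y: "padic_char (Y x) ^ a = padic_char (of_nat a * y * x) / padic_char (of_nat a * y * c)" for a x
      by (simp add: Y_def mult.assoc right_diff_distrib padic_char_diff
        power_divide flip: padic_char_of_nat_mult)
    have [measurable]: "Y \<in> borel_measurable borel" unfolding Y_def by measurable
    have intM: "integrable M (\<lambda>\<omega>. padic_char (of_nat a * y * \<omega>))" for a
      by (rule M.integrable_padic_char) measurable
    have intN: "integrable N (\<lambda>\<omega>. padic_char (of_nat a * y * \<omega>))" for a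
      by (rule N.integrable_padic_char) measurable
    have int_eq: "(LINT \<omega>|M. (\<Sum>a<n. padic_char (Y \<omega>) ^ a) / of_nat n)
        = (LINT \<omega>|N. (\<Sum>a<n. padic_char (Y \<omega>) ^ a) / of_nat n)" for n
      unfolding char_Y using eq intM intN by (simp add: padic_charf_def)
    have A': "A = {x. Y x \<in> padic_integers}" by (simp add: A Y_def)
    have "(\<lambda>n. LINT \<omega>|M. (\<Sum>a<n. padic_char (Y \<omega>) ^ a) / of_nat n) \<longlonglongrightarrow> of_real (M.prob A)"
      using M.prob_padic_integers_tendsto[of "{()}" "\<lambda>_. Y"] by (simp add: sp A')
    moreover have "(\<lambda>n. LINT \<omega>|M. (\<Sum>a<n. padic_char (Y \<omega>) ^ a) / of_nat n) \<longlonglongrightarrow> of_real (N.prob A)"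
      unfolding int_eq using N.prob_padic_integers_tendsto[of "{()}" "\<lambda>_. Y"] by (simp add: sp A')
    ultimately have "complex_of_real (M.prob A) = of_real (N.prob A)"
      by (rule LIMSEQ_unique)
    hence "M.prob A = N.prob A" by (simp only: of_real_eq_iff)
    thus ?thesis by (simp add: M.emeasure_eq_measure N.emeasure_eq_measure)
  qed simp
qed (use assms sets_borel_padic_cosets Int_stable_padic_cosets UNIV_in_padic_cosets
  in \<open>auto simp: prob_space.emeasure_space_1 finite_measure.emeasure_finite prob_space.finite_measure\<close>)


subsection \<open>The equation of independent linear forms\<close>

lemma prod_le_member:
  fixes f :: "'a \<Rightarrow> real"
  assumes "finite A" "x \<in> A" "\<And>i. i \<in> A \<Longrightarrow> 0 \<le> f i" "\<And>i. i \<in> A \<Longrightarrow> f i \<le> 1"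
  shows "prod f A \<le> f x"
proof -
  have "prod f A = f x * prod f (A - {x})" using assms(1,2) by (rule prod.remove)
  also have "\<dots> \<le> f x" using assms by (intro mult_left_le prod_le_1) auto
  finally show ?thesis .
qed

lemma prod_le_two_members:
  fixes f :: "'a \<Rightarrow> real"
  assumes "finite A" "x \<in> A" "y \<in> A" "x \<noteq> y" "\<And>i. i \<in> A \<Longrightarrow> 0 \<le> f i" "\<And>i. i \<in> A \<Longrightarrow> f i \<le> 1"
  shows "prod f A \<le> f x * f y"
proof -
  have "prod f A = f x * prod f (A - {x})" using assms(1,2) by (rule prod.remove)
  also have "\<dots> \<le> f x * f y" using assms by (intro mult_left_mono prod_le_member) auto
  finally show ?thesis .
qed

lemma prod_eq_1_imp_eq_1:
  fixes f :: "'a \<Rightarrow> real"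
  assumes "finite A" "x \<in> A" "\<And>i. i \<in> A \<Longrightarrow> 0 \<le> f i" "\<And>i. i \<in> A \<Longrightarrow> f i \<le> 1" "prod f A = 1"
  shows "f x = 1"
  using prod_le_member[OF assms(1,2), of f] assms by (simp add: order.antisym)

text \<open>A constant second difference makes the sequence quadratic. \<open>lin0\<close> says that
  a bounded affine sequence has slope 0; it is used on the first differences and then on the
  sequence itself.\<close>

lemma bounded_second_difference_const_imp_const:
  fixes a :: "nat \<Rightarrow> real"
  assumes diff: "\<And>n. a (n + 2) - 2 * a (n + 1) + a n = K" and bound: "\<And>n. \<bar>a n\<bar> \<le> B"
  shows "a n = a 0"
proof -
  have lin0: "c = 0" if lin: "\<And>n. \<bar>b + real n * c\<bar> \<le> D" for b c D :: real
  proof (rule ccontr)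
    assume "c \<noteq> 0"
    then obtain n where n: "D + \<bar>b\<bar> < real n * \<bar>c\<bar>"
      using reals_Archimedean3[of "\<bar>c\<bar>"] by auto
    have "real n * \<bar>c\<bar> \<le> \<bar>b + real n * c\<bar> + \<bar>b\<bar>"
      using abs_triangle_ineq4[of "b + real n * c" b] by (simp add: abs_mult)
    thus False using n lin[of n] by linarith
  qed
  have d: "a (n + 1) - a n = a 1 - a 0 + real n * K" for n
  proof (induction n)
    case (Suc n)
    thus ?case using diff[of n] by (simp add: algebra_simps)
  qed simp
  have "\<bar>(a 1 - a 0) + real n * K\<bar> \<le> B + B" for n
    using bound[of "n + 1"] bound[of n] unfolding d[symmetric] by linarith
  hence K: "K = 0" by (rule lin0)
  have a: "a n = a 0 + real n * (a 1 - a 0)" for n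
  proof (induction n)
    case (Suc n)
    thus ?case using d[of n] K by (simp add: algebra_simps)
  qed simp
  have "\<bar>a 0 + real n * (a 1 - a 0)\<bar> \<le> B" for n
    using bound[of n] unfolding a[of n] .
  hence "a 1 - a 0 = 0" by (rule lin0)
  thus ?thesis using a[of n] by simp
qed

lemma matrix_inv_left:
  fixes A :: "'a::field^'n^'n"
  assumes "det A \<noteq> 0"
  shows "matrix_inv A ** A = mat 1"
proof -
  have "\<exists>B. A ** B = mat 1 \<and> B ** A = mat 1"
    using assms by (simp flip: invertible_det_nz add: invertible_def)
  hence "A ** matrix_inv A = mat 1 \<and> matrix_inv A ** A = mat 1"
    unfolding matrix_inv_def by (rule someI_ex)
  thus ?thesis ..
qed

text \<open>The ultrametric inequality bounds the Leibniz sum by its largest term, with no factor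
  for the number of permutations. This carries both the comparison of volumes and the integrality in
  Cramer's rule.\<close>

lemma padic_abs_det_le:
  fixes A :: "'p::prime_card padic^'n^'n"
  assumes "0 \<le> c" "\<And>\<sigma>. \<sigma> permutes UNIV \<Longrightarrow> (\<Prod>i\<in>UNIV. padic_abs (A $ i $ \<sigma> i)) \<le> c"
  shows "padic_abs (det A) \<le> c"
  unfolding det_def
proof (rule padic_abs_sum_le)
  fix \<sigma> :: "'n \<Rightarrow> 'n" assume "\<sigma> \<in> {\<sigma>. \<sigma> permutes UNIV}"
  thus "padic_abs (of_int (sign \<sigma>) * (\<Prod>i\<in>UNIV. A $ i $ \<sigma> i)) \<le> c"
    using assms(2)[of \<sigma>] by (cases \<sigma> rule: sign_cases) (auto simp: padic_abs_mult padic_abs_prod padic_abs_minus)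
qed fact

text \<open>In the application \<open>g j\<close> is the modulus of the characteristic function of \<open>\<xi>\<^sub>j\<close>, and the last
  assumption expresses the independence of the linear forms.\<close>

locale independent_forms_equation =
  fixes \<Lambda> :: "'p::prime_card padic^'n::finite^'n" and g :: "'n \<Rightarrow> 'p padic \<Rightarrow> real"
  assumes det_nonzero: "det \<Lambda> \<noteq> 0"
    and entry_nonzero: "\<And>i j. \<Lambda> $ i $ j \<noteq> 0"
    and two_indices: "\<exists>a b :: 'n. a \<noteq> b"
    and g_0: "\<And>j. g j 0 = 1"
    and g_nonneg: "\<And>j y. 0 \<le> g j y"
    and g_le_1: "\<And>j y. g j y \<le> 1"
    and g_continuous: "\<And>j. continuous_on UNIV (g j)"
    and g_periodic: "\<And>j y h. g j h = 1 \<Longrightarrow> g j (y + h) = g j y"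
    and g_equation: "\<And>u. (\<Prod>j\<in>UNIV. g j (\<Sum>i\<in>UNIV. \<Lambda> $ i $ j * u i))
        = (\<Prod>i\<in>UNIV. \<Prod>j\<in>UNIV. g j (\<Lambda> $ i $ j * u i))"
begin

text \<open>Column j of \<open>W\<close> is the vector dual to column j of \<open>\<Lambda>\<close>:
  with u i = W i j * t the j-th sum in the equation is t and all others are 0. Hence the transposed
  indices.\<close>

definition W :: "'n \<Rightarrow> 'n \<Rightarrow> 'p padic" where "W i j = matrix_inv \<Lambda> $ j $ i"

lemma dual: "(\<Sum>i\<in>UNIV. \<Lambda> $ i $ l * W i j) = (if l = j then 1 else 0)"
proof -
  have "matrix_inv \<Lambda> ** \<Lambda> = mat 1"
    using det_nonzero by (rule matrix_inv_left)
  hence "(matrix_inv \<Lambda> ** \<Lambda>) $ j $ l = (if j = l then 1 else 0)" by (simp add: mat_def)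
  thus ?thesis by (auto simp: matrix_matrix_mult_def W_def mult.commute)
qed

lemma det_dual: "padic_abs (det (\<chi> i j. W i j)) * padic_abs (det \<Lambda>) = 1"
proof -
  have "matrix_inv \<Lambda> ** \<Lambda> = mat 1"
    using det_nonzero by (rule matrix_inv_left)
  hence "det (matrix_inv \<Lambda>) * det \<Lambda> = 1" by (metis det_I det_mul)
  moreover have "(\<chi> i j. W i j) = transpose (matrix_inv \<Lambda>)" by (simp add: W_def transpose_def)
  ultimately show ?thesis by (simp add: det_transpose flip: padic_abs_mult)
qed

lemma g_prod_le_member: "(\<Prod>i\<in>UNIV. \<Prod>j\<in>UNIV. g j (x i j)) \<le> (\<Prod>j\<in>UNIV. g j (x (i :: 'n) j))"
  by (rule prod_le_member) (auto intro: prod_nonneg prod_le_1 g_nonneg g_le_1)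

text \<open>Numbers in [0, 1] have product 1 only if all of them are 1. So membership of the sums in
  the sets where \<open>g\<close> is 1 passes to every single summand.\<close>

lemma g_equation_eq_1:
  assumes "\<And>j. g j (\<Sum>i\<in>UNIV. \<Lambda> $ i $ j * u i) = 1"
  shows "g j (\<Lambda> $ i $ j * u i) = 1"
proof -
  have "(\<Prod>i\<in>UNIV. \<Prod>j\<in>UNIV. g j (\<Lambda> $ i $ j * u i)) = 1"
    unfolding g_equation[symmetric] using assms by simp
  hence "(\<Prod>j\<in>UNIV. g j (\<Lambda> $ i $ j * u i)) = 1"
    using g_prod_le_member[of "\<lambda>i j. \<Lambda> $ i $ j * u i" i] prod_le_1[of UNIV "\<lambda>j. g j (\<Lambda> $ i $ j * u i)"]
      g_nonneg g_le_1 by (simp add: order.antisym)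
  thus ?thesis
    using prod_eq_1_imp_eq_1[of UNIV j "\<lambda>j. g j (\<Lambda> $ i $ j * u i)"] g_nonneg g_le_1 by simp
qed

text \<open>Near 0 put \<open>G j = ln (g j)\<close>. Moving \<open>u\<close> along two different coordinate axes removes the right
  hand side of the equation, and moving it along a dual vector of the columns of \<open>\<Lambda>\<close> isolates one
  \<open>G j\<close>. So \<open>n \<mapsto> G j (n c)\<close> is a bounded quadratic polynomial.\<close>

lemma g_eq_1_near_0: obtains r where "r > 0" "\<And>j y. padic_abs y \<le> r \<Longrightarrow> g j y = 1"
proof -
  have "\<forall>\<^sub>F y in nhds 0. \<forall>j\<in>UNIV. 1 / 2 < g j y"
  proof (intro eventually_ball_finite ballI)
    fix j
    have "(g j \<longlongrightarrow> g j 0) (at 0)"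
      using g_continuous[of j] by (simp add: continuous_on_def)
    hence "(g j \<longlongrightarrow> g j 0) (nhds 0)" by (simp only: tendsto_at_iff_tendsto_nhds)
    hence "(g j \<longlongrightarrow> 1) (nhds 0)" by (simp only: g_0)
    thus "\<forall>\<^sub>F y in nhds 0. 1 / 2 < g j y" by (rule order_tendstoD) simp
  qed simp
  then obtain r where r: "r > 0" "\<And>j y. padic_abs y < r \<Longrightarrow> 1 / 2 < g j y"
    by (auto simp: eventually_nhds_metric dist_padic_def)
  \<comment> \<open>One constant dominates all entries, dual coordinates and inverse entries; the
    leading 1 makes it at least 1. In the radius r / (2 * B * B) one \<open>B\<close> pays for
    forming \<open>u\<close> from \<open>c\<close>, the other for multiplying \<open>u\<close> by
    the entries.\<close>
  define B where "B = 1 + (\<Sum>i\<in>UNIV. \<Sum>j\<in>UNIV. padic_abs (\<Lambda> $ i $ j) + padic_abs (W i j) + padic_abs (1 / \<Lambda> $ i $ j))"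
  have B: "padic_abs (\<Lambda> $ i $ j) + padic_abs (W i j) + padic_abs (1 / \<Lambda> $ i $ j) \<le> B" for i j
  proof -
    have "padic_abs (\<Lambda> $ i $ j) + padic_abs (W i j) + padic_abs (1 / \<Lambda> $ i $ j)
        \<le> (\<Sum>j\<in>UNIV. padic_abs (\<Lambda> $ i $ j) + padic_abs (W i j) + padic_abs (1 / \<Lambda> $ i $ j))"
      by (rule member_le_sum) (auto intro!: add_nonneg_nonneg padic_abs_nonneg)
    also have "\<dots> \<le> (\<Sum>i\<in>UNIV. \<Sum>j\<in>UNIV. padic_abs (\<Lambda> $ i $ j) + padic_abs (W i j) + padic_abs (1 / \<Lambda> $ i $ j))"
      by (rule member_le_sum) (auto intro!: add_nonneg_nonneg sum_nonneg padic_abs_nonneg)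
    finally show ?thesis by (simp add: B_def)
  qed
  have B1: "B \<ge> 1" unfolding B_def by (auto intro!: add_nonneg_nonneg sum_nonneg padic_abs_nonneg)
  have B\<Lambda>: "padic_abs (\<Lambda> $ i $ j) \<le> B" and BW: "padic_abs (W i j) \<le> B"
    and BI: "padic_abs (1 / \<Lambda> $ i $ j) \<le> B" for i j
    using B[of i j] padic_abs_nonneg[of "\<Lambda> $ i $ j"] padic_abs_nonneg[of "W i j"]
      padic_abs_nonneg[of "1 / \<Lambda> $ i $ j"] by linarith+
  define G where "G j y = ln (g j y)" for j y
  have eqG: "(\<Sum>j\<in>UNIV. G j (\<Sum>i\<in>UNIV. \<Lambda> $ i $ j * u i)) = (\<Sum>i\<in>UNIV. \<Sum>j\<in>UNIV. G j (\<Lambda> $ i $ j * u i))"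
    if u: "\<And>i j. padic_abs (\<Lambda> $ i $ j * u i) \<le> r / 2" for u
  proof -
    have small: "0 < g j x" if "padic_abs x \<le> r / 2" for j x
    proof -
      have "padic_abs x < r" using that r(1) by simp
      from r(2)[OF this, of j] show ?thesis by linarith
    qed
    have "padic_abs (\<Sum>i\<in>UNIV. \<Lambda> $ i $ j * u i) \<le> r / 2" for j
      using u r by (intro padic_abs_sum_le) auto
    hence pos0: "0 < g j (\<Sum>i\<in>UNIV. \<Lambda> $ i $ j * u i)" for j
      by (rule small)
    have pos: "0 < g j (\<Lambda> $ i $ j * u i)" for i j
      using u by (rule small)
    have "ln (\<Prod>j\<in>UNIV. g j (\<Sum>i\<in>UNIV. \<Lambda> $ i $ j * u i))
        = (\<Sum>j\<in>UNIV. G j (\<Sum>i\<in>UNIV. \<Lambda> $ i $ j * u i))"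
      unfolding G_def by (intro ln_prod less_imp_neq[OF pos0, symmetric]) auto
    moreover have "ln (\<Prod>i\<in>UNIV. \<Prod>j\<in>UNIV. g j (\<Lambda> $ i $ j * u i))
        = (\<Sum>i\<in>UNIV. ln (\<Prod>j\<in>UNIV. g j (\<Lambda> $ i $ j * u i)))"
      by (intro ln_prod less_imp_neq[OF prod_pos, symmetric] pos) auto
    moreover have "ln (\<Prod>j\<in>UNIV. g j (\<Lambda> $ i $ j * u i)) = (\<Sum>j\<in>UNIV. G j (\<Lambda> $ i $ j * u i))" for i
      unfolding G_def by (intro ln_prod less_imp_neq[OF pos, symmetric]) auto
    ultimately show ?thesis using g_equation[of u] by simp
  qed
  show thesis
  proof (rule that)
    show "0 < r / (2 * B * B)" using r B1 by simp
    fix j and c :: "'p padic"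
    assume c: "padic_abs c \<le> r / (2 * B * B)"
    obtain a b :: 'n where ab: "a \<noteq> b" using two_indices by blast
    have cB: "padic_abs c * B \<le> r / (2 * B)" "padic_abs c \<le> r / (2 * B)"
    proof -
      show 1: "padic_abs c * B \<le> r / (2 * B)" using c B1 by (simp add: field_simps)
      have "padic_abs c * 1 \<le> padic_abs c * B" using B1 padic_abs_nonneg[of c] by (intro mult_left_mono)
      thus "padic_abs c \<le> r / (2 * B)" using 1 by simp
    qed
    \<comment> \<open>\<open>t\<close> moves \<open>u\<close> along the dual vector of column j,
      while \<beta> and \<gamma> switch on steps along the axes a and b. The steps are normalised so
      that each shifts the j-th sum by exactly \<open>c\<close>.\<close>
    define u where "u t \<beta> \<gamma> i = t * W i j + (if i = a then \<beta> * (c / \<Lambda> $ a $ j) else 0)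
      + (if i = b then \<gamma> * (c / \<Lambda> $ b $ j) else 0)" for t \<beta> \<gamma> i
    define A where "A a l = c * \<Lambda> $ a $ l / \<Lambda> $ a $ j" for a l
    have sum_u: "(\<Sum>i\<in>UNIV. \<Lambda> $ i $ l * u t \<beta> \<gamma> i) = (if l = j then t else 0) + \<beta> * A a l + \<gamma> * A b l" for t \<beta> \<gamma> l
    proof -
      have "(\<Sum>i\<in>UNIV. \<Lambda> $ i $ l * u t \<beta> \<gamma> i) = t * (\<Sum>i\<in>UNIV. \<Lambda> $ i $ l * W i j)
         + (\<Sum>i\<in>UNIV. if i = a then \<Lambda> $ a $ l * (\<beta> * (c / \<Lambda> $ a $ j)) else 0)
         + (\<Sum>i\<in>UNIV. if i = b then \<Lambda> $ b $ l * (\<gamma> * (c / \<Lambda> $ b $ j)) else 0)"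
        unfolding sum_distrib_left sum.distrib[symmetric]
        by (intro sum.cong) (auto simp: u_def algebra_simps)
      also have "\<dots> = (if l = j then t else 0) + \<beta> * A a l + \<gamma> * A b l"
        by (simp only: dual) (simp add: A_def mult_ac)
      finally show ?thesis .
    qed
    have bound_u: "padic_abs (\<Lambda> $ i $ l * u t \<beta> \<gamma> i) \<le> r / 2"
      if t: "padic_abs t \<le> padic_abs c" and \<beta>: "padic_abs \<beta> \<le> 1" and \<gamma>: "padic_abs \<gamma> \<le> 1" for i l t \<beta> \<gamma>
    proof -
      have *: "padic_abs (\<beta> * (c / \<Lambda> $ a $ j)) \<le> r / (2 * B)" if "padic_abs \<beta> \<le> 1" for \<beta> a
      proof -
        have "padic_abs (\<beta> * (c / \<Lambda> $ a $ j)) = padic_abs \<beta> * (padic_abs c * padic_abs (1 / \<Lambda> $ a $ j))"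
          by (simp add: padic_abs_mult padic_abs_divide)
        also have "\<dots> \<le> 1 * (padic_abs c * B)"
          using that BI padic_abs_nonneg by (intro mult_mono mult_left_mono mult_nonneg_nonneg) auto
        finally show ?thesis using cB by simp
      qed
      have "padic_abs (t * W i j) \<le> padic_abs c * B"
        unfolding padic_abs_mult using t BW padic_abs_nonneg by (intro mult_mono) auto
      hence "padic_abs (u t \<beta> \<gamma> i) \<le> r / (2 * B)"
        unfolding u_def using *[OF \<beta>] *[OF \<gamma>] cB r B1
        by (intro padic_abs_add_le) auto
      hence "padic_abs (\<Lambda> $ i $ l * u t \<beta> \<gamma> i) \<le> B * (r / (2 * B))"
        unfolding padic_abs_mult using B\<Lambda> padic_abs_nonneg B1 by (intro mult_mono) auto
      thus ?thesis using B1 by simp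
    qed
    \<comment> \<open>The mixed difference in \<beta> and \<gamma> of the l-th term on the left of
      the equation.\<close>
    define K where "K t l = G l ((if l = j then t else 0) + A a l + A b l) - G l ((if l = j then t else 0) + A a l)
      - G l ((if l = j then t else 0) + A b l) + G l (if l = j then t else 0)" for t l
    have K0: "(\<Sum>l\<in>UNIV. K t l) = 0" if t: "padic_abs t \<le> padic_abs c" for t
    proof -
      define P where "P i x = (\<Sum>l\<in>UNIV. G l (\<Lambda> $ i $ l * x))" for i x
      have eq: "(\<Sum>l\<in>UNIV. G l ((if l = j then t else 0) + \<beta> * A a l + \<gamma> * A b l)) = (\<Sum>i\<in>UNIV. P i (u t \<beta> \<gamma> i))"
        if "padic_abs \<beta> \<le> 1" "padic_abs \<gamma> \<le> 1" for \<beta> \<gamma>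
        unfolding P_def using eqG[of "u t \<beta> \<gamma>", OF bound_u[OF t that]] by (simp add: sum_u)
      \<comment> \<open>On the right each term depends on one coordinate of \<open>u\<close> only,
        and as a \<noteq> b no coordinate depends on both \<beta> and \<gamma>.\<close>
      have "P i (u t 1 1 i) - P i (u t 1 0 i) - P i (u t 0 1 i) + P i (u t 0 0 i) = 0" for i
        using ab by (auto simp: u_def)
      hence "(\<Sum>i\<in>UNIV. P i (u t 1 1 i) - P i (u t 1 0 i) - P i (u t 0 1 i) + P i (u t 0 0 i)) = 0"
        by simp
      hence "(\<Sum>i\<in>UNIV. P i (u t 1 1 i)) - (\<Sum>i\<in>UNIV. P i (u t 1 0 i))
          - (\<Sum>i\<in>UNIV. P i (u t 0 1 i)) + (\<Sum>i\<in>UNIV. P i (u t 0 0 i)) = 0"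
        by (simp add: sum.distrib sum_subtractf)
      thus ?thesis
        using eq[of 1 1] eq[of 1 0] eq[of 0 1] eq[of 0 0]
        by (simp add: K_def sum.distrib sum_subtractf)
    qed
    \<comment> \<open>The sum over l is 0 for every \<open>t\<close>, and its terms other than the
      j-th do not involve \<open>t\<close>.\<close>
    have Kj: "K t j = K 0 j" if t: "padic_abs t \<le> padic_abs c" for t
    proof -
      have "K t j + (\<Sum>l\<in>UNIV - {j}. K t l) = K 0 j + (\<Sum>l\<in>UNIV - {j}. K 0 l)"
        using K0[OF t] K0[of 0] padic_abs_nonneg[of c] by (simp flip: sum.remove)
      moreover have "(\<Sum>l\<in>UNIV - {j}. K t l) = (\<Sum>l\<in>UNIV - {j}. K 0 l)"
        by (intro sum.cong) (auto simp: K_def)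
      ultimately show ?thesis by simp
    qed
    have Aj: "A a j = c" for a using entry_nonzero by (simp add: A_def)
    have nc: "padic_abs (of_nat n * c) \<le> padic_abs c" for n
      using padic_abs_of_nat_le_1[of n, where 'p='p] padic_abs_nonneg[of c]
      by (simp add: padic_abs_mult mult_left_le_one_le padic_abs_nonneg)
    \<comment> \<open>For t = n c the mixed difference \<open>K t j\<close> is the second difference
      at n of n \<mapsto> G j (n c), since both steps equal \<open>c\<close>. The sequence is
      bounded because |n c| \<le> |c| for all n.\<close>
    have "G j (of_nat 1 * c) = G j (of_nat 0 * c)"
    proof (rule bounded_second_difference_const_imp_const[where a = "\<lambda>n. G j (of_nat n * c)"])
      show "G j (of_nat (n + 2) * c) - 2 * G j (of_nat (n + 1) * c) + G j (of_nat n * c) = K 0 j" for n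
      proof -
        have "of_nat n * c + c = of_nat (n + 1) * c" "of_nat n * c + c + c = of_nat (n + 2) * c"
          by (simp_all add: distrib_right)
        thus ?thesis using Kj[OF nc, of n] by (simp only: K_def Aj) simp
      qed
      show "\<bar>G j (of_nat n * c)\<bar> \<le> ln 2" for n
      proof -
        have "padic_abs c < r"
        proof -
          have "r / (2 * B) < r" using r B1 by (simp add: field_simps)
          thus ?thesis using cB by linarith
        qed
        hence g2: "1 / 2 < g j (of_nat n * c)" using nc[of n] r by force
        hence "ln (1 / 2) \<le> G j (of_nat n * c)" unfolding G_def by (subst ln_le_cancel_iff) auto
        moreover have "G j (of_nat n * c) \<le> 0"
          unfolding G_def using g2 g_le_1 by (subst ln_le_zero_iff) auto
        ultimately show ?thesis by (simp add: ln_div)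
      qed
    qed
    hence "ln (g j c) = 0" by (simp add: G_def g_0)
    moreover have "1 / 2 < g j c"
    proof (rule r(2))
      have "r / (2 * B) < r" using r B1 by (simp add: field_simps)
      thus "padic_abs c < r" using cB by linarith
    qed
    ultimately show "g j c = 1" by simp
  qed
qed

section \<open>The sets where \<open>g j\<close> equals 1\<close>

lemma g_add_eq_1: "g j x = 1 \<Longrightarrow> g j y = 1 \<Longrightarrow> g j (x + y) = 1"
  using g_periodic by simp

text \<open>The set where \<open>g j\<close> is 1 is closed under addition and contains a ball
  around 0. Since natural numbers are dense in the integers of the field, z = (z / y) y differs from
  some multiple m y by an element of that ball.\<close>

lemma g_eq_1_downward:
  assumes y: "g j y = 1" and z: "padic_abs z \<le> padic_abs y"
  shows "g j z = 1"
proof (cases "y = 0")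
  case True
  thus ?thesis using z padic_abs_nonneg[of z] by (simp add: padic_abs_eq_0_iff g_0)
next
  case False
  obtain r where r: "r > 0" "\<And>j y. padic_abs y \<le> r \<Longrightarrow> g j y = 1" by (rule g_eq_1_near_0) blast
  have y0: "0 < padic_abs y" using False by (rule padic_abs_pos)
  obtain n where n: "(1 / real CARD('p)) ^ n < r / padic_abs y"
    using inverse_prime_power_less[of "r / padic_abs y", where 'p='p] r y0 by auto
  have "padic_abs (z / y) \<le> 1" using z y0 by (simp add: padic_abs_divide)
  then obtain m where m: "padic_abs (z / y - of_nat m) \<le> (1 / real CARD('p)) ^ n"
    using padic_dense_int by metis
  have "padic_abs ((z / y - of_nat m) * y) \<le> r"
  proof -
    have "padic_abs ((z / y - of_nat m) * y) \<le> (1 / real CARD('p)) ^ n * padic_abs y"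
      unfolding padic_abs_mult using m y0 by (intro mult_right_mono) auto
    also have "\<dots> \<le> r" using n y0 by (simp add: pos_less_divide_eq)
    finally show ?thesis .
  qed
  hence "g j ((z / y - of_nat m) * y) = 1" by (rule r)
  moreover have "g j (of_nat m * y) = 1"
    by (induction m) (auto simp: g_0 distrib_right intro: g_add_eq_1 y)
  ultimately have "g j ((z / y - of_nat m) * y + of_nat m * y) = 1" by (rule g_add_eq_1)
  thus ?thesis using False by (simp add: left_diff_distrib)
qed

text \<open>Multiplying \<open>w\<close> by powers of p leads into the ball of
  \<open>g_eq_1_near_0\<close>; the first power that reaches the set gives the radius. Absolute
  values jump by factors of p, so an element larger than \<open>s\<close> is at least as large as
  the product with the previous power, which lies outside.\<close>

lemma g_eq_1_iff_ball:
  assumes "g j w \<noteq> 1"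
  obtains s :: "'p padic" where "s \<noteq> 0" "\<And>y. g j y = 1 \<longleftrightarrow> padic_abs y \<le> padic_abs s"
proof -
  obtain r where r: "r > 0" "\<And>j y. padic_abs y \<le> r \<Longrightarrow> g j y = 1" by (rule g_eq_1_near_0) blast
  have w0: "w \<noteq> 0" using assms g_0 by auto
  hence w1: "0 < padic_abs w" by (rule padic_abs_pos)
  obtain n where n: "(1 / real CARD('p)) ^ n < r / padic_abs w"
    using inverse_prime_power_less[of "r / padic_abs w", where 'p='p] r w1 by auto
  hence "padic_abs (w * uniformizer ^ n) \<le> r"
    using w1 by (simp add: padic_abs_mult padic_abs_uniformizer_power pos_less_divide_eq mult.commute)
  hence ex: "\<exists>n. g j (w * uniformizer ^ n) = 1" using r by blast
  define N where "N = (LEAST n. g j (w * uniformizer ^ n) = 1)"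
  have N: "g j (w * uniformizer ^ N) = 1" unfolding N_def using ex by (rule LeastI_ex)
  then obtain M where M: "N = Suc M" using assms by (cases N) auto
  have gM: "g j (w * uniformizer ^ M) \<noteq> 1"
    using M not_less_Least[of M "\<lambda>n. g j (w * uniformizer ^ n) = 1"] unfolding N_def by simp
  show thesis
  proof (rule that)
    let ?s = "w * uniformizer ^ N"
    show s0: "?s \<noteq> 0" using w0 by simp
    fix y
    show "g j y = 1 \<longleftrightarrow> padic_abs y \<le> padic_abs ?s"
    proof
      assume y: "g j y = 1"
      show "padic_abs y \<le> padic_abs ?s"
      proof (rule ccontr)
        assume "\<not> padic_abs y \<le> padic_abs ?s"
        hence "1 < padic_abs (y / ?s)" using padic_abs_pos[OF s0] by (simp add: padic_abs_divide)
        hence "real CARD('p) \<le> padic_abs (y / ?s)" by (rule padic_abs_gt_1D)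
        hence "real CARD('p) * padic_abs ?s \<le> padic_abs y"
          using padic_abs_pos[OF s0] by (simp add: padic_abs_divide pos_le_divide_eq)
        hence "padic_abs (w * uniformizer ^ M) \<le> padic_abs y"
          using M prime_card_gt_1[where 'p='p] by (simp add: padic_abs_mult padic_abs_uniformizer)
        thus False using g_eq_1_downward[OF y] gM by blast
      qed
    qed (rule g_eq_1_downward[OF N])
  qed
qed

text \<open>Along the dual vector of column j all sums but the j-th vanish, and \<open>g j\<close>
  is 1 everywhere, so every summand has value 1. An index i with a nonzero dual coordinate makes the
  l-th summand run through the whole field.\<close>

lemma g_all_1:
  assumes "\<And>y. g j y = 1"
  shows "g l y = 1"
proof -
  have "(\<Sum>i\<in>UNIV. \<Lambda> $ i $ j * W i j) \<noteq> 0" by (simp add: dual)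
  then obtain i where "\<Lambda> $ i $ j * W i j \<noteq> 0" using sum.not_neutral_contains_not_neutral by blast
  hence nz: "\<Lambda> $ i $ l * W i j \<noteq> 0" using entry_nonzero by simp
  define t where "t = y / (\<Lambda> $ i $ l * W i j)"
  have "(\<Sum>i\<in>UNIV. \<Lambda> $ i $ m * (W i j * t)) = (if m = j then t else 0)" for m
    using dual[of m j] by (simp add: sum_distrib_right[symmetric] flip: mult.assoc)
  hence "g l (\<Lambda> $ i $ l * (W i j * t)) = 1"
    using assms by (intro g_equation_eq_1) (auto simp: g_0)
  thus ?thesis using nz by (simp add: t_def)
qed

section \<open>Comparison of the two lattices\<close>

context
  fixes s :: "'n \<Rightarrow> 'p padic"
  assumes s_nonzero: "\<And>j. s j \<noteq> 0"
    and g_eq_1_iff: "\<And>j y. g j y = 1 \<longleftrightarrow> padic_abs y \<le> padic_abs (s j)"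
begin

text \<open>The radius of the ball of all x such that, for every j,
  \<open>\<Lambda> $ i $ j * x\<close> lies in the set where \<open>g j\<close> is 1.\<close>

definition R :: "'n \<Rightarrow> real" where
  "R i = Min (range (\<lambda>j. padic_abs (s j) / padic_abs (\<Lambda> $ i $ j)))"

lemma R_le: "R i \<le> padic_abs (s j) / padic_abs (\<Lambda> $ i $ j)"
  unfolding R_def by (rule Min_le) auto

lemma R_pos: "0 < R i"
  unfolding R_def by (subst Min_gr_iff) (auto intro!: divide_pos_pos padic_abs_pos s_nonzero entry_nonzero)

text \<open>The dual vector of column j scaled by \<open>s j\<close> has its only nonzero sum equal
  to \<open>s j\<close>, where \<open>g j\<close> is still 1; so its coordinates lie in the balls of
  radius \<open>R i\<close>.\<close>

lemma W_le: "padic_abs (W i j) * padic_abs (s j) \<le> R i"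
  unfolding R_def
proof (rule Min.boundedI)
  fix x assume "x \<in> range (\<lambda>j. padic_abs (s j) / padic_abs (\<Lambda> $ i $ j))"
  then obtain l where x: "x = padic_abs (s l) / padic_abs (\<Lambda> $ i $ l)" by blast
  have "(\<Sum>i\<in>UNIV. \<Lambda> $ i $ m * (W i j * s j)) = (if m = j then s j else 0)" for m
    using dual[of m j] by (simp add: sum_distrib_right[symmetric] flip: mult.assoc)
  hence "g l (\<Lambda> $ i $ l * (W i j * s j)) = 1"
    by (intro g_equation_eq_1) (auto simp: g_0 g_eq_1_iff padic_abs_nonneg)
  thus "padic_abs (W i j) * padic_abs (s j) \<le> x"
    unfolding x g_eq_1_iff using padic_abs_pos[OF entry_nonzero, of i l]
    by (simp add: padic_abs_mult field_simps)
qed auto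

text \<open>Each Leibniz term of the dual determinant is at most the product of the quotients R i /
  |s (\<sigma> i)|, which is the same for all \<sigma>; \<open>det_dual\<close> turns this into a
  bound involving det \<Lambda>.\<close>

lemma prod_R_ge: "(\<Prod>j\<in>UNIV. padic_abs (s j)) \<le> padic_abs (det \<Lambda>) * prod R UNIV"
proof -
  let ?\<rho> = "\<Prod>j\<in>UNIV. padic_abs (s j)"
  have \<rho>: "0 < ?\<rho>" by (intro prod_pos padic_abs_pos) (auto simp: s_nonzero)
  have "padic_abs (det (\<chi> i j. W i j)) \<le> prod R UNIV / ?\<rho>"
  proof (rule padic_abs_det_le)
    show "0 \<le> prod R UNIV / ?\<rho>" using \<rho> R_pos by (intro divide_nonneg_nonneg prod_nonneg less_imp_le[OF \<rho>]) (auto intro: less_imp_le)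
    fix \<sigma> :: "'n \<Rightarrow> 'n" assume \<sigma>: "\<sigma> permutes UNIV"
    have "(\<Prod>i\<in>UNIV. padic_abs (W i (\<sigma> i))) \<le> (\<Prod>i\<in>UNIV. R i / padic_abs (s (\<sigma> i)))"
      using W_le padic_abs_pos[OF s_nonzero] padic_abs_nonneg by (intro prod_mono) (auto simp: pos_le_divide_eq)
    also have "\<dots> = prod R UNIV / (\<Prod>i\<in>UNIV. padic_abs (s (\<sigma> i)))" by (simp add: prod_dividef)
    also have "(\<Prod>i\<in>UNIV. padic_abs (s (\<sigma> i))) = ?\<rho>"
      using prod.permute[OF \<sigma>, of "\<lambda>j. padic_abs (s j)"] by (simp add: comp_def)
    finally show "(\<Prod>i\<in>UNIV. padic_abs ((\<chi> i j. W i j) $ i $ \<sigma> i)) \<le> prod R UNIV / ?\<rho>" by simp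
  qed
  hence "padic_abs (det (\<chi> i j. W i j)) * padic_abs (det \<Lambda>) \<le> prod R UNIV / ?\<rho> * padic_abs (det \<Lambda>)"
    by (rule mult_right_mono) (rule padic_abs_nonneg)
  thus ?thesis unfolding det_dual using \<rho> by (simp add: field_simps)
qed

lemma prod_R_le:
  assumes \<tau>: "\<tau> permutes UNIV"
  shows "prod R UNIV * (\<Prod>i\<in>UNIV. padic_abs (\<Lambda> $ i $ \<tau> i)) \<le> (\<Prod>j\<in>UNIV. padic_abs (s j))"
proof -
  have "prod R UNIV * (\<Prod>i\<in>UNIV. padic_abs (\<Lambda> $ i $ \<tau> i)) = (\<Prod>i\<in>UNIV. R i * padic_abs (\<Lambda> $ i $ \<tau> i))"
    by (simp add: prod.distrib)
  also have "\<dots> \<le> (\<Prod>i\<in>UNIV. padic_abs (s (\<tau> i)))"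
  proof (intro prod_mono conjI)
    fix i show "R i * padic_abs (\<Lambda> $ i $ \<tau> i) \<le> padic_abs (s (\<tau> i))"
      using R_le[of i "\<tau> i"] padic_abs_pos[OF entry_nonzero, of i "\<tau> i"] by (simp add: pos_le_divide_eq)
    show "0 \<le> R i * padic_abs (\<Lambda> $ i $ \<tau> i)"
      using R_pos[of i] by (intro mult_nonneg_nonneg padic_abs_nonneg) simp
  qed
  also have "\<dots> = (\<Prod>j\<in>UNIV. padic_abs (s j))"
    using prod.permute[OF \<tau>, of "\<lambda>j. padic_abs (s j)"] by (simp add: comp_def)
  finally show ?thesis .
qed

text \<open>The product of the \<open>R i\<close> is squeezed between its lower bound from the
  determinant and its upper bound from \<tau>, and cancels.\<close>

lemma prod_entries_le_det:
  assumes \<tau>: "\<tau> permutes UNIV"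
  shows "(\<Prod>i\<in>UNIV. padic_abs (\<Lambda> $ i $ \<tau> i)) \<le> padic_abs (det \<Lambda>)"
proof -
  have "0 < prod R UNIV" by (intro prod_pos) (auto simp: R_pos)
  moreover have "prod R UNIV * (\<Prod>i\<in>UNIV. padic_abs (\<Lambda> $ i $ \<tau> i)) \<le> prod R UNIV * padic_abs (det \<Lambda>)"
    using prod_R_le[OF \<tau>] prod_R_ge by (simp add: mult.commute)
  ultimately show ?thesis by simp
qed

text \<open>Equality in the squeeze makes a product of numbers at most 1 equal to 1, so each
  estimate of \<open>R i\<close> along \<tau> is sharp.\<close>

lemma R_eq:
  assumes \<tau>: "\<tau> permutes UNIV" and eq: "(\<Prod>i\<in>UNIV. padic_abs (\<Lambda> $ i $ \<tau> i)) = padic_abs (det \<Lambda>)"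
  shows "R i * padic_abs (\<Lambda> $ i $ \<tau> i) = padic_abs (s (\<tau> i))"
proof -
  let ?f = "\<lambda>i. R i * padic_abs (\<Lambda> $ i $ \<tau> i) / padic_abs (s (\<tau> i))"
  have sp: "0 < padic_abs (s j)" for j by (rule padic_abs_pos[OF s_nonzero])
  have \<rho>: "(\<Prod>i\<in>UNIV. padic_abs (s (\<tau> i))) = (\<Prod>j\<in>UNIV. padic_abs (s j))"
    using prod.permute[OF \<tau>, of "\<lambda>j. padic_abs (s j)"] by (simp add: comp_def)
  have "prod R UNIV * (\<Prod>i\<in>UNIV. padic_abs (\<Lambda> $ i $ \<tau> i)) = (\<Prod>j\<in>UNIV. padic_abs (s j))"
    using prod_R_le[OF \<tau>] prod_R_ge eq by (simp add: mult.commute order.antisym)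
  hence "prod ?f UNIV = 1"
    using sp by (simp add: prod_dividef prod.distrib \<rho> less_imp_neq[symmetric])
  moreover have "?f i \<le> 1" "0 \<le> ?f i" for i
    using R_le[of i "\<tau> i"] padic_abs_pos[OF entry_nonzero, of i "\<tau> i"] R_pos[of i] sp[of "\<tau> i"]
    by (auto simp: pos_le_divide_eq)
  ultimately have "?f i = 1" by (intro prod_eq_1_imp_eq_1[of UNIV i ?f]) auto
  moreover have "padic_abs (s (\<tau> i)) \<noteq> 0" using sp[of "\<tau> i"] by simp
  ultimately show ?thesis by (simp add: right_inverse_eq del: divide_eq_1_iff mult_eq_0_iff)
qed

text \<open>By the equation, the maximum \<open>S < 1\<close> of the \<open>g l\<close> over the spheres of radius proportional
  to the radius of \<open>{y. g l y = 1}\<close> satisfies \<open>S \<le> S\<^sup>2\<close>.\<close>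

lemma g_eq_0:
  assumes \<tau>: "\<tau> permutes UNIV" "(\<Prod>i\<in>UNIV. padic_abs (\<Lambda> $ i $ \<tau> i)) = padic_abs (det \<Lambda>)"
    and \<tau>': "\<tau>' permutes UNIV" "(\<Prod>i\<in>UNIV. padic_abs (\<Lambda> $ i $ \<tau>' i)) = padic_abs (det \<Lambda>)"
    and disj: "\<And>i. \<tau> i \<noteq> \<tau>' i"
    and y: "padic_abs (s j) < padic_abs y"
  shows "g j y = 0"
proof -
  have sp: "0 < padic_abs (s j)" for j by (rule padic_abs_pos[OF s_nonzero])
  \<comment> \<open>All spheres are dilated by the same factor, that of \<open>y\<close> relative to
    \<open>s j\<close>, so that \<open>R_eq\<close> matches them with one another.\<close>
  define q where "q = padic_abs y / padic_abs (s j)"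
  have q1: "1 < q" using y sp[of j] by (simp add: q_def)
  define D where "D l = {b :: 'p padic. padic_abs b = q * padic_abs (s l)}" for l
  have "\<exists>b\<in>D l. \<forall>b'\<in>D l. g l b' \<le> g l b" for l
  proof (rule continuous_attains_sup)
    have "D l = {b. padic_abs b \<le> q * padic_abs (s l)} \<inter> {b. padic_abs b = q * padic_abs (s l)}"
      by (auto simp: D_def)
    also have "compact \<dots>"
      by (intro compact_Int_closed compact_padic_ball closed_Collect_eq continuous_on_padic_abs continuous_intros)
    finally show "compact (D l)" .
    have "y * s l / s j \<in> D l" by (simp add: D_def q_def padic_abs_mult padic_abs_divide)
    thus "D l \<noteq> {}" by blast
    show "continuous_on (D l) (g l)" using g_continuous by (rule continuous_on_subset) simp
  qed
  then obtain b where b: "\<And>l. b l \<in> D l" "\<And>l b'. b' \<in> D l \<Longrightarrow> g l b' \<le> g l (b l)" by metis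
  obtain l where l: "\<And>l'. g l' (b l') \<le> g l (b l)"
  proof -
    have "Max (range (\<lambda>l. g l (b l))) \<in> range (\<lambda>l. g l (b l))" by (rule Max_in) auto
    then obtain l where "g l (b l) = Max (range (\<lambda>l. g l (b l)))" by force
    thus thesis using that by (metis Max_ge finite finite_imageI rangeI)
  qed
  let ?S = "g l (b l)"
  have max: "g l' b' \<le> ?S" if "b' \<in> D l'" for l' b' using b(2)[OF that] l[of l'] by linarith
  have "padic_abs (s l) < padic_abs (b l)" using b(1)[of l] q1 sp[of l] by (simp add: D_def)
  hence S1: "?S < 1" using g_eq_1_iff[of l "b l"] g_le_1[of l "b l"] by linarith
  \<comment> \<open>The terms sum to 1, so one of them has absolute value at least 1. For this row
    the bounds \<open>W_le\<close> and \<open>R_le\<close> are both attained.\<close>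
  have "\<exists>i. 1 \<le> padic_abs (\<Lambda> $ i $ l * W i l)"
  proof (rule ccontr)
    assume "\<nexists>i. 1 \<le> padic_abs (\<Lambda> $ i $ l * W i l)"
    hence "padic_abs (\<Sum>i\<in>UNIV. \<Lambda> $ i $ l * W i l) < 1" by (intro padic_abs_sum_less) (auto simp: not_le)
    thus False by (simp add: dual)
  qed
  then obtain i where "1 \<le> padic_abs (\<Lambda> $ i $ l) * padic_abs (W i l)" by (auto simp: padic_abs_mult)
  hence "padic_abs (s l) / padic_abs (\<Lambda> $ i $ l) \<le> padic_abs (W i l) * padic_abs (s l)"
    using padic_abs_pos[OF entry_nonzero, of i l] sp[of l]
    by (simp add: pos_divide_le_eq mult.commute mult.left_commute)
  hence Wi: "padic_abs (W i l) * padic_abs (s l) = R i" using W_le[of i l] R_le[of i l] by linarith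
  \<comment> \<open>In that row the sharp estimates put the arguments at the columns \<tau> i and
    \<tau>' i exactly on their spheres.\<close>
  have sphere: "\<Lambda> $ i $ \<tau> i * (W i l * b l) \<in> D (\<tau> i)"
    if "\<tau> permutes UNIV" "(\<Prod>i\<in>UNIV. padic_abs (\<Lambda> $ i $ \<tau> i)) = padic_abs (det \<Lambda>)" for \<tau>
  proof -
    have "padic_abs (\<Lambda> $ i $ \<tau> i * (W i l * b l)) = q * (R i * padic_abs (\<Lambda> $ i $ \<tau> i))"
      using b(1)[of l] by (simp add: D_def padic_abs_mult flip: Wi)
    thus ?thesis using R_eq[OF that] by (simp add: D_def)
  qed
  have "(\<Sum>i\<in>UNIV. \<Lambda> $ i $ m * (W i l * b l)) = (if m = l then b l else 0)" for m
    using dual[of m l] by (simp add: sum_distrib_right[symmetric] flip: mult.assoc)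
  \<comment> \<open>On the left only the l-th sum is nonzero, and it is the point where the maximum
    is attained.\<close>
  hence "(\<Prod>m\<in>UNIV. g m (\<Sum>i\<in>UNIV. \<Lambda> $ i $ m * (W i l * b l))) = (\<Prod>m\<in>UNIV. if m = l then ?S else 1)"
    by (intro prod.cong) (auto simp: g_0)
  also have "\<dots> = ?S" by simp
  finally have "?S = (\<Prod>i\<in>UNIV. \<Prod>m\<in>UNIV. g m (\<Lambda> $ i $ m * (W i l * b l)))"
    by (simp add: g_equation)
  also have "\<dots> \<le> (\<Prod>m\<in>UNIV. g m (\<Lambda> $ i $ m * (W i l * b l)))" by (rule g_prod_le_member)
  also have "\<dots> \<le> g (\<tau> i) (\<Lambda> $ i $ \<tau> i * (W i l * b l)) * g (\<tau>' i) (\<Lambda> $ i $ \<tau>' i * (W i l * b l))"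
    by (rule prod_le_two_members) (auto simp: disj g_nonneg g_le_1)
  also have "\<dots> \<le> ?S * ?S"
    using sphere[OF \<tau>] sphere[OF \<tau>'] by (intro mult_mono max g_nonneg)
  finally have "?S * (1 - ?S) \<le> 0" by (simp add: algebra_simps)
  hence "?S \<le> 0" using S1 by (simp add: mult_le_0_iff)
  moreover have "y \<in> D j" using sp[of j] by (simp add: D_def q_def)
  ultimately show ?thesis using max[of y j] g_nonneg[of j y] by linarith
qed

end

theorem g_degenerate:
  assumes "\<tau> permutes UNIV" "padic_abs (det \<Lambda>) < (\<Prod>i\<in>UNIV. padic_abs (\<Lambda> $ i $ \<tau> i))"
  shows "g j y = 1"
proof (rule ccontr)
  assume "g j y \<noteq> 1"
  hence "\<forall>l. \<exists>w. g l w \<noteq> 1" using g_all_1 by blast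
  hence "\<forall>l. \<exists>s :: 'p padic. s \<noteq> 0 \<and> (\<forall>y. g l y = 1 \<longleftrightarrow> padic_abs y \<le> padic_abs s)"
    using g_eq_1_iff_ball by metis
  then obtain s :: "'n \<Rightarrow> 'p padic" where s: "\<And>l. s l \<noteq> 0" "\<And>l y. g l y = 1 \<longleftrightarrow> padic_abs y \<le> padic_abs (s l)" by metis
  from prod_entries_le_det[OF s assms(1)] show False using assms(2) by simp
qed

theorem g_idempotent:
  assumes "\<tau> permutes UNIV" "(\<Prod>i\<in>UNIV. padic_abs (\<Lambda> $ i $ \<tau> i)) = padic_abs (det \<Lambda>)"
    and "\<tau>' permutes UNIV" "(\<Prod>i\<in>UNIV. padic_abs (\<Lambda> $ i $ \<tau>' i)) = padic_abs (det \<Lambda>)"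
    and "\<And>i. \<tau> i \<noteq> \<tau>' i" and "g j w \<noteq> 1"
  obtains s :: "'p padic" where "s \<noteq> 0" "\<And>y. g j y = (if padic_abs y \<le> padic_abs s then 1 else 0)"
proof -
  have "\<forall>l. \<exists>w. g l w \<noteq> 1" using g_all_1 assms(6) by blast
  hence "\<forall>l. \<exists>s :: 'p padic. s \<noteq> 0 \<and> (\<forall>y. g l y = 1 \<longleftrightarrow> padic_abs y \<le> padic_abs s)"
    using g_eq_1_iff_ball by metis
  then obtain s :: "'n \<Rightarrow> 'p padic" where s: "\<And>l. s l \<noteq> 0" "\<And>l y. g l y = 1 \<longleftrightarrow> padic_abs y \<le> padic_abs (s l)" by metis
  have "g j y = (if padic_abs y \<le> padic_abs (s j) then 1 else 0)" for y
    using s(2)[of j y] g_eq_0[OF s assms(1-5), of j y] by auto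
  with s(1)[of j] show thesis by (rule that)
qed

end


subsection \<open>Characteristic functions of degenerate and idempotent distributions\<close>

lemma (in prob_space) AE_witness:
  assumes "AE x in M. P x"
  shows "\<exists>x. P x"
proof (rule ccontr)
  assume "\<nexists>x. P x"
  hence "AE x in M. False" using assms by simp
  thus False by simp
qed

lemma (in prob_space) padic_charf_0: "padic_charf M X 0 = 1"
  by (simp add: padic_charf_def prob_space)

lemma (in prob_space) norm_padic_charf_le_1:
  "norm (padic_charf M X y) \<le> 1"
proof -
  have "norm (padic_charf M X y) \<le> (LINT \<omega>|M. norm (padic_char (y * X \<omega>)))"
    unfolding padic_charf_def by (rule integral_norm_bound)
  thus ?thesis by (simp add: prob_space)
qed

lemma (in prob_space) continuous_padic_charf:
  assumes X [measurable]: "random_variable borel X"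
  shows "continuous_on UNIV (padic_charf M (X :: 'a \<Rightarrow> 'p::prime_card padic))"
  unfolding continuous_on_sequentially
proof (intro allI ballI impI)
  fix y :: "nat \<Rightarrow> 'p padic" and z assume "(\<forall>n. y n \<in> UNIV) \<and> y \<longlonglongrightarrow> z"
  hence y: "y \<longlonglongrightarrow> z" ..
  show "(padic_charf M X \<circ> y) \<longlonglongrightarrow> padic_charf M X z"
    unfolding padic_charf_def comp_def
  proof (rule integral_dominated_convergence[where w = "\<lambda>_. 1"])
    show "AE \<omega> in M. (\<lambda>n. padic_char (y n * X \<omega>)) \<longlonglongrightarrow> padic_char (z * X \<omega>)"
    proof (rule AE_I2)
      fix \<omega>
      have "continuous_on UNIV (\<lambda>t. padic_char (X \<omega> * t))"
        by (intro continuous_on_compose2[OF continuous_on_padic_char[of UNIV]] continuous_intros) auto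
      from continuous_on_tendsto_compose[OF this y]
      show "(\<lambda>n. padic_char (y n * X \<omega>)) \<longlonglongrightarrow> padic_char (z * X \<omega>)" by (simp add: mult.commute)
    qed
  qed auto
qed

text \<open>Equality in |E Z| \<le> E |Z|: after rotation by the conjugate of the mean, Z has
  modulus 1 and its real part has mean 1, so the real part is almost surely 1.\<close>

lemma (in prob_space) AE_padic_char_eq:
  assumes X [measurable]: "random_variable borel (X :: 'a \<Rightarrow> 'p::prime_card padic)"
    and 1: "norm (padic_charf M X y) = 1"
  shows "AE \<omega> in M. padic_char (y * X \<omega>) = padic_charf M X y"
proof -
  define c where "c = padic_charf M X y"
  have cc: "c * cnj c = 1" using complex_norm_square[of c] 1 by (simp add: c_def)
  define Z where "Z \<omega> = cnj c * padic_char (y * X \<omega>)" for \<omega>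
  have Z1: "norm (Z \<omega>) = 1" for \<omega> using 1 by (simp add: Z_def c_def norm_mult)
  have intZ: "integrable M Z" unfolding Z_def
    by (intro integrable_mult_right integrable_padic_char) measurable
  have "(LINT \<omega>|M. Z \<omega>) = cnj c * c"
    unfolding Z_def c_def padic_charf_def by simp
  also have "\<dots> = 1" using cc by (simp add: mult.commute)
  finally have "(LINT \<omega>|M. Re (Z \<omega>)) = 1" using intZ by (simp add: integral_Re)
  hence "(LINT \<omega>|M. 1 - Re (Z \<omega>)) = 0" using intZ by (simp add: prob_space)
  moreover have Re_le: "Re (Z \<omega>) \<le> 1" for \<omega> using complex_Re_le_cmod[of "Z \<omega>"] Z1 by simp
  ultimately have "AE \<omega> in M. 1 - Re (Z \<omega>) = 0"
    using intZ by (subst (asm) integral_nonneg_eq_0_iff_AE) auto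
  thus ?thesis
  proof eventually_elim
    case (elim \<omega>)
    have "(Re (Z \<omega>))\<^sup>2 + (Im (Z \<omega>))\<^sup>2 = 1" using Z1[of \<omega>] by (simp add: cmod_power2[symmetric])
    hence "Z \<omega> = 1" using elim by (simp add: complex_eq_iff)
    hence "c * cnj c * padic_char (y * X \<omega>) = c" by (simp add: Z_def)
    thus ?case unfolding cc by (simp add: c_def)
  qed
qed

lemma (in prob_space) padic_charf_add:
  assumes X [measurable]: "random_variable borel (X :: 'a \<Rightarrow> 'p::prime_card padic)"
    and 1: "norm (padic_charf M X h) = 1"
  shows "padic_charf M X (y + h) = padic_charf M X y * padic_charf M X h"
proof -
  have "padic_charf M X (y + h) = (LINT \<omega>|M. padic_char (y * X \<omega>) * padic_charf M X h)"
    unfolding padic_charf_def[of M X "y + h"]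
    using AE_padic_char_eq[OF X 1]
    by (intro integral_cong_AE) (auto simp: distrib_right padic_char_add)
  thus ?thesis by (simp add: padic_charf_def)
qed

text \<open>The countably many frequencies p^(-m) can be treated on one event of probability 1.
  There \<open>X\<close> agrees with a fixed value \<open>X \<omega>0\<close> modulo every power of
  p.\<close>

lemma (in prob_space) degenerate_if_norm_charf_eq_1:
  assumes X [measurable]: "random_variable borel (X :: 'a \<Rightarrow> 'p::prime_card padic)"
    and 1: "\<And>y. norm (padic_charf M X y) = 1"
  shows "distr M borel X \<in> degenerate_distributions"
proof -
  let ?y = "\<lambda>m. 1 / uniformizer ^ m :: 'p padic"
  have AE: "AE \<omega> in M. \<forall>m. padic_char (?y m * X \<omega>) = padic_charf M X (?y m)"
    using AE_padic_char_eq[OF X 1] by (subst AE_all_countable) blast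
  obtain \<omega>0 where \<omega>0: "\<And>m. padic_char (?y m * X \<omega>0) = padic_charf M X (?y m)"
    using AE_witness[OF AE] by blast
  have "AE \<omega> in M. X \<omega> = X \<omega>0"
    using AE
  proof eventually_elim
    case (elim \<omega>)
    have le: "padic_abs (X \<omega> - X \<omega>0) \<le> (1 / real CARD('p)) ^ m" for m
    proof -
      have "padic_char (?y m * X \<omega> - ?y m * X \<omega>0) = 1"
        unfolding padic_char_diff elim[rule_format, of m] \<omega>0[of m, symmetric] by simp
      hence "padic_abs (?y m * (X \<omega> - X \<omega>0)) \<le> 1"
        by (simp add: padic_char_eq_1_iff right_diff_distrib)
      thus ?thesis
        using prime_card_gt_1[where 'p='p]
        by (simp add: padic_abs_divide padic_abs_uniformizer_power pos_divide_le_eq)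
    qed
    have "padic_abs (X \<omega> - X \<omega>0) \<le> 0"
    proof (rule ccontr)
      assume "\<not> padic_abs (X \<omega> - X \<omega>0) \<le> 0"
      hence "0 < padic_abs (X \<omega> - X \<omega>0)" by simp
      then obtain m where "(1 / real CARD('p)) ^ m < padic_abs (X \<omega> - X \<omega>0)"
        by (rule inverse_prime_power_less)
      thus False using le[of m] by simp
    qed
    thus ?case using padic_abs_nonneg[of "X \<omega> - X \<omega>0"] padic_abs_eq_0_iff[of "X \<omega> - X \<omega>0"] by simp
  qed
  hence "distr M borel X = distr M borel (\<lambda>_. X \<omega>0)" by (intro distr_cong_AE) auto
  also have "\<dots> = return borel (X \<omega>0)" by (rule distr_const) simp
  finally show ?thesis unfolding degenerate_distributions_def by simp
qed

lemma padic_charf_distr: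
  assumes [measurable]: "X \<in> measurable M borel"
  shows "padic_charf (distr M borel X) (\<lambda>x. x) y = padic_charf M (X :: _ \<Rightarrow> 'p::prime_card padic) y"
  unfolding padic_charf_def by (rule integral_distr) auto

lemma borel_measurable_padic_add_const [measurable]:
  "(\<lambda>y. (c :: 'p::prime_card padic) + y) \<in> borel_measurable borel"
  by (intro borel_measurable_continuous_onI continuous_intros)

text \<open>\<open>K\<close> is the annihilator of the ball of radius |s|. At frequency
  \<open>s\<close> the character is almost surely constant, which puts X - X \<omega>0 in
  \<open>K\<close>. Translation by an element of \<open>K\<close> preserves the characteristic
  function: on the ball the extra factor is 1, outside it the function is 0.\<close>

lemma (in prob_space) idempotent_if_norm_charf_indicator:
  assumes X [measurable]: "random_variable borel (X :: 'a \<Rightarrow> 'p::prime_card padic)"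
    and s: "(s :: 'p padic) \<noteq> 0" "\<And>y. norm (padic_charf M X y) = (if padic_abs y \<le> padic_abs s then 1 else 0)"
  shows "distr M borel X \<in> idempotent_distributions"
proof -
  have AE: "AE \<omega> in M. padic_char (s * X \<omega>) = padic_charf M X s"
    using s by (intro AE_padic_char_eq) auto
  obtain \<omega>0 where \<omega>0: "padic_char (s * X \<omega>0) = padic_charf M X s"
    using AE_witness[OF AE] by blast
  define K where "K = {x. padic_abs (s * x) \<le> 1}"
  define m where "m = distr M borel (\<lambda>\<omega>. X \<omega> - X \<omega>0)"
  have m_sets [measurable_cong]: "sets m = sets borel" by (simp add: m_def)
  have prob_m: "prob_space m" unfolding m_def by (rule prob_space_distr) measurable
  have charf_m: "padic_charf m (\<lambda>x. x) y = padic_charf M X y / padic_char (y * X \<omega>0)" for y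
  proof -
    have "padic_charf m (\<lambda>x. x) y = padic_charf M (\<lambda>\<omega>. X \<omega> - X \<omega>0) y"
      unfolding m_def by (rule padic_charf_distr) measurable
    thus ?thesis by (simp add: padic_charf_def right_diff_distrib padic_char_diff)
  qed
  have "compact_subgroup K"
    unfolding compact_subgroup_def
  proof (intro conjI ballI)
    have "K = {x. padic_abs x \<le> 1 / padic_abs s}"
      using padic_abs_pos[OF s(1)] by (auto simp: K_def padic_abs_mult field_simps)
    thus "compact K" by (simp add: compact_padic_ball)
    show "0 \<in> K" by (simp add: K_def)
    show "x - y \<in> K" if "x \<in> K" "y \<in> K" for x y
      using that padic_abs_diff_le[of "s * x" 1 "s * y"] by (simp add: K_def right_diff_distrib)
  qed
  moreover have "haar_distribution K m"
    unfolding haar_distribution_def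
  proof (intro conjI ballI)
    show "prob_space m" by (rule prob_m)
    show "sets m = sets borel" by (rule m_sets)
    have K_borel [measurable]: "K \<in> sets borel" unfolding K_def by measurable
    have "AE \<omega> in M. X \<omega> - X \<omega>0 \<in> K"
      using AE
    proof eventually_elim
      case (elim \<omega>)
      hence "padic_char (s * X \<omega> - s * X \<omega>0) = 1" unfolding padic_char_diff \<omega>0[symmetric] by simp
      thus ?case by (simp add: K_def padic_char_eq_1_iff right_diff_distrib)
    qed
    hence "prob {\<omega> \<in> space M. X \<omega> - X \<omega>0 \<in> K} = 1" by (subst prob_Collect_eq_1) auto
    thus "emeasure m K = 1"
      by (simp add: m_def emeasure_distr emeasure_eq_measure vimage_def Int_def conj_commute)
    fix x assume x: "x \<in> K"
    show "distr m borel (\<lambda>y. x + y) = m"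
    proof (rule padic_charf_unique)
      show "prob_space (distr m borel (\<lambda>y. x + y))"
        using prob_m by (rule prob_space.prob_space_distr) measurable
      fix y
      have "padic_charf (distr m borel (\<lambda>y. x + y)) (\<lambda>x. x) y = padic_charf m (\<lambda>z. x + z) y"
        by (rule padic_charf_distr) measurable
      also have "\<dots> = padic_char (y * x) * padic_charf m (\<lambda>z. z) y"
        by (simp add: padic_charf_def distrib_left padic_char_add)
      also have "\<dots> = padic_charf m (\<lambda>z. z) y"
      proof (cases "padic_abs y \<le> padic_abs s")
        case True
        hence "padic_abs y * padic_abs x \<le> padic_abs s * padic_abs x"
          by (rule mult_right_mono) (rule padic_abs_nonneg)
        hence "padic_abs (y * x) \<le> 1" using x by (simp add: K_def padic_abs_mult)
        thus ?thesis by (simp add: padic_char_eq_1_iff[THEN iffD2])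
      next
        case False
        hence "padic_charf M X y = 0" using s(2)[of y] by simp
        thus ?thesis by (simp add: charf_m)
      qed
      finally show "padic_charf (distr m borel (\<lambda>y. x + y)) (\<lambda>x. x) y = padic_charf m (\<lambda>x. x) y" .
    qed (simp_all add: prob_m m_sets)
  qed
  moreover have "distr M borel X = distr m borel (\<lambda>y. X \<omega>0 + y)"
    unfolding m_def by (subst distr_distr) (auto simp: comp_def)
  ultimately show ?thesis unfolding idempotent_distributions_def by blast
qed

lemma degenerate_imp_idempotent:
  "degenerate_distributions \<subseteq> (idempotent_distributions :: 'p::prime_card padic measure set)"
proof
  fix \<mu> :: "'p padic measure" assume "\<mu> \<in> degenerate_distributions"
  then obtain x where \<mu>: "\<mu> = return borel x" unfolding degenerate_distributions_def by blast
  have "compact_subgroup {0 :: 'p padic}" by (simp add: compact_subgroup_def)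
  moreover have "haar_distribution {0} (return borel (0 :: 'p padic))"
    by (simp add: haar_distribution_def prob_space_return distr_return distr_id2)
  moreover have "\<mu> = distr (return borel 0) borel (\<lambda>y. x + y)"
    by (simp add: \<mu> distr_return)
  ultimately show "\<mu> \<in> idempotent_distributions" unfolding idempotent_distributions_def by blast
qed

lemma forces_distributions_mono:
  "forces_distributions T \<Lambda> D \<Longrightarrow> D \<subseteq> D' \<Longrightarrow> forces_distributions T \<Lambda> D'"
  unfolding forces_distributions_def by blast

section \<open>The functional equation\<close>

lemma (in prob_space) charf_indep_vars:
  fixes X :: "'i \<Rightarrow> 'a \<Rightarrow> 'p::prime_card padic"
  assumes "finite I" "indep_vars (\<lambda>_. borel) X I"
  shows "(LINT \<omega>|M. (\<Prod>i\<in>I. padic_char (u i * X i \<omega>))) = (\<Prod>i\<in>I. padic_charf M (X i) (u i))"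
proof -
  have "indep_vars (\<lambda>_. borel) (\<lambda>i \<omega>. padic_char (u i * X i \<omega>)) I"
    by (rule indep_vars_compose2[OF assms(2)]) measurable
  moreover have "integrable M (\<lambda>\<omega>. padic_char (u i * X i \<omega>))" if "i \<in> I" for i
    using assms(2) that by (intro integrable_padic_char borel_measurable_padic_mult) (auto simp: indep_vars_def)
  ultimately show ?thesis
    unfolding padic_charf_def by (intro indep_vars_lebesgue_integral assms(1))
qed

lemma padic_char_forms:
  fixes \<Lambda> :: "'p::prime_card padic^'n::finite^'m::finite"
  shows "(\<Prod>i\<in>UNIV. padic_char (u i * (\<Lambda> *v (\<chi> j. x j)) $ i))
    = (\<Prod>j\<in>UNIV. padic_char ((\<Sum>i\<in>UNIV. \<Lambda> $ i $ j * u i) * x j))"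
proof -
  have "(\<Sum>i\<in>UNIV. u i * (\<Lambda> *v (\<chi> j. x j)) $ i) = (\<Sum>j\<in>UNIV. (\<Sum>i\<in>UNIV. \<Lambda> $ i $ j * u i) * x j)"
    unfolding matrix_vector_mult_def
    by (simp add: sum_distrib_left sum_distrib_right mult_ac) (rule sum.swap)
  thus ?thesis by (simp flip: padic_char_sum)
qed

lemma padic_char_form:
  fixes \<Lambda> :: "'p::prime_card padic^'n::finite^'m::finite"
  shows "padic_char (t * (\<Lambda> *v (\<chi> j. x j)) $ i) = (\<Prod>j\<in>UNIV. padic_char (\<Lambda> $ i $ j * t * x j))"
  unfolding matrix_vector_mult_def by (simp add: sum_distrib_left mult_ac padic_char_sum)

text \<open>The joint characteristic function of the forms is evaluated twice: regrouped by the
  variables, and factored over the independent forms, each of which is then split over the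
  variables.\<close>

lemma charf_equation:
  assumes "independent_with_forms \<Lambda> M \<xi>"
  shows "(\<Prod>j\<in>UNIV. padic_charf M (\<xi> j) (\<Sum>i\<in>UNIV. \<Lambda> $ i $ j * u i))
    = (\<Prod>i\<in>UNIV. \<Prod>j\<in>UNIV. padic_charf M (\<xi> j) (\<Lambda> $ i $ j * u i))"
proof -
  interpret prob_space M using assms by (simp add: independent_with_forms_def)
  have \<xi>: "indep_vars (\<lambda>_. borel) \<xi> UNIV"
    and L: "indep_vars (\<lambda>_. borel) (\<lambda>i \<omega>. (\<Lambda> *v (\<chi> j. \<xi> j \<omega>)) $ i) UNIV"
    using assms by (auto simp: independent_with_forms_def)
  have "(\<Prod>j\<in>UNIV. padic_charf M (\<xi> j) (\<Sum>i\<in>UNIV. \<Lambda> $ i $ j * u i))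
      = (LINT \<omega>|M. (\<Prod>i\<in>UNIV. padic_char (u i * (\<Lambda> *v (\<chi> j. \<xi> j \<omega>)) $ i)))"
    unfolding padic_char_forms by (rule charf_indep_vars[symmetric]) (auto intro: \<xi>)
  also have "\<dots> = (\<Prod>i\<in>UNIV. padic_charf M (\<lambda>\<omega>. (\<Lambda> *v (\<chi> j. \<xi> j \<omega>)) $ i) (u i))"
    by (rule charf_indep_vars) (auto intro: L)
  also have "\<dots> = (\<Prod>i\<in>UNIV. \<Prod>j\<in>UNIV. padic_charf M (\<xi> j) (\<Lambda> $ i $ j * u i))"
  proof (rule prod.cong)
    fix i
    show "padic_charf M (\<lambda>\<omega>. (\<Lambda> *v (\<chi> j. \<xi> j \<omega>)) $ i) (u i)
        = (\<Prod>j\<in>UNIV. padic_charf M (\<xi> j) (\<Lambda> $ i $ j * u i))"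
      unfolding padic_charf_def[of M "\<lambda>\<omega>. (\<Lambda> *v (\<chi> j. \<xi> j \<omega>)) $ i"] padic_char_form
      by (rule charf_indep_vars) (auto intro: \<xi>)
  qed simp
  finally show ?thesis .
qed

lemma independent_forms_equationI:
  fixes \<Lambda> :: "'p::prime_card padic^3^3"
  assumes "independent_with_forms \<Lambda> M \<xi>" "det \<Lambda> \<noteq> 0" "\<And>i j. \<Lambda> $ i $ j \<noteq> 0"
  shows "independent_forms_equation \<Lambda> (\<lambda>j y. norm (padic_charf M (\<xi> j) y))"
proof -
  interpret prob_space M using assms by (simp add: independent_with_forms_def)
  have rv: "random_variable borel (\<xi> j)" for j
    using assms by (auto simp: independent_with_forms_def indep_vars_def)
  show ?thesis
  proof
    show "\<exists>a b :: 3. a \<noteq> b" by (rule exI[of _ 1], rule exI[of _ 2]) simp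
    show "continuous_on UNIV (\<lambda>y. norm (padic_charf M (\<xi> j) y))" for j
      by (intro continuous_intros continuous_padic_charf rv)
    show "norm (padic_charf M (\<xi> j) (y + h)) = norm (padic_charf M (\<xi> j) y)"
      if "norm (padic_charf M (\<xi> j) h) = 1" for j y h
      using padic_charf_add[OF rv that] that by (simp add: norm_mult)
    show "(\<Prod>j\<in>UNIV. norm (padic_charf M (\<xi> j) (\<Sum>i\<in>UNIV. \<Lambda> $ i $ j * u i)))
        = (\<Prod>i\<in>UNIV. \<Prod>j\<in>UNIV. norm (padic_charf M (\<xi> j) (\<Lambda> $ i $ j * u i)))" for u
      using charf_equation[OF assms(1), of u, THEN arg_cong, of norm] by (simp add: prod_norm)
  qed (use assms in \<open>auto simp: padic_charf_0 norm_padic_charf_le_1\<close>)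
qed

theorem forces_degenerate:
  fixes \<Lambda> :: "'p::prime_card padic^3^3"
  assumes "det \<Lambda> \<noteq> 0" "\<And>i j. \<Lambda> $ i $ j \<noteq> 0" and "\<tau> permutes UNIV"
    and "padic_abs (det \<Lambda>) < (\<Prod>i\<in>UNIV. padic_abs (\<Lambda> $ i $ \<tau> i))"
  shows "forces_distributions TYPE('w) \<Lambda> degenerate_distributions"
  unfolding forces_distributions_def
proof (intro allI impI)
  fix M :: "'w measure" and \<xi> j
  assume indep: "independent_with_forms \<Lambda> M \<xi>"
  interpret prob_space M using indep by (simp add: independent_with_forms_def)
  interpret independent_forms_equation \<Lambda> "\<lambda>j y. norm (padic_charf M (\<xi> j) y)"
    using indep assms(1,2) by (rule independent_forms_equationI)
  show "distr M borel (\<xi> j) \<in> degenerate_distributions"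
  proof (rule degenerate_if_norm_charf_eq_1)
    show "random_variable borel (\<xi> j)" using indep by (auto simp: independent_with_forms_def indep_vars_def)
  qed (rule g_degenerate[OF assms(3,4)])
qed

theorem forces_idempotent:
  fixes \<Lambda> :: "'p::prime_card padic^3^3"
  assumes "det \<Lambda> \<noteq> 0" "\<And>i j. \<Lambda> $ i $ j \<noteq> 0"
    and "\<tau> permutes UNIV" "(\<Prod>i\<in>UNIV. padic_abs (\<Lambda> $ i $ \<tau> i)) = padic_abs (det \<Lambda>)"
    and "\<tau>' permutes UNIV" "(\<Prod>i\<in>UNIV. padic_abs (\<Lambda> $ i $ \<tau>' i)) = padic_abs (det \<Lambda>)"
    and "\<And>i. \<tau> i \<noteq> \<tau>' i"
  shows "forces_distributions TYPE('w) \<Lambda> idempotent_distributions"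
  unfolding forces_distributions_def
proof (intro allI impI)
  fix M :: "'w measure" and \<xi> j
  assume indep: "independent_with_forms \<Lambda> M \<xi>"
  interpret prob_space M using indep by (simp add: independent_with_forms_def)
  interpret independent_forms_equation \<Lambda> "\<lambda>j y. norm (padic_charf M (\<xi> j) y)"
    using indep assms(1,2) by (rule independent_forms_equationI)
  have rv: "random_variable borel (\<xi> j)" using indep by (auto simp: independent_with_forms_def indep_vars_def)
  show "distr M borel (\<xi> j) \<in> idempotent_distributions"
  \<comment> \<open>If all moduli are 1 there is no finite radius, and the law is a point
    mass.\<close>
  proof (cases "\<forall>y. norm (padic_charf M (\<xi> j) y) = 1")
    case True
    thus ?thesis using degenerate_if_norm_charf_eq_1[OF rv] degenerate_imp_idempotent by blast
  next
    case False
    then obtain w where w: "norm (padic_charf M (\<xi> j) w) \<noteq> 1" by blast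
    show ?thesis
    proof (rule g_idempotent[OF assms(3-7) w])
      fix s :: "'p padic"
      assume "s \<noteq> 0" "\<And>y. norm (padic_charf M (\<xi> j) y) = (if padic_abs y \<le> padic_abs s then 1 else 0)"
      thus ?thesis by (rule idempotent_if_norm_charf_indicator[OF rv])
    qed
  qed
qed


subsection \<open>Non-idempotent solutions\<close>

lemma padic_abs_mult_le:
  assumes "padic_abs x \<le> a" "padic_abs y \<le> b"
  shows "padic_abs (x * y :: 'p::prime_card padic) \<le> a * b"
  unfolding padic_abs_mult using assms padic_abs_nonneg[of x] padic_abs_nonneg[of y]
  by (intro mult_mono) auto

section \<open>Random digit expansions\<close>

definition digit_partial_sum :: "(nat \<Rightarrow> nat) \<Rightarrow> nat \<Rightarrow> 'p::prime_card padic" where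
  "digit_partial_sum \<omega> N = (\<Sum>n<N. of_nat (\<omega> n) * uniformizer ^ n)"

text \<open>Digits may be arbitrary natural numbers: the series converges because every natural
  number has absolute value at most 1.\<close>

definition padic_of_digits :: "(nat \<Rightarrow> nat) \<Rightarrow> 'p::prime_card padic" where
  "padic_of_digits \<omega> = lim (digit_partial_sum \<omega>)"

lemma padic_abs_digit_partial_sum_diff:
  assumes "N \<le> M"
  shows "padic_abs (digit_partial_sum \<omega> M - digit_partial_sum \<omega> N :: 'p::prime_card padic) \<le> (1 / real CARD('p)) ^ N"
proof -
  have p1: "1 < real CARD('p)" by (rule prime_card_gt_1)
  have "digit_partial_sum \<omega> M - digit_partial_sum \<omega> N
      = (\<Sum>n\<in>{N..<M}. of_nat (\<omega> n) * uniformizer ^ n :: 'p padic)"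
    using sum.atLeastLessThan_concat[OF _ assms, of 0 "\<lambda>n. of_nat (\<omega> n) * uniformizer ^ n :: 'p padic"]
    by (simp add: digit_partial_sum_def lessThan_atLeast0 algebra_simps)
  also have "padic_abs \<dots> \<le> (1 / real CARD('p)) ^ N"
  proof (rule padic_abs_sum_le)
    fix n assume "n \<in> {N..<M}"
    have "padic_abs (of_nat (\<omega> n) * uniformizer ^ n :: 'p padic) \<le> 1 * (1 / real CARD('p)) ^ n"
      unfolding padic_abs_mult padic_abs_uniformizer_power
      using padic_abs_of_nat_le_1 p1 by (intro mult_right_mono) auto
    also have "\<dots> \<le> (1 / real CARD('p)) ^ N"
      using \<open>n \<in> _\<close> p1 by (simp add: power_decreasing)
    finally show "padic_abs (of_nat (\<omega> n) * uniformizer ^ n :: 'p padic) \<le> (1 / real CARD('p)) ^ N" .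
  qed simp
  finally show ?thesis .
qed

lemma digit_partial_sum_tendsto:
  "digit_partial_sum \<omega> \<longlonglongrightarrow> (padic_of_digits \<omega> :: 'p::prime_card padic)"
proof -
  have "Cauchy (digit_partial_sum \<omega> :: nat \<Rightarrow> 'p padic)"
  proof (rule metric_CauchyI)
    fix e :: real assume "e > 0"
    then obtain N where N: "(1 / real CARD('p)) ^ N < e" by (rule inverse_prime_power_less)
    have "dist (digit_partial_sum \<omega> m) (digit_partial_sum \<omega> n :: 'p padic) < e" if "m \<ge> N" "n \<ge> N" for m n
    proof -
      have "padic_abs ((digit_partial_sum \<omega> m - digit_partial_sum \<omega> N)
          - (digit_partial_sum \<omega> n - digit_partial_sum \<omega> N :: 'p padic)) \<le> (1 / real CARD('p)) ^ N"
        using that by (intro padic_abs_diff_le padic_abs_digit_partial_sum_diff)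
      thus ?thesis using N by (simp add: dist_padic_def)
    qed
    thus "\<exists>M. \<forall>m\<ge>M. \<forall>n\<ge>M. dist (digit_partial_sum \<omega> m) (digit_partial_sum \<omega> n :: 'p padic) < e" by blast
  qed
  thus ?thesis unfolding padic_of_digits_def by (simp add: Cauchy_convergent_iff convergent_LIMSEQ_iff)
qed

lemma padic_of_digits_approx:
  "padic_abs (padic_of_digits \<omega> - digit_partial_sum \<omega> N :: 'p::prime_card padic) \<le> (1 / real CARD('p)) ^ N"
proof -
  have "continuous_on UNIV (\<lambda>x :: 'p padic. dist x (digit_partial_sum \<omega> N))" by (intro continuous_intros)
  from continuous_on_tendsto_compose[OF this digit_partial_sum_tendsto[of \<omega>, where 'p='p]]
  have "(\<lambda>M. padic_abs (digit_partial_sum \<omega> M - digit_partial_sum \<omega> N :: 'p padic))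
      \<longlonglongrightarrow> padic_abs (padic_of_digits \<omega> - digit_partial_sum \<omega> N :: 'p padic)"
    by (simp add: dist_padic_def)
  thus ?thesis
    by (rule LIMSEQ_le_const2) (auto intro!: exI[of _ N] padic_abs_digit_partial_sum_diff)
qed

text \<open>Only the law of the lowest digit is free. If it is uniform on the numbers below p, the
  expansion has the Haar law of \<open>padic_integers\<close>; if it is the point mass at 0, that of
  p times \<open>padic_integers\<close>.\<close>

definition digit_pmf :: "'p::prime_card itself \<Rightarrow> nat pmf \<Rightarrow> nat \<Rightarrow> nat pmf" where
  "digit_pmf _ \<nu> n = (if n = 0 then \<nu> else pmf_of_set {..<CARD('p)})"

definition digit_measure :: "'p::prime_card itself \<Rightarrow> nat pmf \<Rightarrow> (nat \<Rightarrow> nat) measure" where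
  "digit_measure T \<nu> = PiM UNIV (\<lambda>n. measure_pmf (digit_pmf T \<nu> n))"

lemma prob_space_digit_measure: "prob_space (digit_measure T \<nu>)"
  unfolding digit_measure_def by (intro prob_space_PiM prob_space_measure_pmf)

lemma measurable_padic_of_digits [measurable]:
  "(padic_of_digits :: _ \<Rightarrow> 'p::prime_card padic) \<in> borel_measurable (digit_measure TYPE('p) \<nu>)"
proof (rule borel_measurable_LIMSEQ_metric)
  show "(\<lambda>\<omega>. digit_partial_sum \<omega> N :: 'p padic) \<in> borel_measurable (digit_measure TYPE('p) \<nu>)" for N
    unfolding digit_partial_sum_def digit_measure_def
  proof (rule borel_measurable_sum)
    fix n
    show "(\<lambda>\<omega>. of_nat (\<omega> n) * uniformizer ^ n :: 'p padic)
      \<in> borel_measurable (PiM UNIV (\<lambda>n. measure_pmf (digit_pmf TYPE('p) \<nu> n)))"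
      by (rule measurable_compose[OF measurable_component_singleton[of n]]) auto
  qed
qed (rule digit_partial_sum_tendsto)

text \<open>At such a frequency \<open>padic_char z\<close> is a nontrivial p-th root of unity, and
  the sum of its powers over a full period vanishes.\<close>

lemma integral_char_uniform_digit:
  fixes z :: "'p::prime_card padic"
  assumes "padic_abs z = real CARD('p)"
  shows "(LINT k|measure_pmf (pmf_of_set {..<CARD('p)}). padic_char (z * of_nat k)) = 0"
proof -
  have p1: "1 < real CARD('p)" by (rule prime_card_gt_1)
  have ne: "{..<CARD('p)} \<noteq> {}" using p1 by auto
  have w1: "padic_char z \<noteq> 1" using assms p1 by (simp add: padic_char_eq_1_iff)
  have "padic_abs (uniformizer * z) = 1" using assms p1 by (simp add: padic_abs_mult padic_abs_uniformizer)
  hence "padic_char (uniformizer * z) = 1" by (simp add: padic_char_eq_1_iff)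
  hence wp: "padic_char z ^ CARD('p) = 1" by (simp add: padic_char_of_nat_mult)
  have "(LINT k|measure_pmf (pmf_of_set {..<CARD('p)}). padic_char (z * of_nat k))
      = (\<Sum>k<CARD('p). pmf (pmf_of_set {..<CARD('p)}) k *\<^sub>R padic_char (z * of_nat k))"
    using ne by (intro integral_measure_pmf) auto
  also have "\<dots> = (\<Sum>k<CARD('p). (1 / real CARD('p)) *\<^sub>R padic_char z ^ k)"
    using ne by (intro sum.cong) (auto simp: mult.commute[of z] padic_char_of_nat_mult)
  also have "\<dots> = (1 / real CARD('p)) *\<^sub>R (\<Sum>k<CARD('p). padic_char z ^ k)"
    by (simp add: scaleR_sum_right)
  also have "\<dots> = 0" using w1 wp by (simp add: geometric_sum)
  finally show ?thesis .
qed

text \<open>Digits from position \<open>N\<close> on change the argument of the character by an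
  integral element only, so it depends on finitely many independent digits.\<close>

lemma charf_digits_eq_prod:
  fixes y :: "'p::prime_card padic"
  assumes y: "padic_abs y \<le> real CARD('p) ^ N"
  shows "padic_charf (digit_measure TYPE('p) \<nu>) padic_of_digits y
    = (\<Prod>n<N. LINT k|measure_pmf (digit_pmf TYPE('p) \<nu> n). padic_char (y * uniformizer ^ n * of_nat k))"
proof -
  let ?D = "\<lambda>n. measure_pmf (digit_pmf TYPE('p) \<nu> n)"
  have p1: "1 < real CARD('p)" by (rule prime_card_gt_1)
  interpret D: product_prob_space ?D UNIV by unfold_locales
  define F where "F \<omega> = (\<Prod>n<N. padic_char (y * uniformizer ^ n * of_nat (\<omega> n)))" for \<omega> :: "nat \<Rightarrow> nat"
  have char_eq: "padic_char (y * padic_of_digits \<omega>) = F (restrict \<omega> {..<N})" for \<omega>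
  proof -
    have "padic_abs (y * padic_of_digits \<omega> - y * digit_partial_sum \<omega> N)
        \<le> real CARD('p) ^ N * (1 / real CARD('p)) ^ N"
      unfolding right_diff_distrib[symmetric] padic_abs_mult
      using y padic_of_digits_approx[of \<omega> N, where 'p='p] padic_abs_nonneg p1 by (intro mult_mono) auto
    also have "\<dots> = 1" using p1 by (simp add: power_divide)
    finally have "padic_char (y * padic_of_digits \<omega>) = padic_char (y * digit_partial_sum \<omega> N)"
      by (rule padic_char_cong)
    also have "\<dots> = F (restrict \<omega> {..<N})"
      unfolding digit_partial_sum_def F_def sum_distrib_left padic_char_sum
      by (intro prod.cong) (auto simp: mult_ac)
    finally show ?thesis .
  qed
  have F_meas: "F \<in> borel_measurable (PiM {..<N} ?D)"
    unfolding F_def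
  proof (rule borel_measurable_prod)
    fix n assume "n \<in> {..<N}"
    thus "(\<lambda>\<omega>. padic_char (y * uniformizer ^ n * of_nat (\<omega> n))) \<in> borel_measurable (PiM {..<N} ?D)"
      by (intro measurable_compose[OF measurable_component_singleton[of n]]) auto
  qed
  have restrict_meas: "(\<lambda>\<omega>. restrict \<omega> {..<N}) \<in> measurable (PiM UNIV ?D) (PiM {..<N} ?D)"
    by (rule measurable_restrict_subset) simp
  have "padic_charf (digit_measure TYPE('p) \<nu>) padic_of_digits y
      = (LINT \<omega>|PiM UNIV ?D. F (restrict \<omega> {..<N}))"
    by (simp add: padic_charf_def digit_measure_def char_eq)
  also have "\<dots> = (LINT \<omega>|distr (PiM UNIV ?D) (PiM {..<N} ?D) (\<lambda>\<omega>. restrict \<omega> {..<N}). F \<omega>)"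
    by (rule integral_distr[OF restrict_meas F_meas, symmetric])
  also have "\<dots> = (LINT \<omega>|PiM {..<N} ?D. F \<omega>)"
    by (subst D.distr_PiM_restrict_finite) auto
  also have "\<dots> = (\<Prod>n<N. LINT k|?D n. padic_char (y * uniformizer ^ n * of_nat k))"
    unfolding F_def
    by (rule D.product_integral_prod) (auto intro!: measure_pmf.integrable_const_bound[where B = 1])
  finally show ?thesis .
qed

text \<open>For |y| = p^(t + 1) with t > 0 the frequency seen by digit t is y p^t, of absolute value
  p, and uniformity of that digit gives a factor 0. For |y| \<le> p only the lowest digit is
  seen.\<close>

lemma charf_digits:
  fixes y :: "'p::prime_card padic"
  shows "padic_charf (digit_measure TYPE('p) \<nu>) padic_of_digits y
    = (if padic_abs y \<le> real CARD('p) then LINT k|measure_pmf \<nu>. padic_char (y * of_nat k) else 0)"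
proof (cases "padic_abs y \<le> real CARD('p)")
  case True
  thus ?thesis using charf_digits_eq_prod[of y 1 \<nu>] by (simp add: digit_pmf_def)
next
  case False
  have p1: "1 < real CARD('p)" by (rule prime_card_gt_1)
  have "y \<noteq> 0" using False by auto
  then obtain n :: int where n: "padic_abs y = real CARD('p) powi n" by (rule padic_abs_value)
  have "1 < n"
  proof (rule ccontr)
    assume "\<not> 1 < n"
    hence "real CARD('p) powi n \<le> real CARD('p) powi 1" using p1 by (intro power_int_increasing) auto
    thus False using n False by simp
  qed
  define t where "t = nat (n - 1)"
  have t: "n = int (Suc t)" "0 < t" using \<open>1 < n\<close> by (auto simp: t_def)
  hence y: "padic_abs y = real CARD('p) ^ Suc t" using n by (simp only: power_int_of_nat)
  have "padic_abs (y * uniformizer ^ t) = real CARD('p)"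
    using p1 y by (simp add: padic_abs_mult padic_abs_uniformizer_power power_divide)
  hence "(LINT k|measure_pmf (digit_pmf TYPE('p) \<nu> t). padic_char (y * uniformizer ^ t * of_nat k)) = 0"
    using t integral_char_uniform_digit[of "y * uniformizer ^ t"] by (simp add: digit_pmf_def)
  hence "(\<Prod>n<Suc t. LINT k|measure_pmf (digit_pmf TYPE('p) \<nu> n). padic_char (y * uniformizer ^ n * of_nat k)) = 0"
    by simp
  thus ?thesis using charf_digits_eq_prod[of y "Suc t" \<nu>] y False by simp
qed

text \<open>The sample points are vectors because the counterexamples have to live on the type
  \<open>'p padic^3\<close>. The sigma-algebra is pulled back from the product space of functions
  along the coordinates.\<close>

lemma exists_independent_with_laws:
  fixes \<mu> :: "'n::finite \<Rightarrow> 'p::prime_card padic measure"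
  assumes "\<And>j. prob_space (\<mu> j)" "\<And>j. sets (\<mu> j) = sets borel"
  obtains M :: "('p padic^'n) measure" where "prob_space M"
    "prob_space.indep_vars M (\<lambda>_. borel) (\<lambda>j x. x $ j) UNIV"
    "\<And>j. distr M borel (\<lambda>x. x $ j) = \<mu> j"
proof -
  note [measurable_cong] = assms(2)
  interpret P: product_prob_space \<mu> UNIV
    by (intro product_prob_spaceI assms(1))
  define P where "P = PiM UNIV \<mu>"
  define vec :: "('n \<Rightarrow> 'p padic) \<Rightarrow> 'p padic^'n" where "vec f = (\<chi> j. f j)" for f
  define N where "N = vimage_algebra UNIV (\<lambda>(x :: 'p padic^'n) j. x $ j) P"
  have space_\<mu>: "space (\<mu> j) = UNIV" for j using sets_eq_imp_space_eq[OF assms(2)[of j]] by simp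
  have space_P: "space P = UNIV" by (simp add: P_def space_PiM space_\<mu>)
  have comp: "(\<lambda>x. x $ j) \<in> borel_measurable N" for j
  proof -
    have "(\<lambda>(x :: 'p padic^'n) j. x $ j) \<in> measurable N P"
      unfolding N_def by (rule measurable_vimage_algebra1) (simp add: space_P)
    moreover have "(\<lambda>f. f j) \<in> measurable P borel"
      using measurable_component_singleton[of j UNIV \<mu>] assms(2)
      by (simp add: P_def cong: measurable_cong_sets)
    ultimately show ?thesis by (rule measurable_compose)
  qed
  have vec_meas: "vec \<in> measurable P N"
    unfolding N_def
  proof (rule measurable_vimage_algebra2)
    have "(\<lambda>x j. vec x $ j) = (\<lambda>x. x)" by (simp add: vec_def fun_eq_iff)
    thus "(\<lambda>x j. vec x $ j) \<in> measurable P P" by simp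
  qed simp
  define M where "M = distr P N vec"
  have prob_P: "prob_space P" unfolding P_def by (rule prob_space_PiM) (rule assms(1))
  have prob_M: "prob_space M" unfolding M_def by (rule prob_space.prob_space_distr[OF prob_P vec_meas])
  interpret M: prob_space M by (rule prob_M)
  have rv: "(\<lambda>x. x $ j) \<in> borel_measurable M" for j using comp by (simp add: M_def cong: measurable_cong_sets)
  have prod: "(LINT x|M. (\<Prod>j\<in>UNIV. padic_char (u j * x $ j))) = (\<Prod>j\<in>UNIV. padic_charf (\<mu> j) (\<lambda>x. x) (u j))" for u
  proof -
    have "(LINT x|M. (\<Prod>j\<in>UNIV. padic_char (u j * x $ j))) = (LINT f|P. (\<Prod>j\<in>UNIV. padic_char (u j * f j)))"
      unfolding M_def
    proof (subst integral_distr[OF vec_meas])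
      show "(\<lambda>x. \<Prod>j\<in>UNIV. padic_char (u j * x $ j)) \<in> borel_measurable N"
        using comp by (intro borel_measurable_prod) measurable
    qed (simp add: vec_def)
    also have "\<dots> = (\<Prod>j\<in>UNIV. padic_charf (\<mu> j) (\<lambda>x. x) (u j))"
      unfolding P_def padic_charf_def
    proof (rule P.product_integral_prod)
      fix j
      show "integrable (\<mu> j) (\<lambda>x. padic_char (u j * x))"
        by (rule prob_space.integrable_padic_char[OF assms(1)]) measurable
    qed simp
    finally show ?thesis .
  qed
  have marg: "padic_charf M (\<lambda>x. x $ j) y = padic_charf (\<mu> j) (\<lambda>x. x) y" for j y
  proof -
    have "(\<Prod>l\<in>UNIV. padic_char ((if l = j then y else 0) * x $ l)) = padic_char (y * x $ j)" for x :: "'p padic^'n"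
      by (subst prod.mono_neutral_right[of UNIV "{j}"]) auto
    moreover have "(\<Prod>l\<in>UNIV. padic_charf (\<mu> l) (\<lambda>x. x) (if l = j then y else 0)) = padic_charf (\<mu> j) (\<lambda>x. x) y"
      by (subst prod.mono_neutral_right[of UNIV "{j}"]) (auto simp: prob_space.padic_charf_0 assms(1))
    ultimately show ?thesis
      using prod[of "\<lambda>l. if l = j then y else 0"] by (simp add: padic_charf_def)
  qed
  show thesis
  proof (rule that[OF prob_M])
    show "M.indep_vars (\<lambda>_. borel) (\<lambda>j x. x $ j) UNIV"
      by (rule M.indep_vars_padicI) (auto simp: rv prod marg)
    show "distr M borel (\<lambda>x. x $ j) = \<mu> j" for j
    proof (rule padic_charf_unique)
      show "padic_charf (distr M borel (\<lambda>x. x $ j)) (\<lambda>x. x) y = padic_charf (\<mu> j) (\<lambda>x. x) y" for y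
        using padic_charf_distr[OF rv[of j], of y] marg by simp
    qed (simp_all add: M.prob_space_distr rv assms)
  qed
qed

text \<open>Invariance under z in \<open>K\<close> multiplies the characteristic function of the
  Haar law by the character at z. Either the character is trivial on \<open>K\<close>, and the value
  is 1, or some z forces the value 0. Shifts do not change the modulus.\<close>

lemma norm_charf_idempotent:
  assumes "\<mu> \<in> idempotent_distributions"
  shows "norm (padic_charf \<mu> (\<lambda>x. x) (y :: 'p::prime_card padic)) \<in> {0, 1}"
proof -
  obtain x m K where \<mu>: "\<mu> = distr m borel (\<lambda>y. x + y)" and K: "compact_subgroup K" and m: "haar_distribution K m"
    using assms unfolding idempotent_distributions_def by blast
  interpret prob_space m using m by (simp add: haar_distribution_def)
  have [measurable_cong]: "sets m = sets borel" using m by (simp add: haar_distribution_def)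
  have shift: "padic_charf (distr m borel (\<lambda>y. z + y)) (\<lambda>x. x) y
      = padic_char (y * z) * padic_charf m (\<lambda>x. x) y" for z
  proof -
    have "padic_charf (distr m borel (\<lambda>y. z + y)) (\<lambda>x. x) y = padic_charf m (\<lambda>x. z + x) y"
      by (rule padic_charf_distr) measurable
    thus ?thesis by (simp add: padic_charf_def distrib_left padic_char_add)
  qed
  have inv: "padic_charf m (\<lambda>x. x) y = padic_char (y * z) * padic_charf m (\<lambda>x. x) y" if "z \<in> K" for z
    using m that shift[of z] by (simp add: haar_distribution_def)
  have "norm (padic_charf m (\<lambda>x. x) y) \<in> {0, 1}"
  proof (cases "\<forall>z\<in>K. padic_char (y * z) = 1")
    case True
    have "closed K" using K by (simp add: compact_subgroup_def compact_imp_closed)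
    hence [measurable]: "K \<in> sets borel" by (rule borel_closed)
    have "prob K = 1" using m by (simp add: haar_distribution_def emeasure_eq_measure)
    hence "AE x in m. x \<in> K" by (subst prob_eq_1[symmetric]) auto
    hence "AE x in m. padic_char (y * x) = 1" by eventually_elim (use True in blast)
    hence "padic_charf m (\<lambda>x. x) y = (LINT x|m. 1)"
      unfolding padic_charf_def by (intro integral_cong_AE) auto
    thus ?thesis by (simp add: prob_space)
  next
    case False
    then obtain z where "z \<in> K" "padic_char (y * z) \<noteq> 1" by blast
    thus ?thesis using inv[of z] by simp
  qed
  thus ?thesis unfolding \<mu> shift by (simp add: norm_mult)
qed

text \<open>Cramer's rule: an entry of the inverse is the determinant of \<open>A\<close> with one
  column replaced by a unit vector, divided by the unit det A. Such a determinant is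
  integral.\<close>

lemma integral_inverse:
  fixes A :: "'p::prime_card padic^'n^'n"
  assumes A: "\<And>i j. padic_abs (A $ i $ j) \<le> 1" and det: "padic_abs (det A) = 1"
  obtains V :: "'p padic^'n^'n" where "\<And>i j. padic_abs (V $ i $ j) \<le> 1"
    "\<And>i m. (\<Sum>l\<in>UNIV. A $ i $ l * V $ l $ m) = (if i = m then 1 else 0)"
proof -
  have "det A \<noteq> 0" using det by auto
  then obtain V where V: "A ** V = mat 1" unfolding invertible_det_nz[symmetric] invertible_def by blast
  have AV: "(\<Sum>l\<in>UNIV. A $ i $ l * V $ l $ m) = (if i = m then 1 else 0)" for i m
    using V[THEN arg_cong, of "\<lambda>B. B $ i $ m"] by (simp add: matrix_matrix_mult_def mat_def)
  have "padic_abs (V $ l $ m) \<le> 1" for l m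
  proof -
    let ?x = "\<chi> l. V $ l $ m"
    let ?B = "(\<chi> i j. if j = l then (A *v ?x) $ i else A $ i $ j) :: 'p padic^'n^'n"
    have "padic_abs ((A *v ?x) $ i) \<le> 1" for i
      using AV[of i m] by (simp add: matrix_vector_mult_def)
    hence "padic_abs (det ?B) \<le> 1"
      using A by (intro padic_abs_det_le prod_le_1) (auto simp: padic_abs_nonneg)
    thus ?thesis using det by (simp add: cramer_lemma padic_abs_mult)
  qed
  with AV show thesis using that by blast
qed

text \<open>Reducing \<open>A\<close> modulo \<open>p\<close>: in the case of a row, the other summands are uniform on \<open>\<Delta>\<^sub>p\<close>, so the
  form of row \<open>i0\<close> carries the biased digit of \<open>\<xi> j0\<close> and the other forms are uniform; in the case of a
  column, the other summands are uniform on \<open>p \<Delta>\<^sub>p\<close>, and only the form of row \<open>i0\<close> sees that digit.\<close>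

lemma counterexample:
  fixes A :: "'p::prime_card padic^3^3"
  assumes A: "\<And>i j. padic_abs (A $ i $ j) \<le> 1" and det: "padic_abs (det A) = 1"
    and single: "(\<forall>l. l \<noteq> j0 \<longrightarrow> padic_abs (A $ i0 $ l) < 1) \<or> (\<forall>i. i \<noteq> i0 \<longrightarrow> padic_abs (A $ i $ j0) < 1)"
  obtains M :: "('p padic^3) measure" and \<xi> y where "independent_with_forms A M \<xi>"
    "norm (padic_charf M (\<xi> j0) y) \<notin> {0, 1}"
proof -
  let ?p = "real CARD('p)"
  have p1: "1 < ?p" by (rule prime_card_gt_1)
  define row where "row \<longleftrightarrow> (\<forall>l. l \<noteq> j0 \<longrightarrow> padic_abs (A $ i0 $ l) < 1)"
  \<comment> \<open>The weight 1 / 4 rather than 1 / 2 matters for p = 2, where a fair bit is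
    uniform and the characteristic function would vanish at frequency 1 / p.\<close>
  define \<nu>0 :: "nat pmf" where "\<nu>0 = map_pmf (\<lambda>b. if b then 1 else 0) (bernoulli_pmf (1 / 4))"
  define \<nu> where "\<nu> j = (if j = j0 then \<nu>0 else if row then pmf_of_set {..<CARD('p)} else return_pmf 0)" for j
  define \<mu> :: "3 \<Rightarrow> 'p padic measure" where
    "\<mu> j = distr (digit_measure TYPE('p) (\<nu> j)) borel padic_of_digits" for j
  define \<psi> :: "'p padic \<Rightarrow> complex" where "\<psi> y = 3 / 4 + padic_char y / 4" for y
  \<comment> \<open>The radius outside which the characteristic function of the l-th law vanishes: 1
    for a law uniform on the integers, p when the lowest digit is not uniform. If both alternatives
    of \<open>single\<close> hold, the row case is used.\<close>
  define \<rho> where "\<rho> l = (if l = j0 \<or> \<not> row then ?p else 1)" for l :: 3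
  define f where "f l y = (if padic_abs y \<le> \<rho> l then if l = j0 then \<psi> y else 1 else 0)" for l y
  have \<psi>_add: "\<psi> (x + y) = \<psi> x" if "padic_abs y \<le> 1" for x y
    using that padic_char_eq_1_iff[of y] by (simp add: \<psi>_def padic_char_add)
  have \<psi>_1: "\<psi> y = 1" if "padic_abs y \<le> 1" for y using \<psi>_add[OF that, of 0] by (simp add: \<psi>_def)
  have charf_\<mu>: "padic_charf (\<mu> j) (\<lambda>x. x) y = f j y" for j y
  proof -
    have "padic_charf (\<mu> j) (\<lambda>x. x) y = padic_charf (digit_measure TYPE('p) (\<nu> j)) padic_of_digits y"
      unfolding \<mu>_def by (rule padic_charf_distr) measurable
    also have "\<dots> = f j y"
    proof (cases "j = j0")
      case True
      have "(LINT k|measure_pmf \<nu>0. padic_char (y * of_nat k)) = \<psi> y"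
        unfolding \<nu>0_def integral_map_pmf
        by (subst integral_measure_pmf[of UNIV]) (auto simp: UNIV_bool \<psi>_def scaleR_conv_of_real)
      thus ?thesis unfolding charf_digits by (simp add: True \<nu>_def f_def \<rho>_def)
    next
      case False
      show ?thesis
      proof (cases row)
        case True
        have "(LINT k|measure_pmf (pmf_of_set {..<CARD('p)}). padic_char (y * of_nat k)) = 1"
          if "padic_abs y \<le> 1"
        proof -
          have "padic_abs (y * of_nat k) \<le> 1" for k
            using padic_abs_mult_le[OF that padic_abs_of_nat_le_1] by simp
          hence "padic_char (y * of_nat k) = 1" for k by (simp add: padic_char_eq_1_iff)
          thus ?thesis by simp
        qed
        moreover have "(LINT k|measure_pmf (pmf_of_set {..<CARD('p)}). padic_char (y * of_nat k)) = 0"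
          if "\<not> padic_abs y \<le> 1" "padic_abs y \<le> ?p"
        proof (rule integral_char_uniform_digit)
          show "padic_abs y = ?p" using padic_abs_gt_1D[of y] that by simp
        qed
        ultimately show ?thesis
          unfolding charf_digits using True False p1 by (auto simp: \<nu>_def f_def \<rho>_def)
      next
        case row: False
        thus ?thesis unfolding charf_digits using False by (simp add: \<nu>_def f_def \<rho>_def)
      qed
    qed
    finally show ?thesis .
  qed
  obtain V :: "'p padic^3^3" where V: "\<And>i j. padic_abs (V $ i $ j) \<le> 1"
    and AV: "\<And>i m. (\<Sum>l\<in>UNIV. A $ i $ l * V $ l $ m) = (if i = m then 1 else 0)"
    using integral_inverse[OF A det] by blast
  have small: "padic_abs (A $ i $ j) \<le> 1 / ?p" if "padic_abs (A $ i $ j) < 1" for i j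
    using that by (rule padic_abs_less_1D)
  \<comment> \<open>If all sums lie in the supports, so do all summands, and only row i0 sees the
    biased digit. Integrality of the inverse \<open>V\<close> recovers bounds on \<open>u\<close>
    from bounds on the sums.\<close>
  have support: "(\<forall>i l. padic_abs (A $ i $ l * u i) \<le> \<rho> l) \<and> (\<forall>i. i \<noteq> i0 \<longrightarrow> padic_abs (A $ i $ j0 * u i) \<le> 1)"
    if v: "\<And>l. padic_abs (\<Sum>i\<in>UNIV. A $ i $ l * u i) \<le> \<rho> l" for u
  proof -
    define v where "v l = (\<Sum>i\<in>UNIV. A $ i $ l * u i)" for l
    have u: "u m = (\<Sum>l\<in>UNIV. V $ l $ m * v l)" for m
    proof -
      have "(\<Sum>l\<in>UNIV. V $ l $ m * v l) = (\<Sum>l\<in>UNIV. \<Sum>i\<in>UNIV. A $ i $ l * V $ l $ m * u i)"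
        by (simp add: v_def sum_distrib_left mult_ac)
      also have "\<dots> = (\<Sum>i\<in>UNIV. \<Sum>l\<in>UNIV. A $ i $ l * V $ l $ m * u i)" by (rule sum.swap)
      also have "\<dots> = (\<Sum>i\<in>UNIV. (if i = m then 1 else 0) * u i)"
        unfolding AV[symmetric] sum_distrib_right ..
      finally show ?thesis by (simp add: if_distrib[of "\<lambda>x. x * _"] cong: if_cong)
    qed
    have vp: "padic_abs (v l) \<le> ?p" for l using v[of l] p1 by (simp add: v_def \<rho>_def split: if_splits)
    have up: "padic_abs (u i) \<le> ?p" for i
      unfolding u using padic_abs_mult_le[OF V vp] p1 by (intro padic_abs_sum_le) auto
    have Aup: "padic_abs (A $ i $ l * u i) \<le> ?p" for i l using padic_abs_mult_le[OF A up] by simp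
    have Aup1: "padic_abs (A $ i $ l * u i) \<le> 1" if "padic_abs (A $ i $ l) < 1" for i l
      using padic_abs_mult_le[OF small[OF that] up] p1 by simp
    show ?thesis
    proof (cases row)
      case True
      have A_row: "padic_abs (A $ i0 $ l) < 1" if "l \<noteq> j0" for l using True that by (simp add: row_def)
      \<comment> \<open>Modulo p, row i0 of \<open>A\<close> is concentrated at j0. Comparison with
        A V = 1 shows that this entry is a unit and that row j0 of \<open>V\<close> is divisible by
        p except at i0.\<close>
      have sum_A: "A $ i0 $ j0 * V $ j0 $ m = (if i0 = m then 1 else 0) - (\<Sum>l\<in>UNIV - {j0}. A $ i0 $ l * V $ l $ m)" for m
        using AV[of i0 m] by (simp add: sum.remove[of UNIV j0] algebra_simps)
      have rest: "padic_abs (\<Sum>l\<in>UNIV - {j0}. A $ i0 $ l * V $ l $ m) < 1" for m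
      proof (rule padic_abs_sum_less)
        fix l assume "l \<in> UNIV - {j0}"
        hence "padic_abs (A $ i0 $ l * V $ l $ m) \<le> 1 / ?p"
          using padic_abs_mult_le[OF small[OF A_row] V, of l l m] by simp
        also have "\<dots> < 1" using p1 by simp
        finally show "padic_abs (A $ i0 $ l * V $ l $ m) < 1" .
      qed simp
      have A1: "padic_abs (A $ i0 $ j0) = 1"
      proof (rule ccontr)
        assume "padic_abs (A $ i0 $ j0) \<noteq> 1"
        hence "padic_abs (A $ i0 $ j0) < 1" using A[of i0 j0] by simp
        hence "padic_abs (A $ i0 $ j0 * V $ j0 $ i0) < 1"
          using padic_abs_mult_le[OF order.refl V, of "A $ i0 $ j0" j0 i0] by simp
        hence "padic_abs (A $ i0 $ j0 * V $ j0 $ i0 + (\<Sum>l\<in>UNIV - {j0}. A $ i0 $ l * V $ l $ i0)) < 1"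
          using rest by (rule padic_abs_add_less)
        thus False unfolding sum_A by simp
      qed
      have V_small: "padic_abs (V $ j0 $ m) \<le> 1 / ?p" if "m \<noteq> i0" for m
      proof (rule padic_abs_less_1D)
        have "padic_abs (A $ i0 $ j0 * V $ j0 $ m) < 1"
          using rest[of m] that unfolding sum_A by (simp add: padic_abs_minus)
        thus "padic_abs (V $ j0 $ m) < 1" by (simp add: padic_abs_mult A1)
      qed
      have u1: "padic_abs (u m) \<le> 1" if m: "m \<noteq> i0" for m
        unfolding u
      proof (rule padic_abs_sum_le)
        fix l
        show "padic_abs (V $ l $ m * v l) \<le> 1"
        proof (cases "l = j0")
          case True
          thus ?thesis using padic_abs_mult_le[OF V_small[OF m] vp] p1 by simp
        next
          case False
          hence "padic_abs (v l) \<le> 1" using v[of l] \<open>row\<close> by (simp add: v_def \<rho>_def)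
          thus ?thesis using padic_abs_mult_le[OF V] by force
        qed
      qed simp
      have Au1: "padic_abs (A $ i $ l * u i) \<le> 1" if "i \<noteq> i0" for i l
        using padic_abs_mult_le[OF A u1[OF that]] by simp
      have "padic_abs (A $ i $ l * u i) \<le> \<rho> l" for i l
      proof (cases "l = j0")
        case True
        thus ?thesis using Aup by (simp add: \<rho>_def)
      next
        case False
        thus ?thesis using Au1[of i l] Aup1[of i0 l] A_row[of l] True by (cases "i = i0") (auto simp: \<rho>_def)
      qed
      thus ?thesis using Au1 by blast
    next
      case False
      hence "padic_abs (A $ i $ j0) < 1" if "i \<noteq> i0" for i using single that by (auto simp: row_def)
      thus ?thesis using False Aup Aup1 by (auto simp: \<rho>_def)
    qed
  qed
  have equation: "(\<Prod>j\<in>UNIV. f j (\<Sum>i\<in>UNIV. A $ i $ j * u i)) = (\<Prod>i\<in>UNIV. \<Prod>j\<in>UNIV. f j (A $ i $ j * u i))" for u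
  proof (cases "\<forall>l. padic_abs (\<Sum>i\<in>UNIV. A $ i $ l * u i) \<le> \<rho> l")
    case True
    hence bound: "\<And>i l. padic_abs (A $ i $ l * u i) \<le> \<rho> l"
      and bound1: "\<And>i. i \<noteq> i0 \<Longrightarrow> padic_abs (A $ i $ j0 * u i) \<le> 1"
      using support[of u] by auto
    have "(\<Prod>j\<in>UNIV. f j (\<Sum>i\<in>UNIV. A $ i $ j * u i)) = \<psi> (\<Sum>i\<in>UNIV. A $ i $ j0 * u i)"
      using True by (subst prod.mono_neutral_right[of UNIV "{j0}"]) (auto simp: f_def)
    also have "(\<Sum>i\<in>UNIV. A $ i $ j0 * u i) = A $ i0 $ j0 * u i0 + (\<Sum>i\<in>UNIV - {i0}. A $ i $ j0 * u i)"
      by (rule sum.remove) auto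
    also have "\<psi> \<dots> = \<psi> (A $ i0 $ j0 * u i0)"
      by (intro \<psi>_add padic_abs_sum_le) (auto simp: bound1)
    also have "\<dots> = (\<Prod>i\<in>UNIV. \<psi> (A $ i $ j0 * u i))"
      by (subst prod.mono_neutral_right[of UNIV "{i0}"]) (auto simp: \<psi>_1 bound1)
    also have "\<dots> = (\<Prod>i\<in>UNIV. \<Prod>j\<in>UNIV. f j (A $ i $ j * u i))"
      by (intro prod.cong refl, subst prod.mono_neutral_right[of UNIV "{j0}"]) (auto simp: f_def bound)
    finally show ?thesis .
  next
    case False
    then obtain l where l: "\<not> padic_abs (\<Sum>i\<in>UNIV. A $ i $ l * u i) \<le> \<rho> l" by blast
    have "0 \<le> \<rho> l" using p1 by (simp add: \<rho>_def)
    \<comment> \<open>By the ultrametric inequality some summand leaves the support together with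
      the sum, so both sides vanish.\<close>
    with l obtain i where i: "\<not> padic_abs (A $ i $ l * u i) \<le> \<rho> l"
      using padic_abs_sum_le[of UNIV "\<lambda>i. A $ i $ l * u i" "\<rho> l"] by blast
    have "(\<Prod>j\<in>UNIV. f j (A $ i $ j * u i)) = 0"
      by (rule prod_zero) (use i in \<open>auto simp: f_def\<close>)
    hence "(\<Prod>i\<in>UNIV. \<Prod>j\<in>UNIV. f j (A $ i $ j * u i)) = 0"
      by (intro prod_zero) auto
    moreover have "(\<Prod>j\<in>UNIV. f j (\<Sum>i\<in>UNIV. A $ i $ j * u i)) = 0"
      by (rule prod_zero) (use l in \<open>auto simp: f_def\<close>)
    ultimately show ?thesis by (simp only:)
  qed
  have laws: "prob_space (\<mu> j)" "sets (\<mu> j) = sets borel" for j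
    unfolding \<mu>_def by (auto intro!: prob_space.prob_space_distr prob_space_digit_measure measurable_padic_of_digits)
  obtain M :: "('p padic^3) measure" where "prob_space M"
    and \<xi>: "prob_space.indep_vars M (\<lambda>_. borel) (\<lambda>j x. x $ j) UNIV"
    and law: "\<And>j. distr M borel (\<lambda>x. x $ j) = \<mu> j"
    using exists_independent_with_laws[of \<mu>, OF laws] by blast
  interpret prob_space M by fact
  have rv [measurable]: "(\<lambda>x. x $ j) \<in> borel_measurable M" for j using \<xi> by (auto simp: indep_vars_def)
  have charf_\<xi>: "padic_charf M (\<lambda>x. x $ j) y = f j y" for j y
    using padic_charf_distr[OF rv[of j], of y] by (simp add: law charf_\<mu>)
  have charf_L: "padic_charf M (\<lambda>x. (A *v (\<chi> j. x $ j)) $ i) t = (\<Prod>j\<in>UNIV. f j (A $ i $ j * t))" for i t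
    unfolding padic_charf_def padic_char_form
    by (subst charf_indep_vars[OF _ \<xi>]) (auto simp: charf_\<xi>)
  have "indep_vars (\<lambda>_. borel) (\<lambda>i x. (A *v (\<chi> j. x $ j)) $ i) UNIV"
  proof (rule indep_vars_padicI)
    show "random_variable borel (\<lambda>x. (A *v (\<chi> j. x $ j)) $ i)" for i
      unfolding matrix_vector_mult_def by simp
    show "(LINT x|M. (\<Prod>i\<in>UNIV. padic_char (u i * (A *v (\<chi> j. x $ j)) $ i)))
        = (\<Prod>i\<in>UNIV. padic_charf M (\<lambda>x. (A *v (\<chi> j. x $ j)) $ i) (u i))" for u
      unfolding padic_char_forms charf_L
      by (subst charf_indep_vars[OF _ \<xi>]) (auto simp: charf_\<xi> equation)
  qed auto
  hence indep: "independent_with_forms A M (\<lambda>j x. x $ j)"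
    using \<xi> \<open>prob_space M\<close> by (simp add: independent_with_forms_def)
  define y where "y = (1 / uniformizer :: 'p padic)"
  define w where "w = padic_char y"
  have y: "padic_abs y = ?p" using p1 by (simp add: y_def padic_abs_divide padic_abs_uniformizer)
  have charf_y: "padic_charf M (\<lambda>x. x $ j0) y = 3 / 4 + w / 4"
    by (simp add: charf_\<xi> f_def \<rho>_def y \<psi>_def w_def)
  \<comment> \<open>The squared modulus is 5 / 8 + (3 / 8) Re w. It lies between 1 / 4 and 1 and
    equals 1 only for w = 1, which is excluded because y is not integral.\<close>
  have "norm (3 / 4 + w / 4) \<notin> {0, 1}"
  proof
  assume norm_w: "norm (3 / 4 + w / 4) \<in> {0, 1}"
  have w: "(Re w)\<^sup>2 + (Im w)\<^sup>2 = 1" using norm_padic_char[of y] by (simp add: w_def cmod_power2[symmetric])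
  have "(norm (3 / 4 + w / 4))\<^sup>2 = (3 / 4 + Re w / 4)\<^sup>2 + (Im w / 4)\<^sup>2" by (simp add: cmod_power2)
  also have "\<dots> = 9 / 16 + 6 / 16 * Re w + ((Re w)\<^sup>2 + (Im w)\<^sup>2) / 16"
    by (simp add: power2_eq_square field_simps)
  finally have "(norm (3 / 4 + w / 4))\<^sup>2 = 10 / 16 + 6 / 16 * Re w" using w by simp
  moreover from norm_w have "(norm (3 / 4 + w / 4))\<^sup>2 \<in> {0, 1}" by auto
  moreover have "\<bar>Re w\<bar> \<le> 1" using abs_Re_le_cmod[of w] by (simp add: w_def)
  ultimately have "Re w = 1" by auto
  hence "w = 1" using w by (simp add: complex_eq_iff)
  thus False using y p1 by (simp add: w_def padic_char_eq_1_iff)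
  qed
  thus thesis using that[OF indep, of y] by (simp add: charf_y)
qed


subsection \<open>The matrices of the theorem\<close>

text \<open>Here diag(t) \<Lambda> diag(s) plays the role of \<open>A\<close> in
  \<open>counterexample\<close>. Passing to the variables \<open>s j * \<xi> j\<close> turns the
  forms of \<open>A\<close> into those of \<open>\<Lambda>\<close> up to the factors
  \<open>t i\<close>, and constant factors preserve independence.\<close>

lemma not_forces_idempotent:
  fixes \<Lambda> :: "'p::prime_card padic^3^3" and s t :: "3 \<Rightarrow> 'p padic"
  assumes nz: "\<And>i. t i \<noteq> 0" "\<And>j. s j \<noteq> 0"
    and entries: "\<And>i j. padic_abs (t i * \<Lambda> $ i $ j * s j) \<le> 1"
    and det: "padic_abs (t 1 * t 2 * t 3 * (s 1 * s 2 * s 3) * det \<Lambda>) = 1"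
    and single: "(\<forall>l. l \<noteq> j0 \<longrightarrow> padic_abs (t i0 * \<Lambda> $ i0 $ l * s l) < 1)
      \<or> (\<forall>i. i \<noteq> i0 \<longrightarrow> padic_abs (t i * \<Lambda> $ i $ j0 * s j0) < 1)"
  shows "\<not> forces_distributions TYPE('p padic^3) \<Lambda> idempotent_distributions"
proof
  assume forced: "forces_distributions TYPE('p padic^3) \<Lambda> idempotent_distributions"
  define A where "A = (\<chi> i j. t i * \<Lambda> $ i $ j * s j)"
  have "det A = t 1 * t 2 * t 3 * (s 1 * s 2 * s 3) * det \<Lambda>"
    by (simp add: A_def det_3 algebra_simps)
  hence "padic_abs (det A) = 1" using det by simp
  then obtain M :: "('p padic^3) measure" and \<xi> y where indep: "independent_with_forms A M \<xi>"
      and y: "norm (padic_charf M (\<xi> j0) y) \<notin> {0, 1}"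
    using counterexample[of A j0 i0] entries single by (auto simp: A_def)
  interpret prob_space M using indep by (simp add: independent_with_forms_def)
  have \<xi>: "indep_vars (\<lambda>_. borel) \<xi> UNIV"
    and L: "indep_vars (\<lambda>_. borel) (\<lambda>i \<omega>. (A *v (\<chi> j. \<xi> j \<omega>)) $ i) UNIV"
    using indep by (auto simp: independent_with_forms_def)
  define \<eta> where "\<eta> j \<omega> = s j * \<xi> j \<omega>" for j \<omega>
  have "(\<Lambda> *v (\<chi> j. \<eta> j \<omega>)) $ i = inverse (t i) * (A *v (\<chi> j. \<xi> j \<omega>)) $ i" for i \<omega>
    unfolding matrix_vector_mult_def A_def \<eta>_def
    using nz(1)[of i] by (simp add: sum_distrib_left field_simps)
  moreover have "indep_vars (\<lambda>_. borel) (\<lambda>i \<omega>. inverse (t i) * (A *v (\<chi> j. \<xi> j \<omega>)) $ i) UNIV"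
    by (rule indep_vars_compose2[OF L]) measurable
  moreover have "indep_vars (\<lambda>_. borel) \<eta> UNIV"
    unfolding \<eta>_def by (rule indep_vars_compose2[OF \<xi>]) measurable
  ultimately have "independent_with_forms \<Lambda> M \<eta>"
    using prob_space_axioms by (simp add: independent_with_forms_def)
  hence "distr M borel (\<eta> j0) \<in> idempotent_distributions"
    using forced by (simp add: forces_distributions_def)
  \<comment> \<open>Dividing the frequency by \<open>s j0\<close> undoes the scaling of the
    variable.\<close>
  hence "norm (padic_charf (distr M borel (\<eta> j0)) (\<lambda>x. x) (y / s j0)) \<in> {0, 1}"
    by (rule norm_charf_idempotent)
  moreover have "random_variable borel (\<eta> j0)"
    using \<xi> unfolding \<eta>_def by (intro borel_measurable_padic_mult) (auto simp: indep_vars_def)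
  hence "padic_charf (distr M borel (\<eta> j0)) (\<lambda>x. x) (y / s j0) = padic_charf M (\<xi> j0) y"
    using nz(2)[of j0] by (subst padic_charf_distr) (simp_all add: padic_charf_def \<eta>_def)
  ultimately show False using y by simp
qed

definition perm3 :: "3 \<Rightarrow> 3 \<Rightarrow> 3 \<Rightarrow> 3 \<Rightarrow> 3" where
  "perm3 a b c = (\<lambda>i. if i = 1 then a else if i = 2 then b else c)"

lemma perm3_permutes: "distinct [a, b, c] \<Longrightarrow> perm3 a b c permutes UNIV"
proof (rule bij_imp_permutes)
  assume "distinct [a, b, c]"
  hence "inj (perm3 a b c)" unfolding inj_def perm3_def forall_3 by auto
  thus "bij (perm3 a b c)" by (simp add: bij_def finite_UNIV_inj_surj)
qed simp

lemma prod_perm3: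
  "(\<Prod>i\<in>UNIV. f i (perm3 a b c i)) = f 1 a * f 2 b * (f 3 c :: 'a::comm_monoid_mult)"
  unfolding UNIV_3 by (simp add: perm3_def mult.assoc)

lemma forces_degenerate3:
  fixes \<Lambda> :: "'p::prime_card padic^3^3"
  assumes "det \<Lambda> \<noteq> 0" "\<And>i j. \<Lambda> $ i $ j \<noteq> 0" "distinct [a, b, c]"
    and "padic_abs (det \<Lambda>) < padic_abs (\<Lambda> $ 1 $ a) * padic_abs (\<Lambda> $ 2 $ b) * padic_abs (\<Lambda> $ 3 $ c)"
  shows "forces_distributions TYPE('w) \<Lambda> degenerate_distributions"
  using assms by (intro forces_degenerate[OF _ _ perm3_permutes[of a b c]])
    (auto simp: prod_perm3[of "\<lambda>i j. padic_abs (\<Lambda> $ i $ j)"])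

lemma forces_idempotent3:
  fixes \<Lambda> :: "'p::prime_card padic^3^3"
  assumes "det \<Lambda> \<noteq> 0" "\<And>i j. \<Lambda> $ i $ j \<noteq> 0"
    and abc: "distinct [a, b, c]" "distinct [a', b', c']" "a \<noteq> a'" "b \<noteq> b'" "c \<noteq> c'"
    and eq: "padic_abs (\<Lambda> $ 1 $ a) * padic_abs (\<Lambda> $ 2 $ b) * padic_abs (\<Lambda> $ 3 $ c) = padic_abs (det \<Lambda>)"
      "padic_abs (\<Lambda> $ 1 $ a') * padic_abs (\<Lambda> $ 2 $ b') * padic_abs (\<Lambda> $ 3 $ c') = padic_abs (det \<Lambda>)"
  shows "forces_distributions TYPE('w) \<Lambda> idempotent_distributions"
  using assms(1,2) perm3_permutes[OF abc(1)] _ perm3_permutes[OF abc(2)]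
proof (rule forces_idempotent)
  show "perm3 a b c i \<noteq> perm3 a' b' c' i" for i using abc(3-5) by (simp add: perm3_def)
qed (simp_all add: prod_perm3[of "\<lambda>i j. padic_abs (\<Lambda> $ i $ j)"] eq)

lemma card_Collect_3: "card {j :: 3. P j} = of_bool (P 1) + of_bool (P 2) + of_bool (P 3)"
proof -
  have "card {j :: 3. P j} = (\<Sum>j\<in>UNIV. of_bool (P j))" by simp
  thus ?thesis unfolding UNIV_3 by simp
qed

lemma Lambda1_nth [simp]:
  "Lambda1 \<delta>1 \<delta>2 \<epsilon>1 \<epsilon>2 $ 1 $ 1 = 1" "Lambda1 \<delta>1 \<delta>2 \<epsilon>1 \<epsilon>2 $ 1 $ 2 = 1" "Lambda1 \<delta>1 \<delta>2 \<epsilon>1 \<epsilon>2 $ 1 $ 3 = 1"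
  "Lambda1 \<delta>1 \<delta>2 \<epsilon>1 \<epsilon>2 $ 2 $ 1 = 1" "Lambda1 \<delta>1 \<delta>2 \<epsilon>1 \<epsilon>2 $ 2 $ 2 = \<delta>1" "Lambda1 \<delta>1 \<delta>2 \<epsilon>1 \<epsilon>2 $ 2 $ 3 = \<delta>2"
  "Lambda1 \<delta>1 \<delta>2 \<epsilon>1 \<epsilon>2 $ 3 $ 1 = 1" "Lambda1 \<delta>1 \<delta>2 \<epsilon>1 \<epsilon>2 $ 3 $ 2 = \<epsilon>1" "Lambda1 \<delta>1 \<delta>2 \<epsilon>1 \<epsilon>2 $ 3 $ 3 = \<epsilon>2"
  by (simp_all add: Lambda1_def)

lemma Lambda2_nth [simp]:
  "Lambda2 \<delta>1 \<delta>2 \<epsilon>1 \<epsilon>2 $ 1 $ 1 = 1" "Lambda2 \<delta>1 \<delta>2 \<epsilon>1 \<epsilon>2 $ 1 $ 2 = 1" "Lambda2 \<delta>1 \<delta>2 \<epsilon>1 \<epsilon>2 $ 1 $ 3 = 1"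
  "Lambda2 \<delta>1 \<delta>2 \<epsilon>1 \<epsilon>2 $ 2 $ 1 = \<delta>1" "Lambda2 \<delta>1 \<delta>2 \<epsilon>1 \<epsilon>2 $ 2 $ 2 = 1" "Lambda2 \<delta>1 \<delta>2 \<epsilon>1 \<epsilon>2 $ 2 $ 3 = \<delta>2"
  "Lambda2 \<delta>1 \<delta>2 \<epsilon>1 \<epsilon>2 $ 3 $ 1 = 1" "Lambda2 \<delta>1 \<delta>2 \<epsilon>1 \<epsilon>2 $ 3 $ 2 = \<epsilon>1" "Lambda2 \<delta>1 \<delta>2 \<epsilon>1 \<epsilon>2 $ 3 $ 3 = \<epsilon>2"
  by (simp_all add: Lambda2_def)

text \<open>The unit parts of the coefficients and of the determinant disappear: the hypotheses
  retain absolute values only, as powers of r = 1 / p.\<close>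

locale normalized_forms =
  fixes \<delta>1 \<delta>2 \<epsilon>1 \<epsilon>2 :: "'p::prime_card padic" and \<Lambda> :: "'p padic^3^3" and k1 k2 l1 l2 k q :: nat and r :: real
  assumes r_def: "r = 1 / real CARD('p)"
    and abs_coeffs: "padic_abs \<delta>1 = r ^ k1" "padic_abs \<delta>2 = r ^ k2" "padic_abs \<epsilon>1 = r ^ l1" "padic_abs \<epsilon>2 = r ^ l2"
    and k_def: "k = Min {k1, k2, l1, l2}"
    and matrix: "\<Lambda> = Lambda1 \<delta>1 \<delta>2 \<epsilon>1 \<epsilon>2 \<or> \<Lambda> = Lambda2 \<delta>1 \<delta>2 \<epsilon>1 \<epsilon>2"
    and abs_det: "padic_abs (det \<Lambda>) = r ^ q"
begin

lemma r: "0 < r" "r < 1"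
  using prime_card_gt_1[where 'p='p] by (auto simp: r_def)

lemma power_r_less_iff: "r ^ m < r ^ n \<longleftrightarrow> n < m"
  using r by (rule power_strict_decreasing_iff)

lemma power_r_le: "n \<le> m \<Longrightarrow> r ^ m \<le> r ^ n"
  using r by (intro power_decreasing) auto

lemma power_r_less_1_iff [simp]: "r ^ m < 1 \<longleftrightarrow> 0 < m"
  using power_r_less_iff[of m 0] by simp

lemma power_r_eq_1_iff [simp]: "r ^ m = 1 \<longleftrightarrow> m = 0"
  by (metis gr0I less_irrefl power_0 power_r_less_1_iff)

lemma unit_iffs: "\<delta>1 \<in> padic_units \<longleftrightarrow> k1 = 0" "\<delta>2 \<in> padic_units \<longleftrightarrow> k2 = 0"
    "\<epsilon>1 \<in> padic_units \<longleftrightarrow> l1 = 0" "\<epsilon>2 \<in> padic_units \<longleftrightarrow> l2 = 0"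
  by (simp_all add: padic_units_iff abs_coeffs)

lemma k_le: "k \<le> k1" "k \<le> k2" "k \<le> l1" "k \<le> l2" "k = k1 \<or> k = k2 \<or> k = l1 \<or> k = l2"
  unfolding k_def by (auto simp: min_def)

lemma det_nz: "det \<Lambda> \<noteq> 0"
  using abs_det r by auto

lemma coeffs_nz: "\<delta>1 \<noteq> 0" "\<delta>2 \<noteq> 0" "\<epsilon>1 \<noteq> 0" "\<epsilon>2 \<noteq> 0"
  using abs_coeffs r by auto

lemma entry_nz: "\<Lambda> $ i $ j \<noteq> 0"
  using matrix coeffs_nz exhaust_3[of i] exhaust_3[of j] by auto

lemma entry_le: "padic_abs (\<Lambda> $ i $ j) \<le> 1"
  using matrix r exhaust_3[of i] exhaust_3[of j] by (auto simp: abs_coeffs power_le_one)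

definition rows_cols :: bool where
  "rows_cols \<longleftrightarrow> (\<forall>i. card {j. \<Lambda> $ i $ j \<in> padic_units} \<ge> 2) \<and> (\<forall>j. card {i. \<Lambda> $ i $ j \<in> padic_units} \<ge> 2)"

lemma rows_cols_Lambda1:
  assumes "\<Lambda> = Lambda1 \<delta>1 \<delta>2 \<epsilon>1 \<epsilon>2"
  shows "rows_cols \<longleftrightarrow> (k1 = 0 \<or> k2 = 0) \<and> (l1 = 0 \<or> l2 = 0) \<and> (k1 = 0 \<or> l1 = 0) \<and> (k2 = 0 \<or> l2 = 0)"
  unfolding rows_cols_def card_Collect_3 forall_3 Lambda1_nth[of \<delta>1 \<delta>2 \<epsilon>1 \<epsilon>2, folded assms] unit_iffs by (auto simp: padic_units_iff)

lemma rows_cols_Lambda2: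
  assumes "\<Lambda> = Lambda2 \<delta>1 \<delta>2 \<epsilon>1 \<epsilon>2"
  shows "rows_cols \<longleftrightarrow> (k1 = 0 \<or> k2 = 0) \<and> (l1 = 0 \<or> l2 = 0) \<and> (k2 = 0 \<or> l2 = 0)"
  unfolding rows_cols_def card_Collect_3 forall_3 Lambda2_nth[of \<delta>1 \<delta>2 \<epsilon>1 \<epsilon>2, folded assms] unit_iffs by (auto simp: padic_units_iff)

section \<open>Conditions that force degenerate or idempotent laws\<close>

lemma forces_degenerate_perm:
  assumes "distinct [a, b, c]"
    "padic_abs (det \<Lambda>) < padic_abs (\<Lambda> $ 1 $ a) * padic_abs (\<Lambda> $ 2 $ b) * padic_abs (\<Lambda> $ 3 $ c)"
  shows "forces_distributions TYPE('w) \<Lambda> degenerate_distributions"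
  by (rule forces_degenerate3[OF det_nz entry_nz assms])

text \<open>For each of the four coefficients there is a permutation whose product consists of it
  and two entries 1. The one with the smallest exponent gives r^k, which exceeds r^q.\<close>

lemma forces_degenerate_Lambda1:
  assumes "\<Lambda> = Lambda1 \<delta>1 \<delta>2 \<epsilon>1 \<epsilon>2" "k < q"
  shows "forces_distributions TYPE('w) \<Lambda> degenerate_distributions"
proof -
  have "r ^ q < r ^ k" using assms by (simp add: power_r_less_iff)
  thus ?thesis
    using k_le(5) forces_degenerate_perm[of 3 2 1, where 'w='w] forces_degenerate_perm[of 2 3 1, where 'w='w]
      forces_degenerate_perm[of 3 1 2, where 'w='w] forces_degenerate_perm[of 2 1 3, where 'w='w]
    by (auto simp: abs_det Lambda1_nth[of \<delta>1 \<delta>2 \<epsilon>1 \<epsilon>2, folded assms(1)] abs_coeffs)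
qed

text \<open>The antidiagonal of this matrix consists of ones, so its product 1 exceeds any non-unit
  determinant.\<close>

lemma forces_degenerate_Lambda2:
  assumes "\<Lambda> = Lambda2 \<delta>1 \<delta>2 \<epsilon>1 \<epsilon>2" "0 < q"
  shows "forces_distributions TYPE('w) \<Lambda> degenerate_distributions"
  using forces_degenerate_perm[of 3 2 1, where 'w='w]
  by (simp add: abs_det assms(2) Lambda2_nth[of \<delta>1 \<delta>2 \<epsilon>1 \<epsilon>2, folded assms(1)])

text \<open>One permutation passes through \<delta>1 and one through \<epsilon>2 (respectively
  \<delta>2 and \<epsilon>1), all their other entries being 1. The two have equal parity, hence
  differ in every row.\<close>

lemma forces_idempotent_Lambda1:
  assumes "\<Lambda> = Lambda1 \<delta>1 \<delta>2 \<epsilon>1 \<epsilon>2" "k1 = q \<and> l2 = q \<or> k2 = q \<and> l1 = q"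
  shows "forces_distributions TYPE('w) \<Lambda> idempotent_distributions"
  using assms(2)
proof
  assume "k1 = q \<and> l2 = q"
  thus ?thesis
    using forces_idempotent3[OF det_nz entry_nz, of 3 2 1 2 1 3, where 'w='w]
    by (simp add: abs_det Lambda1_nth[of \<delta>1 \<delta>2 \<epsilon>1 \<epsilon>2, folded assms(1)] abs_coeffs)
next
  assume "k2 = q \<and> l1 = q"
  thus ?thesis
    using forces_idempotent3[OF det_nz entry_nz, of 2 3 1 3 1 2, where 'w='w]
    by (simp add: abs_det Lambda1_nth[of \<delta>1 \<delta>2 \<epsilon>1 \<epsilon>2, folded assms(1)] abs_coeffs)
qed

lemma forces_idempotent_rows_cols:
  assumes "q = 0" "rows_cols"
  shows "forces_distributions TYPE('w) \<Lambda> idempotent_distributions"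
  using matrix
proof
  assume L: "\<Lambda> = Lambda1 \<delta>1 \<delta>2 \<epsilon>1 \<epsilon>2"
  thus ?thesis
    using assms rows_cols_Lambda1[OF L] by (intro forces_idempotent_Lambda1) auto
next
  assume L: "\<Lambda> = Lambda2 \<delta>1 \<delta>2 \<epsilon>1 \<epsilon>2"
  note nth = Lambda2_nth[of \<delta>1 \<delta>2 \<epsilon>1 \<epsilon>2, folded L]
  \<comment> \<open>In each of these cases two permutations that differ in every row pass through
    units only.\<close>
  have "k2 = 0 \<and> l1 = 0 \<or> k2 = 0 \<and> l2 = 0 \<or> k1 = 0 \<and> l2 = 0"
    using assms rows_cols_Lambda2[OF L] by auto
  thus ?thesis
  proof (elim disjE)
    assume "k2 = 0 \<and> l1 = 0"
    thus ?thesis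
      by (intro forces_idempotent3[OF det_nz entry_nz, of 1 3 2 3 2 1])
        (simp_all add: abs_det nth abs_coeffs assms(1))
  next
    assume "k2 = 0 \<and> l2 = 0"
    thus ?thesis
      by (intro forces_idempotent3[OF det_nz entry_nz, of 1 2 3 2 3 1])
        (simp_all add: abs_det nth abs_coeffs assms(1))
  next
    assume "k1 = 0 \<and> l2 = 0"
    thus ?thesis
      by (intro forces_idempotent3[OF det_nz entry_nz, of 2 1 3 3 2 1])
        (simp_all add: abs_det nth abs_coeffs assms(1))
  qed
qed

section \<open>Failure of the conditions\<close>

lemma not_forces_rows_cols:
  assumes "q = 0" "\<not> rows_cols"
  shows "\<not> forces_distributions TYPE('p padic^3) \<Lambda> idempotent_distributions"
proof -
  \<comment> \<open>As q = 0, the matrix is integral with unit determinant, so the trivial scaling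
    serves; a row or column with fewer than two units is the one to which
    \<open>counterexample\<close> applies.\<close>
  have counter: "\<not> forces_distributions TYPE('p padic^3) \<Lambda> idempotent_distributions"
    if "(\<forall>l. l \<noteq> j0 \<longrightarrow> padic_abs (\<Lambda> $ i0 $ l) < 1) \<or> (\<forall>i. i \<noteq> i0 \<longrightarrow> padic_abs (\<Lambda> $ i $ j0) < 1)"
    for i0 j0
    using not_forces_idempotent[of "\<lambda>_. 1" "\<lambda>_. 1" \<Lambda> j0 i0] that entry_le abs_det assms(1) by simp
  show ?thesis
    using matrix
  proof
    assume L: "\<Lambda> = Lambda1 \<delta>1 \<delta>2 \<epsilon>1 \<epsilon>2"
    thus ?thesis
      using assms(2) rows_cols_Lambda1[OF L] counter[of 1 2] counter[of 1 3] counter[of 2 1] counter[of 3 1]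
      by (auto simp: forall_3 Lambda1_nth[of \<delta>1 \<delta>2 \<epsilon>1 \<epsilon>2, folded L] abs_coeffs)
  next
    assume L: "\<Lambda> = Lambda2 \<delta>1 \<delta>2 \<epsilon>1 \<epsilon>2"
    thus ?thesis
      using assms(2) rows_cols_Lambda2[OF L] counter[of 2 2] counter[of 1 3] counter[of 3 1]
      by (auto simp: forall_3 Lambda2_nth[of \<delta>1 \<delta>2 \<epsilon>1 \<epsilon>2, folded L] abs_coeffs)
  qed
qed

text \<open>When all four coefficients are divisible by p, the determinant of the second matrix is
  -1 modulo p, which contradicts q > 0.\<close>

lemma Lambda1_if_no_units:
  assumes "0 < q" "0 < k"
  shows "\<Lambda> = Lambda1 \<delta>1 \<delta>2 \<epsilon>1 \<epsilon>2"
  using matrix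
proof
  assume L: "\<Lambda> = Lambda2 \<delta>1 \<delta>2 \<epsilon>1 \<epsilon>2"
  have small: "padic_abs \<delta>1 < 1" "padic_abs \<delta>2 < 1" "padic_abs \<epsilon>1 < 1" "padic_abs \<epsilon>2 < 1"
    using assms(2) k_le by (auto simp: abs_coeffs)
  have mult: "padic_abs (x * y) < 1" if "padic_abs x < 1" "padic_abs y < 1" for x y :: "'p padic"
    using padic_abs_mult_le[OF less_imp_le[OF that(1)] order.refl[of "padic_abs y"]] that by simp
  have det: "det \<Lambda> = - 1 + (\<epsilon>2 + (\<delta>2 + (\<delta>1 * \<epsilon>1 + (- (\<delta>2 * \<epsilon>1) + - (\<delta>1 * \<epsilon>2)))))"
    by (simp add: L det_3)
  have "padic_abs (\<epsilon>2 + (\<delta>2 + (\<delta>1 * \<epsilon>1 + (- (\<delta>2 * \<epsilon>1) + - (\<delta>1 * \<epsilon>2))))) < padic_abs (- 1 :: 'p padic)"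
    unfolding padic_abs_minus padic_abs_1
    by (intro padic_abs_add_less) (simp_all add: padic_abs_minus small mult)
  hence "padic_abs (det \<Lambda>) = padic_abs (- 1 :: 'p padic)"
    unfolding det by (rule padic_abs_add_eq)
  thus ?thesis using abs_det assms(1) by (simp add: padic_abs_minus)
qed

text \<open>Every term of the determinant contains one of the four coefficients, hence is divisible
  by p^k.\<close>

lemma k_le_q:
  assumes L: "\<Lambda> = Lambda1 \<delta>1 \<delta>2 \<epsilon>1 \<epsilon>2"
  shows "k \<le> q"
proof -
  have le: "padic_abs \<delta>1 \<le> r ^ k" "padic_abs \<delta>2 \<le> r ^ k" "padic_abs \<epsilon>1 \<le> r ^ k" "padic_abs \<epsilon>2 \<le> r ^ k"
    using k_le by (auto simp: abs_coeffs power_r_le)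
  have le1: "padic_abs \<delta>1 \<le> 1" "padic_abs \<delta>2 \<le> 1" using r by (auto simp: abs_coeffs power_le_one)
  have "padic_abs (\<delta>1 * \<epsilon>2) \<le> r ^ k" "padic_abs (\<delta>2 * \<epsilon>1) \<le> r ^ k"
    using padic_abs_mult_le[OF le1(1) le(4)] padic_abs_mult_le[OF le1(2) le(3)] by simp_all
  hence "padic_abs ((\<delta>1 * \<epsilon>2 - \<delta>2 * \<epsilon>1) + ((\<delta>2 - \<epsilon>2) + (\<epsilon>1 - \<delta>1))) \<le> r ^ k"
    by (intro padic_abs_add_le padic_abs_diff_le le)
  moreover have "det \<Lambda> = (\<delta>1 * \<epsilon>2 - \<delta>2 * \<epsilon>1) + ((\<delta>2 - \<epsilon>2) + (\<epsilon>1 - \<delta>1))"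
    by (simp add: L det_3 algebra_simps)
  ultimately have "r ^ q \<le> r ^ k" by (simp flip: abs_det)
  thus ?thesis using power_r_less_iff[of k q] by linarith
qed

lemma not_forces_exponents:
  assumes L: "\<Lambda> = Lambda1 \<delta>1 \<delta>2 \<epsilon>1 \<epsilon>2" and q: "q = k"
    and exps: "\<not> (k1 = k \<and> l2 = k \<or> k2 = k \<and> l1 = k)"
  shows "\<not> forces_distributions TYPE('p padic^3) \<Lambda> idempotent_distributions"
proof -
  \<comment> \<open>The first row is multiplied by p^k and the last two columns are divided by p^k.
    The determinant changes by the factor p^(-k) and becomes a unit, the ones outside the corner (1,
    1) stay units, and the exponents of the four coefficients drop by k.\<close>
  define t :: "3 \<Rightarrow> 'p padic" where "t i = (if i = 1 then uniformizer ^ k else 1)" for i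
  define s :: "3 \<Rightarrow> 'p padic" where "s j = (if j = 1 then 1 else 1 / uniformizer ^ k)" for j
  have abs_u: "padic_abs (uniformizer ^ k :: 'p padic) = r ^ k"
    by (simp add: padic_abs_uniformizer_power r_def)
  have div: "r ^ m / r ^ k = r ^ (m - k)" if "k \<le> m" for m
    using r that by (simp add: power_diff)
  have abs_entries: "padic_abs (t 1 * \<Lambda> $ 1 $ 1 * s 1) = r ^ k"
    "padic_abs (t 1 * \<Lambda> $ 1 $ 2 * s 2) = 1" "padic_abs (t 1 * \<Lambda> $ 1 $ 3 * s 3) = 1"
    "padic_abs (t 2 * \<Lambda> $ 2 $ 1 * s 1) = 1"
    "padic_abs (t 2 * \<Lambda> $ 2 $ 2 * s 2) = r ^ (k1 - k)" "padic_abs (t 2 * \<Lambda> $ 2 $ 3 * s 3) = r ^ (k2 - k)"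
    "padic_abs (t 3 * \<Lambda> $ 3 $ 1 * s 1) = 1"
    "padic_abs (t 3 * \<Lambda> $ 3 $ 2 * s 2) = r ^ (l1 - k)" "padic_abs (t 3 * \<Lambda> $ 3 $ 3 * s 3) = r ^ (l2 - k)"
    using r k_le(1-4) by (auto simp: Lambda1_nth[of \<delta>1 \<delta>2 \<epsilon>1 \<epsilon>2, folded L] t_def s_def padic_abs_mult padic_abs_divide abs_u abs_coeffs div)
  have counter: "\<not> forces_distributions TYPE('p padic^3) \<Lambda> idempotent_distributions"
    if single: "(\<forall>l. l \<noteq> j0 \<longrightarrow> padic_abs (t i0 * \<Lambda> $ i0 $ l * s l) < 1)
      \<or> (\<forall>i. i \<noteq> i0 \<longrightarrow> padic_abs (t i * \<Lambda> $ i $ j0 * s j0) < 1)" for i0 j0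
  proof (rule not_forces_idempotent[OF _ _ _ _ single])
    show "padic_abs (t i * \<Lambda> $ i $ j * s j) \<le> 1" for i j
      using exhaust_3[of i] exhaust_3[of j] r by (auto simp: abs_entries power_le_one)
    show "padic_abs (t 1 * t 2 * t 3 * (s 1 * s 2 * s 3) * det \<Lambda>) = 1"
      using r by (simp add: t_def s_def padic_abs_mult padic_abs_divide abs_u abs_det q)
  qed (simp_all add: t_def s_def)
  \<comment> \<open>Each diagonal of the two by two block of coefficients has an exponent above k,
    and a position on one diagonal always shares a row or a column with a position on the
    other.\<close>
  have "k < k1 \<and> k < k2 \<or> k < l1 \<and> k < l2 \<or> k < k1 \<and> k < l1 \<or> k < k2 \<and> k < l2"
    using exps k_le by (auto simp: le_less)
  thus ?thesis
    using counter[of 1 2] counter[of 1 3] counter[of 2 1] counter[of 3 1]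
    by (auto simp: forall_3 abs_entries)
qed

end

text \<open>The counterexamples live on the sample type \<open>'p padic^3\<close>, so the
  equivalences speak of that type, while the positive conclusions hold on an arbitrary type
  \<open>'w\<close>.\<close>

theorem theorem1:
  fixes \<delta>1 \<delta>2 \<epsilon>1 \<epsilon>2 c1 c2 d1 d2 lam :: "'p::prime_card padic"
    and \<Lambda> :: "'p padic^3^3"
    and k1 k2 l1 l2 k q :: nat
  assumes "c1 \<in> padic_units" "c2 \<in> padic_units" "d1 \<in> padic_units" "d2 \<in> padic_units"
    and "\<delta>1 = of_nat CARD('p) ^ k1 * c1" "\<delta>2 = of_nat CARD('p) ^ k2 * c2"
    and "\<epsilon>1 = of_nat CARD('p) ^ l1 * d1" "\<epsilon>2 = of_nat CARD('p) ^ l2 * d2"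
    and "k = Min {k1, k2, l1, l2}"
    and "\<Lambda> = Lambda1 \<delta>1 \<delta>2 \<epsilon>1 \<epsilon>2 \<or> \<Lambda> = Lambda2 \<delta>1 \<delta>2 \<epsilon>1 \<epsilon>2"
    and "lam \<in> padic_units" "det \<Lambda> = of_nat CARD('p) ^ q * lam"
  shows
    "(q = 0 \<longrightarrow>
        (let rows_cols = ((\<forall>i. card {j. \<Lambda> $ i $ j \<in> padic_units} \<ge> 2)
                        \<and> (\<forall>j. card {i. \<Lambda> $ i $ j \<in> padic_units} \<ge> 2))
         in (forces_distributions TYPE('p padic^3) \<Lambda> idempotent_distributions \<longleftrightarrow> rows_cols)
          \<and> (rows_cols \<longrightarrow> forces_distributions TYPE('w) \<Lambda> idempotent_distributions)))
     \<and> (q > 0 \<longrightarrow>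
        (\<delta>1 \<in> padic_units \<or> \<delta>2 \<in> padic_units \<or> \<epsilon>1 \<in> padic_units \<or> \<epsilon>2 \<in> padic_units \<longrightarrow>
          forces_distributions TYPE('w) \<Lambda> degenerate_distributions)
      \<and> (\<delta>1 \<notin> padic_units \<and> \<delta>2 \<notin> padic_units \<and> \<epsilon>1 \<notin> padic_units \<and> \<epsilon>2 \<notin> padic_units \<longrightarrow>
          (let exponents = (q > k \<or> q = k \<and> (k1 = k \<and> l2 = k \<or> k2 = k \<and> l1 = k))
           in (forces_distributions TYPE('p padic^3) \<Lambda> idempotent_distributions \<longleftrightarrow> exponents)
            \<and> (exponents \<longrightarrow> forces_distributions TYPE('w) \<Lambda> idempotent_distributions)
            \<and> (q > k \<longrightarrow> forces_distributions TYPE('w) \<Lambda> degenerate_distributions))))"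
proof -
  interpret normalized_forms \<delta>1 \<delta>2 \<epsilon>1 \<epsilon>2 \<Lambda> k1 k2 l1 l2 k q "1 / real CARD('p)"
    by unfold_locales
      (use assms in \<open>simp_all add: padic_units_iff padic_abs_mult padic_abs_uniformizer_power\<close>)
  note mono = forces_distributions_mono[OF _ degenerate_imp_idempotent]
  have A: "(forces_distributions TYPE('p padic^3) \<Lambda> idempotent_distributions \<longleftrightarrow> rows_cols)
      \<and> (rows_cols \<longrightarrow> forces_distributions TYPE('w) \<Lambda> idempotent_distributions)" if "q = 0"
    using not_forces_rows_cols[OF that] forces_idempotent_rows_cols[OF that, where 'w="'p padic^3"]
      forces_idempotent_rows_cols[OF that, where 'w='w] by blast
  have B1: "forces_distributions TYPE('w) \<Lambda> degenerate_distributions"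
    if "0 < q" "k1 = 0 \<or> k2 = 0 \<or> l1 = 0 \<or> l2 = 0"
    using matrix
  proof
    assume "\<Lambda> = Lambda1 \<delta>1 \<delta>2 \<epsilon>1 \<epsilon>2"
    thus ?thesis using that k_le by (intro forces_degenerate_Lambda1) auto
  qed (use that in \<open>intro forces_degenerate_Lambda2\<close>)
  have B2: "(forces_distributions TYPE('p padic^3) \<Lambda> idempotent_distributions \<longleftrightarrow> exponents)
      \<and> (exponents \<longrightarrow> forces_distributions TYPE('w) \<Lambda> idempotent_distributions)
      \<and> (q > k \<longrightarrow> forces_distributions TYPE('w) \<Lambda> degenerate_distributions)"
    if "0 < q" "k1 \<noteq> 0" "k2 \<noteq> 0" "l1 \<noteq> 0" "l2 \<noteq> 0"
      and exponents: "exponents = (q > k \<or> q = k \<and> (k1 = k \<and> l2 = k \<or> k2 = k \<and> l1 = k))" for exponents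
  proof -
    \<comment> \<open>Without unit coefficients, a non-unit determinant excludes the second
      matrix.\<close>
    have "0 < k" using that k_le(5) by auto
    with that have L: "\<Lambda> = Lambda1 \<delta>1 \<delta>2 \<epsilon>1 \<epsilon>2" by (intro Lambda1_if_no_units)
    note deg = forces_degenerate_Lambda1[OF L]
    note idem = forces_idempotent_Lambda1[OF L]
    show ?thesis
      unfolding exponents
      using k_le_q[OF L] not_forces_exponents[OF L] deg[where 'w='w] mono[OF deg[where 'w='w]]
        mono[OF deg[where 'w="'p padic^3"]] idem[where 'w='w] idem[where 'w="'p padic^3"]
      by (cases "q = k") auto
  qed
  show ?thesis
    unfolding Let_def unit_iffs
    using A[unfolded rows_cols_def] B1 B2[OF _ _ _ _ _ refl] by blast
qed

end
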